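(* Let $K\subset\mathbb{C}^n$ be a nonpluripolar compact set and let $\nu\in\mathcal{M}(K)$ satisfy a strong Bernstein-Markov property. Fix $Q\in C(K)$. Then for any $\mu\in\mathcal{M}(K)$, $$\log\overline J(\mu)=\log\overline W(\mu)=\log\underline J(\mu)=\log\underline W(\mu)=\inf_{v\in C(K)}\Bigl[\log\bar\delta^{v}(K)+\int_K v\,d\mu\Bigr]$$ and $$\log\overline J^Q(\mu)=\log\overline W^Q(\mu)=\log\underline J^Q(\mu)=\log\underline W^Q(\mu)=\inf_{v\in C(K)}\Bigl[\log\bar\delta^{v}(K)+\int_K v\,d\mu\Bigr]-\int_K Q\,d\mu .$$
   Context: $\mathcal{M}(K)$ is the space of Borel probability measures on the compact set $K$, with the weak-* topology; $C(K)$ is the space of real-valued continuous functions on $K$. Convention: $\log 0=-\infty$. For $k=1,2,\dots$ let $\mathcal{P}_k$ be the space of holomorphic polynomials on $\mathbb{C}^n$ of degree at most $k$, $N_k=\dim\mathcal{P}_k=\binom{n+k}{k}$, and let $e_1,\dots,e_{N_k}$ be the standard monomial basis of $\mathcal{P}_k$. Put $$VDM_k(x_1,\dots,x_{N_k})=\det[e_i(x_j)]_{i,j=1,\dots,N_k},$$ $$VDM_k^Q(x_1,\dots,x_{N_k})=VDM_k(x_1,\dots,x_{N_k})\,e^{-kQ(x_1)}\cdots e^{-kQ(x_{N_k})}.$$ The (normalized) weighted transfinite diameter of $K$ with respect to a weight $v$ is $$\bar\delta^{v}(K):=\lim_{k\to\infty}\Bigl(\max_{x_1,\dots,x_{N_k}\in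 K}|VDM_k^{v}(x_1,\dots,x_{N_k})|\Bigr)^{1/(kN_k)};$$ for $K$ nonpluripolar and $v\in C(K)$ this limit is known to exist and to be positive. Strong Bernstein-Markov property: $\nu\in\mathcal{M}(K)$ satisfies it if for every $v\in C(K)$ the triple $(K,\nu,v)$ satisfies a weighted Bernstein-Markov property, i.e., there are constants $M_k$ with $\limsup_{k\to\infty}M_k^{1/k}=1$ such that $\sup_K|e^{-kv}p_k|\le M_k\|e^{-kv}p_k\|_{L^2(\nu)}$ for all $k$ and all $p_k\in\mathcal{P}_k$. For $G\subset\mathcal{M}(K)$ and $s\ge1$ let $\tilde G_s:=\{\mathbf{a}=(a_1,\dots,a_s)\in K^s:\frac1s\sum_{j=1}^s\delta_{a_j}\in G\}$. With $d\nu(\mathbf{a})=d\nu(a_1)\cdots d\nu(a_{N_k})$, set $$J_k(G):=\Bigl[\int_{\tilde G_{N_k}}|VDM_k(\mathbf{a})|^2d\nu(\mathbf{a})\Bigr]^{1/(2kN_k)},\qquad J^Q_k(G):=\Bigl[\int_{\tilde G_{N_k}}|VDM^Q_k(\mathbf{a})|^2d\nu(\mathbf{a})\Bigr]^{1/(2kN_k)},$$ $$W_k(G):=\sup_{\mathbf{a}\in\tilde G_{N_k}}|VDM_k(\mathbf{a})|^{1/(kN_k)},\qquad W_k^Q(G):=\sup_{\mathbf{a}\in\tilde G_{N_k}}|VDM^Q_k(\mathbf{a})|^{1/(kN_k)}$$ (the sup of the empty set is $0$). For each $X\in\{J,W,J^Q,W^Q\}$ define $$\overline X(\mu):=\inf_{G\ni\mu}\limsup_{k\to\infty}X_k(G),\qquad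 \underline X(\mu):=\inf_{G\ni\mu}\liminf_{k\to\infty}X_k(G),$$ where the infima are over all (open) neighborhoods $G$ of $\mu$ in $\mathcal{M}(K)$. *)

theory Defs
  imports "HOL-Probability.Probability" "Jordan_Normal_Form.Determinant"
begin

hide_const (open) Determinants.det
no_notation Matrix.vec_index (infixl "$" 100)

section \<open>Pluripolar sets\<close>

text \<open>
  Integral over \<open>[0, 2\<pi>]\<close> of a function bounded above, with value \<open>-\<infinity>\<close> allowed: the
  integral of the positive part minus that of the negative part. (\<open>e2ennreal\<close> sends negative
  numbers to \<open>0\<close>.) An upper semicontinuous function \<open>< \<infinity>\<close> is bounded above on circles,
  so \<open>\<infinity> - \<infinity>\<close> does not occur below.
\<close>

definition circle_mean :: "(complex \<Rightarrow> ereal) \<Rightarrow> complex \<Rightarrow> real \<Rightarrow> ereal" where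
  "circle_mean u z r =
     (enn2ereal (\<integral>\<^sup>+\<theta>\<in>{0..2*pi}. e2ennreal (u (z + of_real r * cis \<theta>)) \<partial>lborel)
      - enn2ereal (\<integral>\<^sup>+\<theta>\<in>{0..2*pi}. e2ennreal (- u (z + of_real r * cis \<theta>)) \<partial>lborel))
     / ereal (2 * pi)"

definition usc :: "('a::topological_space \<Rightarrow> ereal) \<Rightarrow> bool" where
  "usc u \<longleftrightarrow> (\<forall>c::real. open {x. u x < ereal c})"

text \<open>The constant function \<open>-\<infinity>\<close> is counted as (pluri)subharmonic here; it is excluded in the
  definition of pluripolar sets.\<close>

definition subharmonic :: "(complex \<Rightarrow> ereal) \<Rightarrow> bool" where
  "subharmonic u \<longleftrightarrow> usc u \<and> (\<forall>z. u z < \<infinity>) \<and> (\<forall>z. \<forall>r>0. u z \<le> circle_mean u z r)"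

definition plurisubharmonic :: "(complex ^ 'n \<Rightarrow> ereal) \<Rightarrow> bool" where
  "plurisubharmonic u \<longleftrightarrow>
     usc u \<and> (\<forall>x. u x < \<infinity>) \<and> (\<forall>a b. subharmonic (\<lambda>t. u (a + t *s b)))"

definition pluripolar :: "(complex ^ 'n) set \<Rightarrow> bool" where
  "pluripolar E \<longleftrightarrow>
     (\<exists>u. plurisubharmonic u \<and> (\<exists>x. u x \<noteq> - \<infinity>) \<and> (\<forall>x\<in>E. u x = - \<infinity>))"


section \<open>Polynomials and Vandermonde determinants\<close>

definition multi_indices :: "nat \<Rightarrow> ('n::finite \<Rightarrow> nat) set" where
  "multi_indices k = {\<alpha>. (\<Sum>i\<in>UNIV. \<alpha> i) \<le> k}"

definition monomial :: "('n::finite \<Rightarrow> nat) \<Rightarrow> complex ^ 'n \<Rightarrow> complex" where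
  "monomial \<alpha> x = (\<Prod>i\<in>UNIV. (x $ i) ^ \<alpha> i)"

definition polys :: "nat \<Rightarrow> (complex ^ 'n \<Rightarrow> complex) set" where
  "polys k = {p. \<exists>c. p = (\<lambda>x. \<Sum>\<alpha>\<in>multi_indices k. c \<alpha> * monomial \<alpha> x)}"

text \<open>\<open>N TYPE('n) k\<close> is \<open>N\<^sub>k\<close> for \<open>\<complex>\<^sup>n\<close>.\<close>

definition N :: "'n::finite itself \<Rightarrow> nat \<Rightarrow> nat" where
  "N (T :: 'n itself) k = (CARD('n) + k) choose k"

text \<open>
  Some enumeration of the exponents of degree at most \<open>k\<close> by \<open>0, \<dots>, N\<^sub>k - 1\<close>. Only the modulus
  of the Vandermonde determinant is used, and it does not depend on the enumeration.
\<close>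

definition exponent_enum :: "nat \<Rightarrow> nat \<Rightarrow> ('n::finite \<Rightarrow> nat)" where
  "exponent_enum k = (SOME h. bij_betw h {..<N TYPE('n) k} (multi_indices k))"

lemma bij_betw_multi_indices:
  "\<exists>h. bij_betw h (multi_indices k :: ('n::finite \<Rightarrow> nat) set)
      {l::nat list. length l = CARD('n) + 1 \<and> sum_list l = k}"
proof -
  obtain e where e: "bij_betw e {0..<CARD('n)} (UNIV :: 'n set)"
    using ex_bij_betw_nat_finite[of "UNIV :: 'n set"] by auto
  define f where "f = the_inv_into {0..<CARD('n)} e"
  have f: "e (f i) = i" "f i < CARD('n)" for i
    using e f_the_inv_into_f_bij_betw[OF e] bij_betw_the_inv_into[OF e]
    by (auto simp: f_def bij_betw_def)
  have fe: "f (e j) = j" if "j < CARD('n)" for j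
    using e that by (auto simp: f_def bij_betw_def the_inv_into_f_f)
  have s: "(\<Sum>i\<in>UNIV. \<alpha> i) = (\<Sum>j = 0..<CARD('n). \<alpha> (e j))" for \<alpha> :: "'n \<Rightarrow> nat"
    using sum.reindex_bij_betw[OF e, of \<alpha>] by simp
  have "bij_betw (\<lambda>\<alpha>. map (\<alpha> \<circ> e) [0..<CARD('n)] @ [k - (\<Sum>i\<in>UNIV. \<alpha> i)])
      (multi_indices k :: ('n \<Rightarrow> nat) set)
      {l::nat list. length l = CARD('n) + 1 \<and> sum_list l = k}"
  proof (rule bij_betwI[where g = "\<lambda>l i. l ! f i"], goal_cases)
    case 1
    then show ?case
      by (auto simp: multi_indices_def s sum_list_distinct_conv_sum_set simp flip: interv_sum_list_conv_sum_set_nat)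
  next
    case 2
    show ?case
    proof safe
      fix l :: "nat list" assume l: "length l = CARD('n) + 1" "k = sum_list l"
      have "(\<Sum>i\<in>(UNIV :: 'n set). l ! f i) = (\<Sum>j = 0..<CARD('n). l ! j)"
        unfolding s by (intro sum.cong) (auto simp: fe)
      also have "\<dots> \<le> sum_list l"
        by (simp add: sum_list_sum_nth l)
      finally show "(\<lambda>i::'n. l ! f i) \<in> multi_indices (sum_list l)"
        by (simp add: multi_indices_def)
    qed
  next
    case (3 \<alpha>)
    then show ?case by (auto simp: nth_append f)
  next
    case (4 l)
    then have l: "length l = CARD('n) + 1" "sum_list l = k" by auto
    have "(\<Sum>i\<in>(UNIV :: 'n set). l ! f i) = (\<Sum>j = 0..<CARD('n). l ! j)"
      unfolding s by (intro sum.cong) (auto simp: fe)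
    then have "k - (\<Sum>i\<in>(UNIV :: 'n set). l ! f i) = l ! CARD('n)"
      using l by (simp add: sum_list_sum_nth flip: l(2))
    with l show ?case
      by (intro nth_equalityI) (auto simp: nth_append fe less_Suc_eq)
  qed
  then show ?thesis by blast
qed

lemma exponent_enum_bij:
  "bij_betw (exponent_enum k) {..<N TYPE('n) k} (multi_indices k :: ('n::finite \<Rightarrow> nat) set)"
proof -
  let ?L = "{l::nat list. length l = CARD('n) + 1 \<and> sum_list l = k}"
  obtain h where h: "bij_betw h (multi_indices k :: ('n \<Rightarrow> nat) set) ?L"
    using bij_betw_multi_indices by blast
  have "card ?L = N TYPE('n) k"
    by (simp add: card_length_sum_list N_def add.commute)
  moreover have "N TYPE('n) k > 0" by (simp add: N_def)
  ultimately have "finite ?L" "card ?L = N TYPE('n) k"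
    by (auto intro: card_ge_0_finite)
  then obtain g where "bij_betw g {..<N TYPE('n) k} ?L"
    using ex_bij_betw_nat_finite[of ?L] by (auto simp: atLeast0LessThan)
  then have "bij_betw (the_inv_into (multi_indices k) h \<circ> g) {..<N TYPE('n) k}
      (multi_indices k :: ('n \<Rightarrow> nat) set)"
    using bij_betw_the_inv_into[OF h] bij_betw_trans by blast
  then show ?thesis
    unfolding exponent_enum_def
    by (rule someI[where P = "\<lambda>h. bij_betw h {..<N TYPE('n) k} (multi_indices k)"])
qed

definition VDM :: "nat \<Rightarrow> (nat \<Rightarrow> complex ^ 'n) \<Rightarrow> complex" where
  "VDM k a = Determinant.det
     (mat (N TYPE('n) k) (N TYPE('n) k) (\<lambda>(i, j). monomial (exponent_enum k i) (a j)))"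

definition wVDM :: "(complex ^ 'n \<Rightarrow> real) \<Rightarrow> nat \<Rightarrow> (nat \<Rightarrow> complex ^ 'n) \<Rightarrow> complex" where
  "wVDM Q k a = VDM k a * (\<Prod>j<N TYPE('n) k. of_real (exp (- real k * Q (a j))))"

definition transfinite_diameter :: "(complex ^ 'n) set \<Rightarrow> (complex ^ 'n \<Rightarrow> real) \<Rightarrow> real" where
  "transfinite_diameter K v =
     lim (\<lambda>k. (SUP a\<in>({..<N TYPE('n) k} \<rightarrow>\<^sub>E K). cmod (wVDM v k a))
                powr (1 / (real k * real (N TYPE('n) k))))"


section \<open>Probability measures on a compact set\<close>

text \<open>Elements of \<open>M(K)\<close> are measures whose space is \<open>K\<close> itself, so integrals against them
  are integrals over \<open>K\<close>.\<close>

definition prob_measures :: "'a::topological_space set \<Rightarrow> 'a measure set" where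
  "prob_measures K = {\<mu>. sets \<mu> = sets (restrict_space borel K) \<and> prob_space \<mu>}"

definition weak_star :: "'a::topological_space set \<Rightarrow> 'a measure topology" where
  "weak_star K = topology_generated_by
     {{\<mu> \<in> prob_measures K. (\<integral>x. f x \<partial>\<mu>) \<in> U} | (f :: 'a \<Rightarrow> real) U. continuous_on K f \<and> open U}"

lemma topspace_weak_star: "topspace (weak_star K) = prob_measures K"
proof -
  have "prob_measures K \<in> {{\<mu> \<in> prob_measures K. (\<integral>x. f x \<partial>\<mu>) \<in> U} |
      (f :: 'a \<Rightarrow> real) U. continuous_on K f \<and> open U}"
    by (auto intro!: exI[of _ "\<lambda>_. 0"] exI[of _ UNIV])
  then show ?thesis
    unfolding weak_star_def topology_generated_by_topspace by blast
qed

definition empirical_measure ::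
    "'a::topological_space set \<Rightarrow> nat \<Rightarrow> (nat \<Rightarrow> 'a) \<Rightarrow> 'a measure" where
  "empirical_measure K s a = measure_of K (sets (restrict_space borel K))
     (\<lambda>A. (\<Sum>j<s. emeasure (return (restrict_space borel K) (a j)) A) / of_nat s)"

lemma emeasure_empirical_measure:
  assumes "A \<in> sets (restrict_space borel K)"
  shows "emeasure (empirical_measure K s a) A
    = (\<Sum>j<s. emeasure (return (restrict_space borel K) (a j)) A) / of_nat s"
proof (rule emeasure_measure_of[OF empirical_measure_def])
  let ?S = "sets (restrict_space borel K)"
  let ?m = "\<lambda>A. (\<Sum>j<s. emeasure (return (restrict_space borel K) (a j)) A) / of_nat s"
  show "?S \<subseteq> Pow K"
    using sets.space_closed[of "restrict_space borel K"] by (simp add: space_restrict_space)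
  have "sets (empirical_measure K s a) = ?S"
    unfolding empirical_measure_def
    using sets.sigma_sets_eq[of "restrict_space borel K"]
      sets.space_closed[of "restrict_space borel K"]
    by (simp add: space_restrict_space)
  then show "A \<in> sets (empirical_measure K s a)" using assms by simp
  show "positive (sets (empirical_measure K s a)) ?m"
    by (simp add: positive_def)
  show "countably_additive (sets (empirical_measure K s a)) ?m"
  proof (rule countably_additiveI)
    fix B :: "nat \<Rightarrow> 'a set"
    assume B: "range B \<subseteq> sets (empirical_measure K s a)" "disjoint_family B"
    have "(\<Sum>i. emeasure (return (restrict_space borel K) (a j)) (B i))
        = emeasure (return (restrict_space borel K) (a j)) (\<Union>i. B i)" for j
      using B \<open>sets (empirical_measure K s a) = ?S\<close>
      by (intro suminf_emeasure) auto
    then have "(\<Sum>i. \<Sum>j<s. emeasure (return (restrict_space borel K) (a j)) (B i))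
        = (\<Sum>j<s. emeasure (return (restrict_space borel K) (a j)) (\<Union>i. B i))"
      by (subst suminf_sum) auto
    then show "(\<Sum>i. ?m (B i)) = ?m (\<Union>i. B i)"
      by (simp add: divide_ennreal_def)
  qed
qed

lemma empirical_measure_in_prob_measures:
  assumes "s \<ge> 1" "\<And>j. j < s \<Longrightarrow> a j \<in> K"
  shows "empirical_measure K s a \<in> prob_measures K"
proof -
  have S: "sets (empirical_measure K s a) = sets (restrict_space borel K)"
    unfolding empirical_measure_def
    using sets.sigma_sets_eq[of "restrict_space borel K"]
      sets.space_closed[of "restrict_space borel K"]
    by (simp add: space_restrict_space)
  then have sp: "space (empirical_measure K s a) = K"
    using sets_eq_imp_space_eq[OF S] by (simp add: space_restrict_space)
  have K: "K \<in> sets (restrict_space borel K)"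
    using sets.top[of "restrict_space borel K"] by (simp add: space_restrict_space)
  have "emeasure (empirical_measure K s a) K = (\<Sum>j<s. 1) / of_nat s"
    unfolding emeasure_empirical_measure[OF K] using assms K by simp
  also have "\<dots> = 1"
    using assms(1) ennreal_divide_self[of "of_nat s"] by (simp add: of_nat_less_top)
  finally show ?thesis
    using S sp by (auto simp: prob_measures_def intro: prob_spaceI)
qed

definition tilde :: "'a::topological_space set \<Rightarrow> 'a measure set \<Rightarrow> nat \<Rightarrow> (nat \<Rightarrow> 'a) set" where
  "tilde K G s = {a \<in> {..<s} \<rightarrow>\<^sub>E K. empirical_measure K s a \<in> G}"

definition weighted_BM ::
    "(complex ^ 'n) set \<Rightarrow> (complex ^ 'n) measure \<Rightarrow> (complex ^ 'n \<Rightarrow> real) \<Rightarrow> bool" where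
  "weighted_BM K \<nu> v \<longleftrightarrow>
     (\<exists>M :: nat \<Rightarrow> real. limsup (\<lambda>k. ereal (root k (M k))) = 1 \<and>
       (\<forall>k\<ge>1. \<forall>p\<in>polys k.
          (SUP x\<in>K. cmod (of_real (exp (- real k * v x)) * p x))
          \<le> M k * sqrt (\<integral>x. (cmod (of_real (exp (- real k * v x)) * p x))\<^sup>2 \<partial>\<nu>)))"

definition strong_BM :: "(complex ^ 'n) set \<Rightarrow> (complex ^ 'n) measure \<Rightarrow> bool" where
  "strong_BM K \<nu> \<longleftrightarrow> \<nu> \<in> prob_measures K \<and> (\<forall>v. continuous_on K v \<longrightarrow> weighted_BM K \<nu> v)"


section \<open>The functionals\<close>

text \<open>
  In \<open>J\<close> and \<open>W\<close> the argument \<open>V\<close> is \<open>VDM\<close> or \<open>wVDM Q\<close>; this yields the unweighted and the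
  weighted functionals. Values are in \<open>ennreal\<close>, where the supremum of the empty set is \<open>0\<close>.
\<close>

definition J :: "(complex ^ 'n) set \<Rightarrow> (complex ^ 'n) measure \<Rightarrow>
    (nat \<Rightarrow> (nat \<Rightarrow> complex ^ 'n) \<Rightarrow> complex) \<Rightarrow> nat \<Rightarrow> (complex ^ 'n) measure set \<Rightarrow> ennreal" where
  "J K \<nu> V k G = ennreal
     ((LINT a:tilde K G (N TYPE('n) k)|(Pi\<^sub>M {..<N TYPE('n) k} (\<lambda>_. \<nu>)). (cmod (V k a))\<^sup>2)
        powr (1 / (2 * real k * real (N TYPE('n) k))))"

definition W :: "(complex ^ 'n) set \<Rightarrow>
    (nat \<Rightarrow> (nat \<Rightarrow> complex ^ 'n) \<Rightarrow> complex) \<Rightarrow> nat \<Rightarrow> (complex ^ 'n) measure set \<Rightarrow> ennreal" where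
  "W K V k G = (SUP a\<in>tilde K G (N TYPE('n) k).
     ennreal (cmod (V k a) powr (1 / (real k * real (N TYPE('n) k)))))"

definition upper :: "'a::topological_space set \<Rightarrow> (nat \<Rightarrow> 'a measure set \<Rightarrow> ennreal) \<Rightarrow>
    'a measure \<Rightarrow> ennreal" where
  "upper K X \<mu> = (INF G\<in>{G. openin (weak_star K) G \<and> \<mu> \<in> G}. limsup (\<lambda>k. X k G))"

definition lower :: "'a::topological_space set \<Rightarrow> (nat \<Rightarrow> 'a measure set \<Rightarrow> ennreal) \<Rightarrow>
    'a measure \<Rightarrow> ennreal" where
  "lower K X \<mu> = (INF G\<in>{G. openin (weak_star K) G \<and> \<mu> \<in> G}. liminf (\<lambda>k. X k G))"

definition elog :: "ennreal \<Rightarrow> ereal" where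
  "elog x = (if x = 0 then - \<infinity> else if x = \<infinity> then \<infinity> else ereal (ln (enn2real x)))"

end

theory Submission
  imports Defs "HOL-Computational_Algebra.Polynomial" "HOL-Real_Asymp.Real_Asymp"
begin

text \<open>
  No pluripotential theory is used. For orthogonal monic weighted polynomials, indexed by a monomial
  order, the integral of \<open>|wVDM v k|\<^sup>2\<close> is \<open>N!\<close> times the product of their squared norms, and the
  Bernstein-Markov property compares these norms with Chebyshev constants, which are submultiplicative
  in the pair (degree, exponent). A splitting of uniformly random exponents makes the logarithms of
  their geometric means subadditive in \<open>k\<close>, and Fekete's lemma gives the existence of the weighted
  transfinite diameter.

  The upper bound for \<open>W\<close> is immediate. For the lower bound for \<open>J\<close>, the minimality of the orthogonal
  polynomials shows that the Laplace transform of a linear statistic under the density \<open>|wVDM v k|\<^sup>2\<close>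
  is at most that of a sum of \<open>N\<close> independent bounded variables, so empirical measures concentrate.
  Given finitely many test functions, choose \<open>v\<close> in their span (plus \<open>Q\<close>) as an almost minimizer of
  the free energy with a small quadratic penalty. Then the mean of every test function is almost its
  \<open>\<mu>\<close>-integral, and the tilted measure charges the prescribed neighbourhood of \<open>\<mu>\<close>.
\<close>

section \<open>Averages over compositions and submultiplicative sequences\<close>

text \<open>The obstacle in the lower bound is that a minimizing weight need not exist and that the
  limiting free energy would have to be differentiated. Both are avoided by minimizing at each
  finite degree k, on the normalized logarithm of \<open>Z\<close> itself: near minimality tested
  with a displacement of order 1/k replaces the derivative, and the Laplace transform bound controls
  the second order error. The limit in k enters as a pointwise limit of free energies, which
  Lipschitz continuity turns into lower bounds uniform on bounded sets of coefficients. The penalty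
  has two tasks: it confines near minimizers to a box independent of k, and its strength is tuned so
  that the bias it puts on the means stays below the size of the neighbourhood. The argument runs
  for general \<open>Q\<close> and in multiplicative form with values in \<open>ennreal\<close>,
  where a vanishing infimum causes no trouble. The unweighted statement is the case \<open>Q\<close>
  = 0, and logarithms of the functionals are taken only at the end.\<close>

definition compositions :: "'m set \<Rightarrow> nat \<Rightarrow> ('m \<Rightarrow> nat) set" where
  "compositions I k = {f. (\<forall>i. i \<notin> I \<longrightarrow> f i = 0) \<and> sum f I = k}"

lemma compositions_empty: "compositions {} k = (if k = 0 then {\<lambda>_. 0} else {})"
  by (auto simp: compositions_def)

lemma compositions_insert:
  fixes I :: "'m set"
  assumes "finite I" "x \<notin> I"
  shows "bij_betw (\<lambda>(j, f). f(x := j)) (SIGMA j:{..k}. compositions I (k - j))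
           (compositions (insert x I) k)"
proof (rule bij_betwI[where g = "\<lambda>f. (f x, f(x := 0))"], goal_cases)
  have upd: "(\<Sum>i\<in>I. if i = x then j else f i) = sum f I" for f :: "'m \<Rightarrow> nat" and j
    using assms(2) by (intro sum.cong) auto
  {
    case 1
    show ?case using assms by (auto simp: compositions_def upd)
  next
    case 2
    show ?case using assms by (auto simp: compositions_def upd)
  next
    case (3 p)
    then show ?case using assms by (auto simp: compositions_def fun_eq_iff split: if_splits)
  next
    case (4 f)
    then show ?case by auto
  }
qed

lemma finite_compositions: "finite I \<Longrightarrow> finite (compositions I k)"
proof (induction I arbitrary: k rule: finite_induct)
  case empty
  then show ?case by (simp add: compositions_empty)
next
  case (insert x I)
  then show ?case
    using bij_betw_finite[OF compositions_insert[OF insert.hyps, of k]] by auto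
qed

lemma sum_compositions_insert:
  assumes "finite I" "x \<notin> I"
  shows "(\<Sum>f\<in>compositions (insert x I) k. g f)
    = (\<Sum>j\<le>k. \<Sum>f\<in>compositions I (k - j). g (f(x := j)) :: 'b::comm_monoid_add)"
proof -
  have "(\<Sum>f\<in>compositions (insert x I) k. g f)
      = (\<Sum>p\<in>(SIGMA j:{..k}. compositions I (k - j)). g (case p of (j, f) \<Rightarrow> f(x := j)))"
    by (rule sum.reindex_bij_betw[OF compositions_insert[OF assms], symmetric])
  also have "\<dots> = (\<Sum>j\<le>k. \<Sum>f\<in>compositions I (k - j). g (f(x := j)))"
    by (subst sum.Sigma) (auto simp: assms(1) finite_compositions intro!: sum.cong)
  finally show ?thesis .
qed

text \<open>Both sides count the k-element subsets of a disjoint union of blocks of sizes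
  \<open>a i\<close>, sorted on the left by the number of elements in each block. The induction
  splits off one block by Vandermonde's identity.\<close>

lemma sum_compositions_choose:
  fixes a :: "'m \<Rightarrow> nat"
  assumes "finite I"
  shows "(\<Sum>f\<in>compositions I k. \<Prod>i\<in>I. a i choose f i) = (sum a I choose k)"
  using assms
proof (induction I arbitrary: k rule: finite_induct)
  case empty
  then show ?case by (simp add: compositions_empty)
next
  case (insert x I)
  have "(\<Sum>f\<in>compositions (insert x I) k. \<Prod>i\<in>insert x I. a i choose f i)
      = (\<Sum>j\<le>k. \<Sum>f\<in>compositions I (k - j). (a x choose j) * (\<Prod>i\<in>I. a i choose f i))"
    unfolding sum_compositions_insert[OF insert.hyps]
  proof (intro sum.cong refl, goal_cases)
    case (1 j f)
    have "(\<Prod>i\<in>I. a i choose (f(x := j)) i) = (\<Prod>i\<in>I. a i choose f i)"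
      using insert.hyps by (intro prod.cong) auto
    then show ?case using insert.hyps by simp
  qed
  also have "\<dots> = (sum a (insert x I) choose k)"
    using insert by (simp add: vandermonde flip: sum_distrib_left)
  finally show ?case .
qed

text \<open>Coefficient of x^l in (1-x)^(-(b+1)) times (1-x)^(-(c+1)). Upper negation
  (\<open>neg\<close>) rewrites each factor as a generalized binomial coefficient with negative
  upper entry, and Vandermonde's identity for these finishes.\<close>

lemma sum_choose_convolution:
  "(\<Sum>j\<le>l. (b + j choose j) * (c + (l - j) choose (l - j))) = (b + c + 1 + l choose l)"
proof -
  have neg: "of_nat (n + j choose j) = (- 1) ^ j * ((- of_nat (n + 1)) gchoose j :: real)" for n j
  proof -
    have "- of_nat (n + 1) gchoose j = (- 1) ^ j * (of_nat (n + j) gchoose j :: real)"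
      using gbinomial_minus[of "real (n + 1)" j] by (simp add: add.commute)
    then show ?thesis by (simp add: binomial_gbinomial flip: power_mult_distrib mult.assoc)
  qed
  have "real (\<Sum>j\<le>l. (b + j choose j) * (c + (l - j) choose (l - j)))
      = (\<Sum>j\<le>l. (- 1) ^ l * (((- of_nat (b + 1)) gchoose j) * ((- of_nat (c + 1)) gchoose (l - j))))"
    unfolding of_nat_sum of_nat_mult neg
    by (intro sum.cong) (auto simp: power_add[symmetric])
  also have "\<dots> = (- 1) ^ l * ((- of_nat (b + 1) + - of_nat (c + 1)) gchoose l)"
    by (simp only: gbinomial_Vandermonde[symmetric] sum_distrib_left atLeast0AtMost)
  also have "\<dots> = real (b + c + 1 + l choose l)"
    unfolding neg by simp
  finally show ?thesis using of_nat_eq_iff by blast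
qed

text \<open>Coefficient of x^l in the product over I of (1-x)^(-(b i + 1)). For b = 0 it is the
  number of compositions; for general b it normalizes the urn weights below.\<close>

lemma sum_compositions_multichoose:
  fixes b :: "'m \<Rightarrow> nat"
  assumes "finite I" "I \<noteq> {}"
  shows "(\<Sum>f\<in>compositions I l. \<Prod>i\<in>I. b i + f i choose f i) = (sum b I + (card I - 1) + l choose l)"
  using assms
proof (induction I arbitrary: l rule: finite_ne_induct)
  case (singleton x)
  have "compositions {x} l = {(\<lambda>_. 0)(x := l)}"
    by (auto simp: compositions_def fun_eq_iff)
  then show ?case by simp
next
  case (insert x I)
  have "(\<Sum>f\<in>compositions (insert x I) l. \<Prod>i\<in>insert x I. b i + f i choose f i)
      = (\<Sum>j\<le>l. \<Sum>f\<in>compositions I (l - j). (b x + j choose j) * (\<Prod>i\<in>I. b i + f i choose f i))"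
    unfolding sum_compositions_insert[OF insert.hyps(1) insert.hyps(3)]
  proof (intro sum.cong refl, goal_cases)
    case (1 j f)
    have "(\<Prod>i\<in>I. b i + (f(x := j)) i choose (f(x := j)) i) = (\<Prod>i\<in>I. b i + f i choose f i)"
      using insert.hyps by (intro prod.cong) auto
    then show ?case using insert.hyps by simp
  qed
  also have "\<dots> = (b x + (sum b I + (card I - 1)) + 1 + l choose l)"
    unfolding sum_choose_convolution[symmetric] by (simp only: insert.IH flip: sum_distrib_left)
  also have "b x + (sum b I + (card I - 1)) + 1 + l = sum b (insert x I) + (card (insert x I) - 1) + l"
    using insert.hyps card_gt_0_iff[of I] by simp
  finally show ?case .
qed

lemma card_compositions_UNIV:
  "card (compositions (UNIV :: 'm::finite set) k) = (CARD('m) - 1 + k choose k)"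
  using sum_compositions_multichoose[of "UNIV :: 'm set" "\<lambda>_. 0" k] by simp

text \<open>
  The two averages on the right are marginals of the Polya-urn splitting of a uniformly random
  composition of \<open>k + l\<close>: given \<open>f\<close>, the part \<open>b\<close> is chosen with probability proportional to
  \<open>\<Prod>i. f i choose b i\<close>, and then \<open>b\<close> and \<open>f - b\<close> are again uniformly distributed.
\<close>

lemma average_subadditive:
  fixes A :: "('m::finite \<Rightarrow> nat) \<Rightarrow> real"
  assumes sub: "\<And>f g. A (\<lambda>i. f i + g i) \<le> A f + A g"
  defines "C k \<equiv> compositions (UNIV :: 'm set) k"
  shows "(\<Sum>f\<in>C (k + l). A f) / card (C (k + l))
    \<le> (\<Sum>f\<in>C k. A f) / card (C k) + (\<Sum>f\<in>C l. A f) / card (C l)"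
proof -
  define n where "n = CARD('m) - 1"
  have fin: "finite (C k)" for k by (simp add: C_def finite_compositions)
  have mem: "f \<in> C k \<longleftrightarrow> sum f UNIV = k" for f k by (simp add: C_def compositions_def)
  have card: "card (C k) = (n + k choose k)" for k
    by (simp add: C_def n_def card_compositions_UNIV)
  \<comment> \<open>Weight of the splitting of b + g into b and g. It is symmetric, and by
    \<open>w_sum\<close> its sum over either argument does not depend on the other one; this
    constancy is what makes both marginals uniform.\<close>
  define w :: "('m \<Rightarrow> nat) \<Rightarrow> ('m \<Rightarrow> nat) \<Rightarrow> nat" where "w b g = (\<Prod>i\<in>UNIV. b i + g i choose g i)" for b g
  have w_sym: "w b g = w g b" for b g
    unfolding w_def by (intro prod.cong refl) (metis add.commute add_diff_cancel_right' binomial_symmetric le_add2)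
  have w_sum: "(\<Sum>g\<in>C l. w b g) = (k + n + l choose l)" if "b \<in> C k" for b k l
    using sum_compositions_multichoose[of "UNIV :: 'm set" b l] that
    by (simp add: w_def C_def n_def mem compositions_def)
  have reindex: "(\<Sum>f\<in>C (k + l). real (\<Prod>i\<in>UNIV. f i choose b i) * A f)
      = (\<Sum>g\<in>C l. real (w b g) * A (\<lambda>i. b i + g i))" if b: "b \<in> C k" for b
  proof -
    have inj: "inj_on (\<lambda>g i. b i + g i) (C l)" by (auto simp: inj_on_def fun_eq_iff)
    have sub: "(\<lambda>g i. b i + g i) ` C l \<subseteq> C (k + l)"
      using b by (auto simp: mem sum.distrib)
    \<comment> \<open>If f lies below b at some index, a binomial coefficient with too large a lower
      entry makes the term 0; otherwise f - b is a composition of l and f is in the image.\<close>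
    have zero: "real (\<Prod>i\<in>UNIV. f i choose b i) * A f = 0"
      if f: "f \<in> C (k + l) - (\<lambda>g i. b i + g i) ` C l" for f
    proof -
      have "\<exists>i. f i < b i"
      proof (rule ccontr)
        assume "\<not> ?thesis"
        then have le: "b i \<le> f i" for i by (simp add: not_less)
        have "sum f UNIV = (\<Sum>i\<in>UNIV. b i + (f i - b i))" using le by simp
        then have "(\<lambda>i. f i - b i) \<in> C l" using b f by (simp add: mem sum.distrib)
        moreover have "f = (\<lambda>i. b i + (f i - b i))" using le by auto
        ultimately have "f \<in> (\<lambda>g i. b i + g i) ` C l" 
          by (intro image_eqI[where x = "\<lambda>i. f i - b i"])
        then show False using f by simp
      qed
      then show ?thesis by (simp add: prod_zero_iff binomial_eq_0_iff)
    qed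
    have "(\<Sum>f\<in>C (k + l). real (\<Prod>i\<in>UNIV. f i choose b i) * A f)
        = (\<Sum>f\<in>(\<lambda>g i. b i + g i) ` C l. real (\<Prod>i\<in>UNIV. f i choose b i) * A f)"
      by (rule sum.mono_neutral_right[OF fin sub]) (use zero in auto)
    also have "\<dots> = (\<Sum>g\<in>C l. real (w g b) * A (\<lambda>i. b i + g i))"
      by (subst sum.reindex[OF inj]) (simp add: w_def add.commute)
    finally show ?thesis by (simp add: w_sym)
  qed
  \<comment> \<open>Double counting: for fixed f the weights of all parts b sum to a constant, so
    the sum over f becomes a sum over splittings, to each of which subadditivity applies.\<close>
  have "real (k + l choose k) * (\<Sum>f\<in>C (k + l). A f)
      = (\<Sum>f\<in>C (k + l). \<Sum>b\<in>C k. real (\<Prod>i\<in>UNIV. f i choose b i) * A f)"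
    unfolding sum_distrib_left
  proof (intro sum.cong refl)
    fix f assume "f \<in> C (k + l)"
    then have "(\<Sum>b\<in>C k. \<Prod>i\<in>UNIV. f i choose b i) = (k + l choose k)"
      using sum_compositions_choose[of "UNIV :: 'm set" f k] by (simp add: C_def mem compositions_def)
    then show "real (k + l choose k) * A f = (\<Sum>b\<in>C k. real (\<Prod>i\<in>UNIV. f i choose b i) * A f)"
      by (metis of_nat_sum sum_distrib_right)
  qed
  also have "\<dots> = (\<Sum>b\<in>C k. \<Sum>f\<in>C (k + l). real (\<Prod>i\<in>UNIV. f i choose b i) * A f)"
    by (rule sum.swap)
  also have "\<dots> = (\<Sum>b\<in>C k. \<Sum>g\<in>C l. real (w b g) * A (\<lambda>i. b i + g i))"
    by (intro sum.cong refl reindex)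
  also have "\<dots> \<le> (\<Sum>b\<in>C k. \<Sum>g\<in>C l. real (w b g) * (A b + A g))"
    by (intro sum_mono mult_left_mono sub) auto
  also have "\<dots> = (\<Sum>b\<in>C k. \<Sum>g\<in>C l. real (w b g) * A b) + (\<Sum>g\<in>C l. \<Sum>b\<in>C k. real (w b g) * A g)"
    by (subst (2) sum.swap) (simp add: distrib_left sum.distrib)
  also have "(\<Sum>b\<in>C k. \<Sum>g\<in>C l. real (w b g) * A b) = (\<Sum>b\<in>C k. real (k + n + l choose l) * A b)"
    by (intro sum.cong refl) (simp only: w_sum[symmetric] of_nat_sum sum_distrib_right)
  also have "(\<Sum>g\<in>C l. \<Sum>b\<in>C k. real (w b g) * A g) = (\<Sum>g\<in>C l. real (l + n + k choose k) * A g)"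
    by (intro sum.cong refl) (simp only: w_sum[symmetric] of_nat_sum sum_distrib_right w_sym[of _ g for g])
  finally have main: "real (k + l choose k) * (\<Sum>f\<in>C (k + l). A f)
      \<le> real (k + n + l choose l) * (\<Sum>f\<in>C k. A f) + real (l + n + k choose k) * (\<Sum>f\<in>C l. A f)"
    by (simp add: sum_distrib_left)
  \<comment> \<open>Choosing k + l elements and then l of them is the same as choosing l first and k
    from the rest. Hence both row sums, divided by the number of compositions of k + l, give the
    plain averages.\<close>
  have ratio: "real (k + n + l choose l)
      = real (k + l choose k) * real (n + (k + l) choose (k + l)) / real (n + k choose k)" for k l
  proof -
    have "(n + (k + l) choose (k + l)) * (k + l choose l) = (n + (k + l) choose l) * (n + k choose k)"
      using choose_mult[of l "k + l" "n + (k + l)"] by simp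
    moreover have "(k + l choose l) = (k + l choose k)"
      using binomial_symmetric[of k "k + l"] by simp
    moreover have "n + (k + l) = k + n + l" by simp
    ultimately have "real (n + (k + l) choose (k + l)) * real (k + l choose k)
        = real (k + n + l choose l) * real (n + k choose k)"
      by (simp only: of_nat_mult[symmetric])
    then show ?thesis by (simp add: field_simps)
  qed
  define c D X where "c = real (k + l choose k)" and "D = real (n + (k + l) choose (k + l))"
    and "X = (\<Sum>f\<in>C k. A f) / real (n + k choose k) + (\<Sum>f\<in>C l. A f) / real (n + l choose l)"
  have cpos: "c > 0" and Dpos: "D > 0" by (simp_all add: c_def D_def)
  have c': "real (k + l choose l) = c"
    using binomial_symmetric[of k "k + l"] by (simp add: c_def)
  have "c * (\<Sum>f\<in>C (k + l). A f) \<le> c * (D * X)"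
  proof -
    have "real (k + n + l choose l) = c * D / real (n + k choose k)"
      by (simp only: ratio[of k l] c_def D_def)
    moreover have "real (l + n + k choose k) = c * D / real (n + l choose l)"
      by (simp only: ratio[of l k] c' D_def add.commute[of l k])
    ultimately have "c * (\<Sum>f\<in>C (k + l). A f)
        \<le> c * D / real (n + k choose k) * (\<Sum>f\<in>C k. A f) + c * D / real (n + l choose l) * (\<Sum>f\<in>C l. A f)"
      using main by (simp only: c_def)
    also have "\<dots> = c * (D * X)" by (simp add: X_def distrib_left)
    finally show ?thesis .
  qed
  then have "(\<Sum>f\<in>C (k + l). A f) \<le> D * X"
    using cpos by simp
  then have "(\<Sum>f\<in>C (k + l). A f) / D \<le> X"
    using Dpos by (simp add: pos_divide_le_eq mult.commute)
  then show ?thesis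
    unfolding card X_def D_def .
qed

text \<open>Fekete's lemma in multiplicative form, which admits zero values; the limit is the
  infimum over n at least 1. For the upper estimate, n is divided by an m whose root is almost the
  infimum.\<close>

lemma submultiplicative_root_convergent:
  fixes c :: "nat \<Rightarrow> real"
  assumes nonneg: "\<And>n. c n \<ge> 0" and sub: "\<And>m n. c (m + n) \<le> c m * c n"
  shows "convergent (\<lambda>n. c n powr (1 / real n))"
proof -
  define x where "x n = c n powr (1 / real n)" for n
  define L where "L = (INF n\<in>{1..}. x n)"
  have bdd: "bdd_below (x ` {1..})" by (auto simp: x_def bdd_below_def intro!: exI[of _ 0])
  have L_le: "L \<le> x n" if "n \<ge> 1" for n
    unfolding L_def using bdd that by (intro cINF_lower) auto
  have "x \<longlonglongrightarrow> L"
  proof (rule order_tendstoI)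
    fix a assume "a < L"
    then have "a < x n" if "n \<ge> 1" for n using L_le[OF that] by linarith
    then show "\<forall>\<^sub>F n in sequentially. a < x n" by (rule eventually_sequentiallyI)
  next
    fix a assume "L < a"
    obtain y where y: "L < y" "y < a" using dense[OF \<open>L < a\<close>] by blast
    obtain m where m: "m \<ge> 1" "x m < y"
      using y(1) unfolding L_def by (subst (asm) cINF_less_iff[OF _ bdd]) auto
    have ypos: "y > 0" using m(2) by (auto simp: x_def intro: le_less_trans[rotated])
    have cm: "c m \<le> y ^ m"
    proof (cases "c m = 0")
      case False
      then have "c m = x m powr real m" using m nonneg[of m] by (simp add: x_def powr_powr)
      also have "\<dots> \<le> y powr real m" using m by (intro powr_mono2) (auto simp: x_def)
      finally show ?thesis using ypos by (simp add: powr_realpow)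
    qed (use ypos in simp)
    \<comment> \<open>B absorbs the remainder r below m. Inserting 1 keeps B positive, so that its
      n-th root tends to 1.\<close>
    define B where "B = Max (insert 1 (c ` {..<m}))"
    have B1: "B \<ge> 1" by (simp add: B_def)
    have B: "c r \<le> B" if "r < m" for r using that by (simp add: B_def)
    have cq: "c (q * m + r) \<le> y ^ (q * m) * B" if "r < m" for q r
    proof (induction q)
      case (Suc q)
      have "c (Suc q * m + r) \<le> c m * c (q * m + r)" using sub[of m "q * m + r"] by (simp add: add.assoc)
      also have "\<dots> \<le> y ^ m * (y ^ (q * m) * B)"
        using Suc cm ypos nonneg by (intro mult_mono) auto
      finally show ?case by (simp add: power_add)
    qed (use B[OF that] in simp)
    \<comment> \<open>The estimate contains y to the power -(r/n) with r depending on n. The maximum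
      bounds it independently of r, whether y is above or below 1, and tends to 1.\<close>
    define h where "h n = y * max 1 (y powr (- (real m / real n))) * B powr (1 / real n)" for n
    have "h \<longlonglongrightarrow> y * max 1 (y powr (- 0)) * B powr 0"
      unfolding h_def using ypos B1
      by (intro tendsto_intros tendsto_max lim_const_over_n lim_1_over_n) auto
    then have "h \<longlonglongrightarrow> y" using ypos B1 by simp
    then have ev: "\<forall>\<^sub>F n in sequentially. h n < a" using y(2) by (rule order_tendstoD)
    have le: "x n \<le> h n" if n: "n \<ge> 1" for n
    proof -
      define q r where "q = n div m" and "r = n mod m"
      have n_eq: "n = q * m + r" and r: "r < m" using m by (auto simp: q_def r_def)
      have "x n \<le> (y ^ (q * m) * B) powr (1 / real n)"
        unfolding x_def using cq[OF r, of q] nonneg by (intro powr_mono2) (auto simp: n_eq)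
      also have "\<dots> = y powr (real (q * m) / real n) * B powr (1 / real n)"
        using ypos B1 by (simp add: powr_mult powr_powr flip: powr_realpow)
      also have "real (q * m) / real n = 1 - real r / real n"
      proof -
        have "real (q * m) = real n - real r" by (simp add: n_eq)
        then show ?thesis using n by (simp add: diff_divide_distrib)
      qed
      finally have x_le: "x n \<le> y powr (1 - real r / real n) * B powr (1 / real n)" .
      have "y powr (1 - real r / real n) = y * y powr (- (real r / real n))"
        using ypos powr_add[of y 1 "- (real r / real n)"] by simp
      also have "\<dots> \<le> y * max 1 (y powr (- (real m / real n)))"
      proof (intro mult_left_mono)
        show "y powr (- (real r / real n)) \<le> max 1 (y powr (- (real m / real n)))"
        proof (cases "y \<ge> 1")
          case True
          then have "y powr (- (real r / real n)) \<le> y powr 0" by (intro powr_mono) auto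
          then show ?thesis using True by simp
        next
          case False
          then have "y powr (- (real r / real n)) \<le> y powr (- (real m / real n))"
            using ypos r by (intro powr_mono') (auto simp: divide_right_mono)
          then show ?thesis by simp
        qed
      qed (use ypos in simp)
      finally have "y powr (1 - real r / real n) * B powr (1 / real n) \<le> h n"
        unfolding h_def by (rule mult_right_mono) simp
      with x_le show ?thesis by (rule order_trans)
    qed
    show "\<forall>\<^sub>F n in sequentially. x n < a"
      using ev eventually_ge_at_top[of 1]
    proof eventually_elim
      case (elim n)
      show ?case using le[OF elim(2)] elim(1) by linarith
    qed
  qed
  then show ?thesis unfolding x_def by (auto intro: convergentI)
qed

section \<open>Gram-Schmidt orthogonalization and determinants\<close>

text \<open>Functions index the rows, points the columns. Weighted Vandermonde determinants are the
  special case of weighted monomials; the general form is needed to pass to orthogonalized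
  functions.\<close>

definition slater :: "nat \<Rightarrow> (nat \<Rightarrow> 'a \<Rightarrow> complex) \<Rightarrow> (nat \<Rightarrow> 'a) \<Rightarrow> complex" where
  "slater n \<phi> a = Determinant.det (mat n n (\<lambda>(i, j). \<phi> i (a j)))"

lemma slater_leibniz:
  "slater n \<phi> a = (\<Sum>p | p permutes {0..<n}. signof p * (\<Prod>j<n. \<phi> (p j) (a j)))"
proof -
  have "slater n \<phi> a = (\<Sum>p | p permutes {0..<n}. signof p *
      (\<Prod>j<n. mat n n (\<lambda>(i, j). \<phi> i (a j)) $$ (p j, j)))"
    unfolding slater_def by (rule det_col) simp
  also have "\<dots> = (\<Sum>p | p permutes {0..<n}. signof p * (\<Prod>j<n. \<phi> (p j) (a j)))"
  proof (intro sum.cong refl arg_cong2[where f = "(*)"] prod.cong, goal_cases)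
    case (1 p j)
    then have "p j < n" using permutes_in_image[of p "{0..<n}" j] by auto
    with 1 show ?case by simp
  qed
  finally show ?thesis .
qed

lemma slater_mult:
  "slater n (\<lambda>i x. \<phi> i x * w x) a = slater n \<phi> a * (\<Prod>j<n. w (a j))"
  by (simp add: slater_leibniz prod.distrib sum_distrib_right mult.assoc)

text \<open>Adding to each function a combination of earlier ones multiplies the matrix from the
  left by a lower triangular matrix with unit diagonal.\<close>

lemma slater_unitriangular:
  assumes "\<And>i x. i < n \<Longrightarrow> \<psi> i x = \<phi> i x + (\<Sum>j<i. c i j * \<phi> j x)"
  shows "slater n \<psi> a = slater n \<phi> a"
proof -
  define L where "L = mat n n (\<lambda>(i, j). if i = j then 1 else if j < i then c i j else 0)"
  let ?A = "mat n n (\<lambda>(i, j). \<phi> i (a j))"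
  have L: "L \<in> carrier_mat n n" by (simp add: L_def)
  have "mat n n (\<lambda>(i, j). \<psi> i (a j)) = L * ?A"
  proof (rule eq_matI, goal_cases)
    case (1 i j)
    then have ij: "i < n" "j < n" by (simp_all add: L_def)
    have "(L * ?A) $$ (i, j) = (\<Sum>l\<in>{0..<n}. L $$ (i, l) * \<phi> l (a j))"
      using ij by (simp add: L_def scalar_prod_def)
    also have "\<dots> = (\<Sum>l\<in>insert i {..<i}. L $$ (i, l) * \<phi> l (a j))"
      using ij by (intro sum.mono_neutral_right) (auto simp: L_def)
    also have "\<dots> = \<psi> i (a j)"
      using ij assms by (simp add: L_def)
    finally show ?case using ij by simp
  qed (simp_all add: L_def)
  moreover have "Determinant.det L = 1"
  proof -
    have "Determinant.det L = prod_list (diag_mat L)"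
      by (rule det_lower_triangular[OF _ L]) (simp add: L_def)
    also have "diag_mat L = replicate n 1"
      by (intro nth_equalityI) (auto simp: diag_mat_def L_def)
    finally show ?thesis by simp
  qed
  ultimately show ?thesis
    unfolding slater_def by (simp add: det_mult[OF L])
qed

text \<open>Two enumerations of one index set differ by a permutation, which changes only the sign.
  This allows the arbitrary \<open>exponent_enum\<close> to be traded for an enumeration along the
  monomial order.\<close>

lemma cmod_slater_reindex:
  assumes h: "bij_betw h {..<n} S" and h': "bij_betw h' {..<n} S"
  shows "cmod (slater n (\<lambda>i. \<phi> (h i)) a) = cmod (slater n (\<lambda>i. \<phi> (h' i)) a)"
proof -
  define p where "p i = (if i < n then the_inv_into {..<n} h' (h i) else i)" for i
  have "bij_betw (the_inv_into {..<n} h' \<circ> h) {..<n} {..<n}"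
    using bij_betw_trans[OF h bij_betw_the_inv_into[OF h']] .
  then have "bij_betw p {..<n} {..<n}"
    by (rule bij_betw_cong[THEN iffD1, rotated]) (simp add: p_def)
  then have p: "p permutes {0..<n}"
    by (intro bij_imp_permutes) (auto simp: p_def atLeast0LessThan)
  have hp: "h' (p i) = h i" "p i < n" if "i < n" for i
  proof -
    show "h' (p i) = h i"
      using that h h' by (auto simp: p_def bij_betw_def intro!: f_the_inv_into_f)
    show "p i < n" using that permutes_in_image[OF p, of i] by simp
  qed
  have "mat n n (\<lambda>(i, j). \<phi> (h i) (a j))
      = mat n n (\<lambda>(i, j). mat n n (\<lambda>(i, j). \<phi> (h' i) (a j)) $$ (p i, j))"
    by (rule eq_matI) (auto simp: hp)
  then have "slater n (\<lambda>i. \<phi> (h i)) a = signof p * slater n (\<lambda>i. \<phi> (h' i)) a"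
    unfolding slater_def by (simp add: det_permute_rows[OF _ p])
  then show ?thesis by (simp add: norm_mult sign_def)
qed

section \<open>Hilbert space geometry of continuous functions for a probability measure on a compact
  set\<close>

locale compact_prob =
  fixes K :: "'a::topological_space set" and \<nu> :: "'a measure"
  assumes compact_K: "compact K" and \<nu>: "\<nu> \<in> prob_measures K"
begin

sublocale prob_space \<nu> using \<nu> by (simp add: prob_measures_def)

lemma sets_\<nu>: "sets \<nu> = sets (restrict_space borel K)"
  using \<nu> by (simp add: prob_measures_def)

lemma space_\<nu>: "space \<nu> = K"
  using sets_eq_imp_space_eq[OF sets_\<nu>] by (simp add: space_restrict_space)

lemma K_nonempty: "K \<noteq> {}"
  using not_empty space_\<nu> by simp

lemma measurable_continuous:
  fixes f :: "'a \<Rightarrow> 'b::topological_space"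
  assumes "continuous_on K f"
  shows "f \<in> borel_measurable \<nu>"
  using borel_measurable_continuous_on_restrict[OF assms] measurable_cong_sets[OF sets_\<nu> refl]
  by blast

lemma continuous_bounded:
  fixes f :: "'a \<Rightarrow> 'b::real_normed_vector"
  assumes "continuous_on K f"
  obtains B where "B > 0" "\<And>x. x \<in> K \<Longrightarrow> norm (f x) \<le> B"
  using compact_imp_bounded[OF compact_continuous_image[OF assms compact_K]]
  by (auto simp: bounded_pos)

lemma integrable_continuous:
  fixes f :: "'a \<Rightarrow> 'b::{banach, second_countable_topology}"
  assumes "continuous_on K f"
  shows "integrable \<nu> f"
proof -
  obtain B where "\<And>x. x \<in> K \<Longrightarrow> norm (f x) \<le> B"
    using continuous_bounded[OF assms] by blast
  then show ?thesis
    by (intro integrable_const_bound[where B = B] measurable_continuous assms AE_I2)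
      (simp add: space_\<nu>)
qed

definition ip :: "('a \<Rightarrow> complex) \<Rightarrow> ('a \<Rightarrow> complex) \<Rightarrow> complex" where
  "ip f g = (\<integral>x. f x * cnj (g x) \<partial>\<nu>)"

text \<open>The square of the norm. It may vanish for a nonzero continuous function, because the
  support of the measure can be smaller than K; the Gram-Schmidt process below has to tolerate
  this.\<close>

definition norm2 :: "('a \<Rightarrow> complex) \<Rightarrow> real" where
  "norm2 f = (\<integral>x. (cmod (f x))\<^sup>2 \<partial>\<nu>)"

lemma norm2_nonneg: "norm2 f \<ge> 0"
  by (simp add: norm2_def)

lemma ip_self: "ip f f = of_real (norm2 f)"
  unfolding ip_def norm2_def by (simp only: complex_norm_square[symmetric] integral_complex_of_real)

lemma ip_commute: "ip g f = cnj (ip f g)"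
  unfolding ip_def using Bochner_Integration.integral_cnj[of \<nu> "\<lambda>x. f x * cnj (g x)"] by (simp add: mult.commute)

lemma ip_add_left:
  assumes "continuous_on K f" "continuous_on K g" "continuous_on K h"
  shows "ip (\<lambda>x. f x + g x) h = ip f h + ip g h"
  unfolding ip_def distrib_right
  by (intro Bochner_Integration.integral_add integrable_continuous continuous_intros assms)

lemma ip_cmult_left: "ip (\<lambda>x. c * f x) h = c * ip f h"
  unfolding ip_def by (simp add: mult.assoc)

lemma ip_sum_left:
  assumes "\<And>i. i \<in> I \<Longrightarrow> continuous_on K (f i)" "continuous_on K h"
  shows "ip (\<lambda>x. \<Sum>i\<in>I. f i x) h = (\<Sum>i\<in>I. ip (f i) h)"
  unfolding ip_def sum_distrib_right
  by (intro Bochner_Integration.integral_sum integrable_continuous continuous_intros assms)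

lemma ip_lincomb_right:
  assumes "continuous_on K f" "continuous_on K g" "\<And>i. i \<in> I \<Longrightarrow> continuous_on K (h i)"
  shows "ip f (\<lambda>x. g x + (\<Sum>i\<in>I. c i * h i x)) = ip f g + (\<Sum>i\<in>I. cnj (c i) * ip f (h i))"
proof -
  have "ip (\<lambda>x. g x + (\<Sum>i\<in>I. c i * h i x)) f = ip g f + (\<Sum>i\<in>I. c i * ip (h i) f)"
  proof -
    have "continuous_on K (\<lambda>x. \<Sum>i\<in>I. c i * h i x)"
      using assms(3) by (intro continuous_intros) auto
    then have "ip (\<lambda>x. g x + (\<Sum>i\<in>I. c i * h i x)) f = ip g f + ip (\<lambda>x. \<Sum>i\<in>I. c i * h i x) f"
      using assms by (intro ip_add_left)
    also have "ip (\<lambda>x. \<Sum>i\<in>I. c i * h i x) f = (\<Sum>i\<in>I. c i * ip (h i) f)"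
      using assms by (subst ip_sum_left) (auto intro!: continuous_intros simp: ip_cmult_left)
    finally show ?thesis .
  qed
  then have "cnj (ip (\<lambda>x. g x + (\<Sum>i\<in>I. c i * h i x)) f) = cnj (ip g f + (\<Sum>i\<in>I. c i * ip (h i) f))"
    by simp
  then show ?thesis
    by (simp only: ip_commute[of f] complex_cnj_add cnj_sum complex_cnj_mult complex_cnj_cnj)
qed

text \<open>The degenerate case of Cauchy-Schwarz: g vanishes almost everywhere.\<close>

lemma ip_zero_right:
  assumes "continuous_on K f" "continuous_on K g" "norm2 g = 0"
  shows "ip f g = 0"
proof -
  have "AE x in \<nu>. (cmod (g x))\<^sup>2 = 0"
    using assms(3) unfolding norm2_def
    by (subst (asm) integral_nonneg_eq_0_iff_AE)
      (auto intro!: integrable_continuous continuous_intros assms)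
  then have "AE x in \<nu>. f x * cnj (g x) = 0" by eventually_elim auto
  then show ?thesis unfolding ip_def by (rule integral_eq_zero_AE)
qed

text \<open>Gram-Schmidt without linear independence. In the induction step both f and the new
  function \<open>b m\<close> are made orthogonal to the earlier ones; then the first residual is
  projected off the second.\<close>

lemma orthogonal_residual:
  fixes b :: "nat \<Rightarrow> 'a \<Rightarrow> complex"
  assumes "\<And>j. j < m \<Longrightarrow> continuous_on K (b j)" "continuous_on K f"
  shows "\<exists>c. \<forall>j<m. ip (\<lambda>x. f x + (\<Sum>i<m. c i * b i x)) (b j) = 0"
  using assms
proof (induct m arbitrary: f)
  case 0
  then show ?case by simp
next
  case (Suc m)
  have b: "continuous_on K (b j)" if "j \<le> m" for j using Suc.prems(1) that by simp
  define r where "r g c x = g x + (\<Sum>i<m. c i * b i x)" for g :: "'a \<Rightarrow> complex" and c x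
  have r: "continuous_on K (r g c)" if "continuous_on K g" for g c
    unfolding r_def using that b by (intro continuous_intros) auto
  obtain c1 where c1: "\<And>j. j < m \<Longrightarrow> ip (r f c1) (b j) = 0"
    using Suc.hyps[OF b Suc.prems(2)] by (auto simp: r_def[abs_def])
  obtain c2 where c2: "\<And>j. j < m \<Longrightarrow> ip (r (b m) c2) (b j) = 0"
    using Suc.hyps[OF b b[of m]] by (auto simp: r_def[abs_def])
  define f' b' where "f' = r f c1" and "b' = r (b m) c2"
  have cont: "continuous_on K f'" "continuous_on K b'"
    unfolding f'_def b'_def by (intro r Suc.prems b order_refl)+
  \<comment> \<open>If the residual of \<open>b m\<close> has norm 0, it is orthogonal to everything
    and the coefficient 0 does as well.\<close>
  define t where "t = (if norm2 b' = 0 then 0 else - ip f' b' / norm2 b')"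
  define f'' where "f'' x = f' x + t * b' x" for x
  have cont'': "continuous_on K f''" unfolding f''_def using cont by (intro continuous_intros)
  have ip'': "ip f'' g = ip f' g + t * ip b' g" if "continuous_on K g" for g
    unfolding f''_def using cont that
    by (subst ip_add_left) (auto intro!: continuous_intros simp: ip_cmult_left)
  have lt: "ip f'' (b j) = 0" if "j < m" for j
    using that c1 c2 b by (simp add: ip'' f'_def b'_def)
  have "ip f'' b' = 0"
    using cont by (simp add: ip'' ip_self t_def ip_zero_right)
  also have "ip f'' b' = ip f'' (b m) + (\<Sum>i<m. cnj (c2 i) * ip f'' (b i))"
    unfolding b'_def r_def using b cont'' by (intro ip_lincomb_right) auto
  finally have "ip f'' (b m) = 0" using lt by simp
  with lt have orth: "ip f'' (b j) = 0" if "j < Suc m" for j using that by (auto simp: less_Suc_eq)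
  define c where "c i = (if i < m then c1 i + t * c2 i else t)" for i
  have "f'' = (\<lambda>x. f x + (\<Sum>i<Suc m. c i * b i x))"
    by (simp add: f''_def f'_def b'_def r_def c_def fun_eq_iff algebra_simps sum.distrib sum_distrib_left)
  then show ?case using orth by (intro exI[of _ c]) auto
qed

text \<open>Leibniz expansion of both factors turns the integral into a double sum over permutations
  p and q, each term factoring over the coordinates. For p different from q some factor is the inner
  product of two distinct functions; the n! diagonal terms all equal the product of the
  norms.\<close>

lemma slater_norm_orthogonal:
  assumes cont: "\<And>i. i < n \<Longrightarrow> continuous_on K (\<psi> i)"
    and orth: "\<And>i j. i < n \<Longrightarrow> j < n \<Longrightarrow> i \<noteq> j \<Longrightarrow> ip (\<psi> i) (\<psi> j) = 0"
  shows "(\<integral>a. (cmod (slater n \<psi> a))\<^sup>2 \<partial>Pi\<^sub>M {..<n} (\<lambda>_. \<nu>)) = fact n * (\<Prod>i<n. norm2 (\<psi> i))"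
proof -
  interpret P: product_sigma_finite "\<lambda>_::nat. \<nu>"
    by unfold_locales
  let ?P = "{p. p permutes {0..<n}}"
  let ?M = "Pi\<^sub>M {..<n} (\<lambda>_. \<nu>)"
  have fin: "finite ?P" by (simp add: finite_permutations)
  have perm: "p j < n" if "p permutes {0..<n}" "j < n" for p j
    using permutes_in_image[OF that(1), of j] that(2) by simp
  have int1: "integrable \<nu> (\<lambda>x. \<psi> (p j) x * cnj (\<psi> (q j) x))"
    if "p permutes {0..<n}" "q permutes {0..<n}" "j < n" for p q j
  proof -
    have "continuous_on K (\<psi> (p j))" "continuous_on K (\<psi> (q j))"
      using cont[OF perm[OF that(1,3)]] cont[OF perm[OF that(2,3)]] .
    then show ?thesis by (intro integrable_continuous continuous_intros)
  qed
  have int: "integrable ?M (\<lambda>a. \<Prod>j<n. \<psi> (p j) (a j) * cnj (\<psi> (q j) (a j)))"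
    if "p permutes {0..<n}" "q permutes {0..<n}" for p q
    using int1[OF that] by (intro P.product_integrable_prod) auto
  have eq: "(\<integral>a. (\<Prod>j<n. \<psi> (p j) (a j) * cnj (\<psi> (q j) (a j))) \<partial>?M)
      = (if p = q then of_real (\<Prod>i<n. norm2 (\<psi> i)) else 0)"
    if p: "p permutes {0..<n}" and q: "q permutes {0..<n}" for p q
  proof -
    have "(\<integral>a. (\<Prod>j<n. \<psi> (p j) (a j) * cnj (\<psi> (q j) (a j))) \<partial>?M)
        = (\<Prod>j<n. ip (\<psi> (p j)) (\<psi> (q j)))"
      unfolding ip_def using int1[OF that] by (subst P.product_integral_prod) auto
    also have "\<dots> = (if p = q then of_real (\<Prod>i<n. norm2 (\<psi> i)) else 0)"
    proof (cases "p = q")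
      case True
      have "(\<Prod>j\<in>{0..<n}. norm2 (\<psi> (p j))) = (\<Prod>i\<in>{0..<n}. norm2 (\<psi> i))"
        using prod.permute[OF p, of "\<lambda>i. norm2 (\<psi> i)"] by (simp add: comp_def)
      then show ?thesis using True by (simp add: ip_self atLeast0LessThan flip: of_real_prod)
    next
      case False
      then obtain j where j: "p j \<noteq> q j" by auto
      then have "j < n"
        using p q by (metis atLeastLessThan_iff permutes_def zero_le)
      then have "ip (\<psi> (p j)) (\<psi> (q j)) = 0" 
        using orth[OF perm[OF p] perm[OF q] j] by simp
      then show ?thesis using False \<open>j < n\<close> by (auto intro!: prod_zero)
    qed
    finally show ?thesis .
  qed
  have "of_real (\<integral>a. (cmod (slater n \<psi> a))\<^sup>2 \<partial>?M)
      = (\<integral>a. slater n \<psi> a * cnj (slater n \<psi> a) \<partial>?M)"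
    by (simp only: complex_norm_square[symmetric] integral_complex_of_real)
  also have "\<dots> = (\<integral>a. (\<Sum>p\<in>?P. \<Sum>q\<in>?P. signof p * signof q *
      (\<Prod>j<n. \<psi> (p j) (a j) * cnj (\<psi> (q j) (a j)))) \<partial>?M)"
    unfolding slater_leibniz by (simp add: sum_product prod.distrib mult_ac)
  also have "\<dots> = (\<Sum>p\<in>?P. \<Sum>q\<in>?P. signof p * signof q *
      (\<integral>a. (\<Prod>j<n. \<psi> (p j) (a j) * cnj (\<psi> (q j) (a j))) \<partial>?M))"
  proof -
    have int': "integrable ?M (\<lambda>a. signof p * signof q * (\<Prod>j<n. \<psi> (p j) (a j) * cnj (\<psi> (q j) (a j))))"
      if "p \<in> ?P" "q \<in> ?P" for p q
      using int that by (intro integrable_mult_right) auto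
    show ?thesis
      by (subst Bochner_Integration.integral_sum, intro Bochner_Integration.integrable_sum int',
          assumption, assumption, intro sum.cong refl,
          subst Bochner_Integration.integral_sum, rule int', assumption, assumption)
        simp
  qed
  also have "\<dots> = (\<Sum>p\<in>?P. \<Sum>q\<in>?P. if p = q then of_real (\<Prod>i<n. norm2 (\<psi> i)) else 0)"
    using eq by (intro sum.cong refl) (auto simp: sign_def)
  also have "\<dots> = (\<Sum>p\<in>?P. of_real (\<Prod>i<n. norm2 (\<psi> i)))"
    using fin by (intro sum.cong refl) simp
  also have "\<dots> = of_real (fact n * (\<Prod>i<n. norm2 (\<psi> i)))"
    by (simp add: card_permutations[of "{0..<n}" n])
  finally show ?thesis by (simp only: of_real_eq_iff)
qed

lemma norm2_add_orthogonal:
  assumes f: "continuous_on K f" and g: "continuous_on K g" and "ip f g = 0"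
  shows "norm2 (\<lambda>x. f x + g x) = norm2 f + norm2 g"
proof -
  have fg: "continuous_on K (\<lambda>x. f x + g x)" by (intro continuous_intros f g)
  have "ip (\<lambda>x. f x + g x) (\<lambda>x. f x + g x) = ip f f + ip g g"
    using assms(3) ip_commute[of g f]
      ip_lincomb_right[of f f "{()}" "\<lambda>_. g" "\<lambda>_. 1"] ip_lincomb_right[of g f "{()}" "\<lambda>_. g" "\<lambda>_. 1"] f g
    by (simp add: ip_add_left[OF f g fg])
  then show ?thesis by (simp add: ip_self del: of_real_add flip: of_real_add)
qed

text \<open>The residual is orthogonal to all earlier functions, so any competitor differs from it
  by an orthogonal vector and Pythagoras gives minimality. Only this minimality, not the
  coefficients, matters when two weights are compared.\<close>

lemma slater_gram_schmidt:
  assumes cont: "\<And>i. i < n \<Longrightarrow> continuous_on K (\<phi> i)"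
  shows "\<exists>\<psi> c. (\<forall>i<n. \<psi> i = (\<lambda>x. \<phi> i x + (\<Sum>j<i. c i j * \<phi> j x)))
    \<and> (\<forall>a. slater n \<phi> a = slater n \<psi> a)
    \<and> (\<integral>a. (cmod (slater n \<phi> a))\<^sup>2 \<partial>Pi\<^sub>M {..<n} (\<lambda>_. \<nu>)) = fact n * (\<Prod>i<n. norm2 (\<psi> i))
    \<and> (\<forall>i<n. \<forall>d. norm2 (\<psi> i) \<le> norm2 (\<lambda>x. \<phi> i x + (\<Sum>j<i. d j * \<phi> j x)))"
proof -
  have "\<exists>c. \<forall>j<i. ip (\<lambda>x. \<phi> i x + (\<Sum>j<i. c j * \<phi> j x)) (\<phi> j) = 0" if "i < n" for i
    using that cont by (intro orthogonal_residual) auto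
  then obtain c where c: "\<And>i j. i < n \<Longrightarrow> j < i \<Longrightarrow>
      ip (\<lambda>x. \<phi> i x + (\<Sum>j<i. c i j * \<phi> j x)) (\<phi> j) = 0" by metis
  define \<psi> where "\<psi> i x = \<phi> i x + (\<Sum>j<i. c i j * \<phi> j x)" for i x
  have \<psi>: "continuous_on K (\<psi> i)" if "i < n" for i
    unfolding \<psi>_def using that cont by (intro continuous_intros) auto
  have orth: "ip (\<psi> i) (\<phi> j) = 0" if "i < n" "j < i" for i j
    using c[OF that] by (simp add: \<psi>_def[abs_def])
  have orth': "ip (\<psi> i) (\<lambda>x. \<phi> j x + (\<Sum>l<j. d l * \<phi> l x)) = 0" if "i < n" "j < i" for i j d
    using that orth cont \<psi> by (subst ip_lincomb_right) auto
  have lt: "ip (\<psi> i) (\<psi> j) = 0" if "i < n" "j < i" for i j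
    using orth'[OF that] by (simp add: \<psi>_def[abs_def])
  have pair: "ip (\<psi> i) (\<psi> j) = 0" if "i < n" "j < n" "i \<noteq> j" for i j
    using that lt ip_commute[of "\<psi> i" "\<psi> j"] by (cases "i < j") auto
  have sl: "slater n \<phi> a = slater n \<psi> a" for a
    by (rule slater_unitriangular[symmetric]) (simp add: \<psi>_def)
  have le: "norm2 (\<psi> i) \<le> norm2 (\<lambda>x. \<phi> i x + (\<Sum>j<i. d j * \<phi> j x))" if "i < n" for i d
  proof -
    define r where "r x = (\<Sum>j<i. (d j - c i j) * \<phi> j x)" for x
    have r: "continuous_on K r" unfolding r_def using that cont by (intro continuous_intros) auto
    have "ip r (\<psi> i) = (\<Sum>j<i. (d j - c i j) * ip (\<phi> j) (\<psi> i))"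
      unfolding r_def using that cont \<psi>
      by (subst ip_sum_left) (auto intro!: continuous_intros simp: ip_cmult_left)
    then have "ip (\<psi> i) r = 0"
      using that orth by (simp add: ip_commute[of "\<psi> i" r] ip_commute[of "\<phi> _" "\<psi> i"])
    then have "norm2 (\<lambda>x. \<psi> i x + r x) = norm2 (\<psi> i) + norm2 r"
      using that \<psi> r by (intro norm2_add_orthogonal) auto
    moreover have "(\<lambda>x. \<psi> i x + r x) = (\<lambda>x. \<phi> i x + (\<Sum>j<i. d j * \<phi> j x))"
      by (simp add: \<psi>_def r_def fun_eq_iff algebra_simps sum_subtractf)
    ultimately show ?thesis using norm2_nonneg[of r] by simp
  qed
  show ?thesis
    using slater_norm_orthogonal[of n \<psi>] \<psi> pair le sl
    by (intro exI[of _ \<psi>] exI[of _ c]) (auto simp: \<psi>_def[abs_def])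
qed

end

section \<open>Monic polynomials for a monomial order\<close>

text \<open>
  The integer polynomials form a linearly ordered group, so this injective additive map induces a
  monomial order (a lexicographic one).
\<close>

definition key :: "('n::finite \<Rightarrow> nat) \<Rightarrow> int poly" where
  "key \<alpha> = (\<Sum>i\<in>UNIV. Polynomial.monom (int (\<alpha> i)) (to_nat i))"

lemma key_add: "key (\<lambda>i. \<alpha> i + \<beta> i) = key \<alpha> + key \<beta>"
  by (simp add: key_def sum.distrib flip: add_monom)

lemma inj_key: "inj key"
proof (rule injI, rule ext)
  fix \<alpha> \<beta> :: "'n::finite \<Rightarrow> nat" and i
  assume eq: "key \<alpha> = key \<beta>"
  have "Polynomial.coeff (key \<alpha>) (to_nat i) = int (\<alpha> i)" for \<alpha> :: "'n \<Rightarrow> nat"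
  proof -
    have "Polynomial.coeff (key \<alpha>) (to_nat i) = (\<Sum>j\<in>UNIV. if j = i then int (\<alpha> j) else 0)"
      unfolding key_def coeff_sum by (intro sum.cong) auto
    then show ?thesis by simp
  qed
  from this[of \<alpha>] this[of \<beta>] show "\<alpha> i = \<beta> i" using eq by simp
qed

lemma finite_multi_indices: "finite (multi_indices k)"
  using bij_betw_finite[OF exponent_enum_bij[of k]] by simp

lemma card_multi_indices: "card (multi_indices k :: ('n::finite \<Rightarrow> nat) set) = N TYPE('n) k"
  using bij_betw_same_card[OF exponent_enum_bij[where 'n = 'n, of k]] by simp

lemma multi_indices_add:
  "\<alpha> \<in> multi_indices k \<Longrightarrow> \<beta> \<in> multi_indices l \<Longrightarrow> (\<lambda>i. \<alpha> i + \<beta> i) \<in> multi_indices (k + l)"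
  by (simp add: multi_indices_def sum.distrib)

lemma monomial_add: "monomial (\<lambda>i. \<alpha> i + \<beta> i) x = monomial \<alpha> x * monomial \<beta> x"
  by (simp add: monomial_def power_add prod.distrib)

lemma continuous_on_monomial: "continuous_on S (monomial \<alpha>)"
  unfolding monomial_def by (intro continuous_intros)

text \<open>A lexicographic order need not refine the degree, so the degree bound is imposed
  separately. For this reason the classes \<open>monic k \<alpha>\<close> and the Chebyshev
  constants carry both k and \<alpha>.\<close>

definition lower_indices :: "nat \<Rightarrow> ('n::finite \<Rightarrow> nat) \<Rightarrow> ('n \<Rightarrow> nat) set" where
  "lower_indices k \<alpha> = {\<beta> \<in> multi_indices k. key \<beta> < key \<alpha>}"

definition monic :: "nat \<Rightarrow> ('n::finite \<Rightarrow> nat) \<Rightarrow> (complex ^ 'n \<Rightarrow> complex) set" where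
  "monic k \<alpha> = {p. \<exists>c. p = (\<lambda>x. monomial \<alpha> x + (\<Sum>\<beta>\<in>lower_indices k \<alpha>. c \<beta> * monomial \<beta> x))}"

lemma finite_lower_indices: "finite (lower_indices k \<alpha>)"
  by (rule finite_subset[OF _ finite_multi_indices[of k]]) (auto simp: lower_indices_def)

lemma monomial_in_monic: "monomial \<alpha> \<in> monic k \<alpha>"
  unfolding monic_def by (auto intro!: exI[of _ "\<lambda>_. 0"])

lemma continuous_on_monic: "p \<in> monic k \<alpha> \<Longrightarrow> continuous_on S p"
  unfolding monic_def by (auto intro!: continuous_intros continuous_on_monomial)

lemma monic_subset_polys:
  assumes "\<alpha> \<in> multi_indices k"
  shows "monic k \<alpha> \<subseteq> polys k"
proof
  fix p assume "p \<in> monic k \<alpha>"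
  then obtain c where c: "p = (\<lambda>x. monomial \<alpha> x + (\<Sum>\<beta>\<in>lower_indices k \<alpha>. c \<beta> * monomial \<beta> x))"
    by (auto simp: monic_def)
  define c' where "c' \<beta> = (if \<beta> = \<alpha> then 1 else if \<beta> \<in> lower_indices k \<alpha> then c \<beta> else 0)" for \<beta>
  have nin: "\<alpha> \<notin> lower_indices k \<alpha>" by (simp add: lower_indices_def)
  have "p x = (\<Sum>\<beta>\<in>multi_indices k. c' \<beta> * monomial \<beta> x)" for x
  proof -
    have "(\<Sum>\<beta>\<in>multi_indices k. c' \<beta> * monomial \<beta> x)
        = (\<Sum>\<beta>\<in>insert \<alpha> (lower_indices k \<alpha>). c' \<beta> * monomial \<beta> x)"
      using assms finite_multi_indices
      by (intro sum.mono_neutral_right) (auto simp: c'_def lower_indices_def)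
    also have "\<dots> = monomial \<alpha> x + (\<Sum>\<beta>\<in>lower_indices k \<alpha>. c' \<beta> * monomial \<beta> x)"
      using nin by (simp add: c'_def sum.insert[OF finite_lower_indices])
    also have "(\<Sum>\<beta>\<in>lower_indices k \<alpha>. c' \<beta> * monomial \<beta> x)
        = (\<Sum>\<beta>\<in>lower_indices k \<alpha>. c \<beta> * monomial \<beta> x)"
      using nin by (intro sum.cong) (auto simp: c'_def)
    finally show ?thesis by (simp add: c)
  qed
  then show "p \<in> polys k" by (auto simp: polys_def)
qed

text \<open>Leading terms multiply because \<open>key\<close> is additive: in every other pair of
  terms at least one key is strictly smaller, so the key of the product is too, while the degree
  bounds add.\<close>

lemma monic_mult:
  fixes \<alpha> \<beta> :: "'n::finite \<Rightarrow> nat"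
  assumes \<alpha>: "\<alpha> \<in> multi_indices k" and \<beta>: "\<beta> \<in> multi_indices l"
    and p: "p \<in> monic k \<alpha>" and q: "q \<in> monic l \<beta>"
  shows "(\<lambda>x. p x * q x) \<in> monic (k + l) (\<lambda>i. \<alpha> i + \<beta> i)"
proof -
  let ?A = "lower_indices k \<alpha>" and ?B = "lower_indices l \<beta>"
  obtain c d where c: "p = (\<lambda>x. monomial \<alpha> x + (\<Sum>\<gamma>\<in>?A. c \<gamma> * monomial \<gamma> x))"
    and d: "q = (\<lambda>x. monomial \<beta> x + (\<Sum>\<gamma>\<in>?B. d \<gamma> * monomial \<gamma> x))"
    using p q by (auto simp: monic_def)
  define c' d' where "c' = c(\<alpha> := 1)" and "d' = d(\<beta> := 1)"
  have nin: "\<alpha> \<notin> ?A" "\<beta> \<notin> ?B" by (simp_all add: lower_indices_def)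
  have p_eq: "p x = (\<Sum>\<gamma>\<in>insert \<alpha> ?A. c' \<gamma> * monomial \<gamma> x)" for x
    using nin by (auto simp: c c'_def sum.insert[OF finite_lower_indices] intro!: sum.cong)
  have q_eq: "q x = (\<Sum>\<gamma>\<in>insert \<beta> ?B. d' \<gamma> * monomial \<gamma> x)" for x
    using nin by (auto simp: d d'_def sum.insert[OF finite_lower_indices] intro!: sum.cong)
  define P where "P = insert \<alpha> ?A \<times> insert \<beta> ?B"
  have P: "finite P" "(\<alpha>, \<beta>) \<in> P" using finite_lower_indices by (auto simp: P_def)
  let ?T = "lower_indices (k + l) (\<lambda>i. \<alpha> i + \<beta> i)"
  define g where "g z i = fst z i + snd z i" for z :: "('n \<Rightarrow> nat) \<times> ('n \<Rightarrow> nat)" and i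
  have g_img: "g ` (P - {(\<alpha>, \<beta>)}) \<subseteq> ?T"
  proof
    fix \<epsilon> assume "\<epsilon> \<in> g ` (P - {(\<alpha>, \<beta>)})"
    then obtain z where "z \<in> P - {(\<alpha>, \<beta>)}" "\<epsilon> = g z" by blast
    moreover obtain \<gamma> \<delta> where "z = (\<gamma>, \<delta>)" by (cases z)
    ultimately have z: "(\<gamma>, \<delta>) \<in> P" "(\<gamma>, \<delta>) \<noteq> (\<alpha>, \<beta>)" "\<epsilon> = (\<lambda>i. \<gamma> i + \<delta> i)"
      by (simp_all add: g_def[abs_def])
    then have le: "key \<gamma> \<le> key \<alpha>" "key \<delta> \<le> key \<beta>" "\<gamma> \<in> multi_indices k" "\<delta> \<in> multi_indices l"
      using \<alpha> \<beta> by (auto simp: P_def lower_indices_def)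
    have "key \<gamma> < key \<alpha> \<or> key \<delta> < key \<beta>"
      using z(1,2) by (auto simp: P_def lower_indices_def)
    then have "key \<gamma> + key \<delta> < key \<alpha> + key \<beta>"
      using le by (auto intro: add_less_le_mono add_le_less_mono)
    then show "\<epsilon> \<in> ?T" using le z by (simp add: lower_indices_def key_add multi_indices_add)
  qed
  define h where "h z = c' (fst z) * d' (snd z)" for z
  \<comment> \<open>Several pairs in P may produce the same exponent; coefficients are therefore
    collected over the fibres of g.\<close>
  have "p x * q x = monomial (\<lambda>i. \<alpha> i + \<beta> i) x
      + (\<Sum>\<epsilon>\<in>?T. (\<Sum>z\<in>{z \<in> P - {(\<alpha>, \<beta>)}. g z = \<epsilon>}. h z) * monomial \<epsilon> x)" for x
  proof -
    have "p x * q x = (\<Sum>z\<in>P. h z * monomial (g z) x)"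
      unfolding p_eq q_eq sum_product sum.cartesian_product P_def
      by (intro sum.cong) (auto simp: h_def g_def[abs_def] monomial_add)
    also have "\<dots> = monomial (\<lambda>i. \<alpha> i + \<beta> i) x + (\<Sum>z\<in>P - {(\<alpha>, \<beta>)}. h z * monomial (g z) x)"
      using P by (subst sum.remove) (auto simp: h_def g_def[abs_def] c'_def d'_def)
    also have "(\<Sum>z\<in>P - {(\<alpha>, \<beta>)}. h z * monomial (g z) x)
        = (\<Sum>\<epsilon>\<in>?T. \<Sum>z\<in>{z \<in> P - {(\<alpha>, \<beta>)}. g z = \<epsilon>}. h z * monomial (g z) x)"
      using P g_img finite_lower_indices by (intro sum.group[symmetric]) auto
    finally show ?thesis by (simp add: sum_distrib_right)
  qed
  then show ?thesis by (auto simp: monic_def fun_eq_iff)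
qed

text \<open>Sorting the finitely many keys makes initial segments of the enumeration coincide with
  \<open>lower_indices\<close>, so that Gram-Schmidt along it stays inside the classes
  \<open>monic\<close>.\<close>

lemma monomial_order_enum:
  obtains h where "bij_betw h {..<N TYPE('n::finite) k} (multi_indices k :: ('n \<Rightarrow> nat) set)"
    and "\<And>i. i < N TYPE('n) k \<Longrightarrow> h ` {..<i} = lower_indices k (h i)"
proof -
  let ?M = "multi_indices k :: ('n \<Rightarrow> nat) set"
  let ?n = "N TYPE('n) k"
  define L where "L = sorted_list_of_set (key ` ?M)"
  have setL: "set L = key ` ?M" by (simp add: L_def finite_multi_indices)
  have inj: "inj_on key A" for A :: "('n \<Rightarrow> nat) set" using inj_key by (rule inj_on_subset) simp
  have len: "length L = ?n"
    by (simp add: L_def card_image[OF inj] card_multi_indices)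
  have less: "L ! j < L ! i \<longleftrightarrow> j < i" if "i < ?n" "j < ?n" for i j
  proof -
    have "sorted L" "distinct L" by (simp_all add: L_def)
    then show ?thesis
      using that len sorted_nth_mono[of L i j] sorted_nth_mono[of L j i] nth_eq_iff_index_eq[of L i j]
      by (cases "j < i") (auto simp: not_less order_less_le)
  qed
  define h where "h i = inv_into ?M key (L ! i)" for i
  have h: "key (h i) = L ! i" "h i \<in> ?M" if "i < ?n" for i
  proof -
    have "L ! i \<in> key ` ?M" using that len setL nth_mem[of i L] by simp
    then show "key (h i) = L ! i" "h i \<in> ?M"
      unfolding h_def by (rule f_inv_into_f, rule inv_into_into)
  qed
  have surj: "\<exists>j<?n. h j = \<beta>" if "\<beta> \<in> ?M" for \<beta>
  proof -
    have "key \<beta> \<in> set L" using that by (simp add: setL)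
    then obtain j where j: "j < ?n" "L ! j = key \<beta>" by (auto simp: in_set_conv_nth len)
    then have "h j = \<beta>" using h(1)[OF j(1)] inj_key by (auto dest: injD)
    then show ?thesis using j by blast
  qed
  have inj_h: "inj_on h {..<?n}"
  proof (rule inj_onI)
    fix i j assume ij: "i \<in> {..<?n}" "j \<in> {..<?n}" "h i = h j"
    then have "L ! i = L ! j" using h(1)[of i] h(1)[of j] by simp
    then show "i = j" using less[of i j] less[of j i] ij by (cases i j rule: linorder_cases) auto
  qed
  have "bij_betw h {..<?n} ?M"
    using inj_h h(2) surj by (auto simp: bij_betw_def image_def)
  moreover have "h ` {..<i} = lower_indices k (h i)" if i: "i < ?n" for i
  proof (intro equalityI subsetI)
    fix \<beta> assume "\<beta> \<in> h ` {..<i}"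
    then obtain j where "j < i" "\<beta> = h j" by auto
    then show "\<beta> \<in> lower_indices k (h i)"
      using i h[of i] h[of j] less[of i j] by (simp add: lower_indices_def)
  next
    fix \<beta> assume b: "\<beta> \<in> lower_indices k (h i)"
    then obtain j where j: "j < ?n" "\<beta> = h j" using surj[of \<beta>] by (auto simp: lower_indices_def)
    then have "j < i" using b i h(1)[of i] h(1)[of j] less[of i j] by (simp add: lower_indices_def)
    then show "\<beta> \<in> h ` {..<i}" using j by auto
  qed
  ultimately show ?thesis using that by blast
qed

text \<open>Homogenization: the extra index \<open>None\<close> takes up the slack k - |\<alpha>|,
  which makes exponents of degree at most k into compositions of exactly k.\<close>

lemma sum_compositions_option:
  "(\<Sum>f\<in>compositions (UNIV :: 'n::finite option set) k. F (f \<circ> Some)) = (\<Sum>\<alpha>\<in>multi_indices k. F \<alpha> :: 'b::comm_monoid_add)"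
proof (rule sum.reindex_bij_witness[where j = "\<lambda>f. f \<circ> Some"
      and i = "\<lambda>\<alpha> i. case i of None \<Rightarrow> k - (\<Sum>i\<in>UNIV. \<alpha> i) | Some i \<Rightarrow> \<alpha> i"], goal_cases)
  have sum_option: "sum f UNIV = f None + (\<Sum>i\<in>UNIV. f (Some i))" for f :: "'n option \<Rightarrow> nat"
    by (simp add: UNIV_option_conv sum.reindex)
  {
    case (1 f)
    then show ?case
      by (auto simp: compositions_def sum_option fun_eq_iff split: option.split)
  next
    case (2 f)
    then show ?case by (auto simp: compositions_def multi_indices_def sum_option)
  next
    case (3 \<alpha>)
    then show ?case by (auto simp: fun_eq_iff)
  next
    case (4 \<alpha>)
    then show ?case by (auto simp: compositions_def multi_indices_def sum_option)
  next
    case (5 f)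
    then show ?case by simp
  }
qed

section \<open>Chebyshev constants and the weighted transfinite diameter\<close>

lemma le_cInf_mult:
  fixes A :: "real set"
  assumes "A \<noteq> {}" "\<And>a. a \<in> A \<Longrightarrow> c \<le> a * b" "0 \<le> b"
  shows "c \<le> Inf A * b"
proof (cases "b = 0")
  case True
  then show ?thesis using assms(1,2) by fastforce
next
  case False
  then have "b > 0" using assms(3) by simp
  then have "c / b \<le> Inf A" using assms by (intro cInf_greatest) (simp_all add: pos_divide_le_eq)
  then show ?thesis using \<open>b > 0\<close> by (simp add: pos_divide_le_eq)
qed

lemma sqrt_prod: "sqrt (\<Prod>i\<in>I. f i) = (\<Prod>i\<in>I. sqrt (f i))"
  by (induction I rule: infinite_finite_induct) (simp_all add: real_sqrt_mult)

lemma N_pos: "N TYPE('n::finite) k > 0"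
  by (simp add: N_def)

lemma N_at_top: "filterlim (N TYPE('n::finite)) at_top sequentially"
proof (rule filterlim_at_top_mono[OF filterlim_ident])
  have "k \<le> N TYPE('n) k" for k
  proof (cases "k = 0")
    case False
    have "Suc k choose k \<le> (CARD('n) + k) choose k"
      by (rule binomial_right_mono) (simp add: Suc_leI)
    then show ?thesis by (simp add: N_def)
  qed simp
  then show "\<forall>\<^sub>F k in sequentially. k \<le> N TYPE('n) k" by simp
qed

text \<open>N! is at most N^N and N is polynomially bounded in k, so the root is at most N^(1/k) up
  to constants in the exponent. Hence factorial losses in later estimates are invisible in the
  limit.\<close>

lemma fact_root_tendsto:
  "(\<lambda>k. sqrt (fact (N TYPE('n::finite) k)) powr (1 / (real k * real (N TYPE('n) k)))) \<longlonglongrightarrow> 1"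
proof (rule tendsto_sandwich[where f = "\<lambda>_. 1"
      and h = "\<lambda>k. (real CARD('n) + real k) powr (real CARD('n) / real k)"])
  let ?n = "CARD('n)"
  show "(\<lambda>k. (real ?n + real k) powr (real ?n / real k)) \<longlonglongrightarrow> 1"
    by real_asymp
  show "\<forall>\<^sub>F k in sequentially. 1 \<le> sqrt (fact (N TYPE('n) k)) powr (1 / (real k * real (N TYPE('n) k)))"
    by (intro always_eventually allI ge_one_powr_ge_zero) auto
  show "\<forall>\<^sub>F k in sequentially. sqrt (fact (N TYPE('n) k)) powr (1 / (real k * real (N TYPE('n) k)))
      \<le> (real ?n + real k) powr (real ?n / real k)"
    using eventually_ge_at_top[of 1]
  proof eventually_elim
    case (elim k)
    let ?N = "N TYPE('n) k"
    have N: "?N > 0" by (rule N_pos)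
    have "?N \<le> (?n + k) ^ ?n"
      using binomial_le_pow[of ?n "?n + k"] binomial_symmetric[of k "?n + k"] by (simp add: N_def)
    then have "real ?N \<le> (real ?n + real k) ^ ?n"
      by (metis of_nat_add of_nat_le_iff of_nat_power)
    also have "\<dots> = (real ?n + real k) powr real ?n"
      using elim by (simp add: powr_realpow)
    finally have N_le: "real ?N \<le> (real ?n + real k) powr real ?n" .
    have "(1::real) \<le> fact ?N" by simp
    then have "sqrt (fact ?N) * 1 \<le> sqrt (fact ?N) * sqrt (fact ?N)"
      by (intro mult_left_mono) simp_all
    then have "sqrt (fact ?N) \<le> fact ?N" by simp
    also have "\<dots> \<le> real ?N ^ ?N"
      using fact_le_power[of ?N, where 'a = real] by simp
    also have "\<dots> = real ?N powr real ?N" using N by (simp add: powr_realpow)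
    finally have "sqrt (fact ?N) powr (1 / (real k * real ?N))
        \<le> (real ?N powr real ?N) powr (1 / (real k * real ?N))"
      by (intro powr_mono2) auto
    also have "\<dots> = real ?N powr (1 / real k)"
      using N by (simp add: powr_powr)
    also have "\<dots> \<le> ((real ?n + real k) powr real ?n) powr (1 / real k)"
      using N_le by (intro powr_mono2) auto
    also have "\<dots> = (real ?n + real k) powr (real ?n / real k)"
      by (simp add: powr_powr)
    finally show ?case .
  qed
qed simp

section \<open>Weighted polynomials and crude bounds for determinants\<close>

definition weighted :: "(complex ^ 'n \<Rightarrow> real) \<Rightarrow> nat \<Rightarrow> (complex ^ 'n \<Rightarrow> complex) \<Rightarrow> complex ^ 'n \<Rightarrow> complex" where
  "weighted v k p x = p x * of_real (exp (- real k * v x))"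

lemma continuous_on_weighted:
  "continuous_on S v \<Longrightarrow> continuous_on S p \<Longrightarrow> continuous_on S (weighted v k p)"
  unfolding weighted_def by (intro continuous_intros)

lemma wVDM_slater:
  "wVDM v k a = slater (N TYPE('n) k) (\<lambda>i. weighted v k (monomial (exponent_enum k i))) (a :: nat \<Rightarrow> complex ^ 'n)"
  using slater_mult[of "N TYPE('n) k" "\<lambda>i. monomial (exponent_enum k i)" "\<lambda>x. of_real (exp (- real k * v x))" a]
  by (simp add: wVDM_def VDM_def weighted_def[abs_def] slater_def)

text \<open>Changing the weight by u multiplies the determinant by the exponential of the linear
  statistic with summands u (a j). This is what ties weights to empirical measures, in the upper and
  in the lower bound.\<close>

lemma wVDM_add:
  "wVDM (\<lambda>x. v x + u x) k (a :: nat \<Rightarrow> complex ^ 'n)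
    = wVDM v k a * of_real (exp (- real k * (\<Sum>j<N TYPE('n) k. u (a j))))"
proof -
  have "(\<Prod>j<N TYPE('n) k. exp (- real k * (v (a j) + u (a j))))
      = (\<Prod>j<N TYPE('n) k. exp (- real k * v (a j))) * (\<Prod>j<N TYPE('n) k. exp (- real k * u (a j)))"
    by (simp only: distrib_left exp_add prod.distrib)
  also have "(\<Prod>j<N TYPE('n) k. exp (- real k * u (a j))) = exp (- real k * (\<Sum>j<N TYPE('n) k. u (a j)))"
    by (simp only: exp_sum finite_lessThan sum_distrib_left)
  finally show ?thesis
    by (simp only: wVDM_def of_real_prod[symmetric] of_real_mult mult.assoc)
qed

context compact_prob begin

lemma slater_le:
  assumes B: "\<And>i x. i < n \<Longrightarrow> x \<in> K \<Longrightarrow> cmod (\<psi> i x) \<le> B i" and a: "a \<in> {..<n} \<rightarrow>\<^sub>E K"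
  shows "cmod (slater n \<psi> a) \<le> fact n * (\<Prod>i<n. B i)"
proof -
  have "cmod (slater n \<psi> a) \<le> (\<Sum>p | p permutes {0..<n}. \<Prod>i<n. B i)"
    unfolding slater_leibniz
  proof (rule sum_norm_le)
    fix p assume "p \<in> {p. p permutes {0..<n}}"
    then have p: "p permutes {0..<n}" by simp
    have lt: "p j < n" if "j < n" for j using permutes_in_image[OF p, of j] that by simp
    have "cmod (signof p * (\<Prod>j<n. \<psi> (p j) (a j))) = (\<Prod>j<n. cmod (\<psi> (p j) (a j)))"
      by (simp add: norm_mult prod_norm sign_def)
    also have "\<dots> \<le> (\<Prod>j<n. B (p j))"
      using a lt by (intro prod_mono) (auto intro!: B)
    also have "\<dots> = (\<Prod>i<n. B i)"
      using prod.permute[OF p, of B] by (simp add: comp_def atLeast0LessThan)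
    finally show "cmod (signof p * (\<Prod>j<n. \<psi> (p j) (a j))) \<le> (\<Prod>i<n. B i)" .
  qed
  then show ?thesis by (simp add: card_permutations[of "{0..<n}" n])
qed

lemma slater_measurable:
  assumes "\<And>i. i < n \<Longrightarrow> continuous_on K (\<psi> i)"
  shows "slater n \<psi> \<in> borel_measurable (Pi\<^sub>M {..<n} (\<lambda>_. \<nu>))"
proof -
  have "(\<lambda>a. signof p * (\<Prod>j<n. \<psi> (p j) (a j)) :: complex) \<in> borel_measurable (Pi\<^sub>M {..<n} (\<lambda>_. \<nu>))"
    if p: "p permutes {0..<n}" for p
  proof (intro borel_measurable_times borel_measurable_const borel_measurable_prod)
    fix j assume j: "j \<in> {..<n}"
    have "p j < n" using permutes_in_image[OF p, of j] j by simp
    then have "\<psi> (p j) \<in> borel_measurable \<nu>" by (intro measurable_continuous assms)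
    then show "(\<lambda>a. \<psi> (p j) (a j)) \<in> borel_measurable (Pi\<^sub>M {..<n} (\<lambda>_. \<nu>))"
      by (rule measurable_compose[OF measurable_component_singleton[OF j]])
  qed
  then show ?thesis
    unfolding slater_leibniz[abs_def] by (intro borel_measurable_sum) auto
qed

end

section \<open>Chebyshev constants under the Bernstein-Markov property\<close>

locale bernstein_markov =
  fixes K :: "(complex ^ 'n) set" and \<nu> :: "(complex ^ 'n) measure"
  assumes compact: "compact K" and strong_BM: "strong_BM K \<nu>"
begin

sublocale compact_prob K \<nu>
  using compact strong_BM by unfold_locales (simp_all add: strong_BM_def)

definition wnorm :: "(complex ^ 'n \<Rightarrow> real) \<Rightarrow> nat \<Rightarrow> (complex ^ 'n \<Rightarrow> complex) \<Rightarrow> real" where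
  "wnorm v k p = (SUP x\<in>K. cmod (weighted v k p x))"

lemma wnorm_upper:
  assumes "continuous_on K v" "continuous_on K p" "x \<in> K"
  shows "cmod (weighted v k p x) \<le> wnorm v k p"
proof -
  obtain B where "\<And>x. x \<in> K \<Longrightarrow> cmod (weighted v k p x) \<le> B"
    using continuous_bounded[OF continuous_on_weighted[OF assms(1,2), of k]] by blast
  then show ?thesis
    unfolding wnorm_def using assms(3) by (intro cSUP_upper) (auto simp: bdd_above_def)
qed

lemma wnorm_least: "(\<And>x. x \<in> K \<Longrightarrow> cmod (weighted v k p x) \<le> c) \<Longrightarrow> wnorm v k p \<le> c"
  unfolding wnorm_def using K_nonempty by (rule cSUP_least)

lemma wnorm_nonneg: "continuous_on K v \<Longrightarrow> continuous_on K p \<Longrightarrow> 0 \<le> wnorm v k p"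
proof -
  assume "continuous_on K v" "continuous_on K p"
  moreover obtain x where "x \<in> K" using K_nonempty by blast
  ultimately have "cmod (weighted v k p x) \<le> wnorm v k p" by (rule wnorm_upper)
  then show ?thesis by (rule order_trans[OF norm_ge_zero])
qed

lemma norm2_le_wnorm:
  assumes "continuous_on K v" "continuous_on K p"
  shows "norm2 (weighted v k p) \<le> (wnorm v k p)\<^sup>2"
  unfolding norm2_def
proof (rule integral_le_const)
  show "integrable \<nu> (\<lambda>x. (cmod (weighted v k p x))\<^sup>2)"
    by (intro integrable_continuous continuous_intros continuous_on_weighted assms)
  show "AE x in \<nu>. (cmod (weighted v k p x))\<^sup>2 \<le> (wnorm v k p)\<^sup>2"
    using wnorm_upper[OF assms] by (intro AE_I2 power_mono) (auto simp: space_\<nu>)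
qed

text \<open>For a probability measure the sup norm dominates the L2 norm, so one nonvanishing test
  polynomial forces M k to be at least 1. The limit superior of the roots thereby becomes a
  limit.\<close>

lemma Bernstein_Markov_constants:
  assumes v: "continuous_on K v"
  shows "\<exists>M. (\<lambda>k. M k powr (1 / real k)) \<longlonglongrightarrow> 1 \<and> (\<forall>k\<ge>1. M k \<ge> 1)
    \<and> (\<forall>k\<ge>1. \<forall>p\<in>polys k. wnorm v k p \<le> M k * sqrt (norm2 (weighted v k p)))"
proof -
  obtain M :: "nat \<Rightarrow> real" where lim: "limsup (\<lambda>k. ereal (root k (M k))) = 1"
    and "\<forall>k\<ge>1. \<forall>p\<in>polys k. (SUP x\<in>K. cmod (of_real (exp (- real k * v x)) * p x))
          \<le> M k * sqrt (\<integral>x. (cmod (of_real (exp (- real k * v x)) * p x))\<^sup>2 \<partial>\<nu>)"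
    using strong_BM v unfolding strong_BM_def weighted_BM_def by blast
  then have le: "wnorm v k p \<le> M k * sqrt (norm2 (weighted v k p))" if "k \<ge> 1" "p \<in> polys k" for k p
    using that by (simp add: wnorm_def norm2_def weighted_def mult.commute)
  have ge1: "M k \<ge> 1" if k: "k \<ge> 1" for k
  proof (rule ccontr)
    assume neg: "\<not> M k \<ge> 1"
    \<comment> \<open>The constant polynomial 1: multiplied by the weight it has no zeros, so its
      sup norm is positive.\<close>
    define p :: "complex ^ 'n \<Rightarrow> complex" where "p = monomial (\<lambda>_. 0)"
    have p: "continuous_on K p" unfolding p_def by (rule continuous_on_monomial)
    have "p \<in> polys k"
      unfolding p_def
      by (rule subsetD[OF monic_subset_polys monomial_in_monic]) (simp add: multi_indices_def)
    then have up: "wnorm v k p \<le> M k * sqrt (norm2 (weighted v k p))" by (rule le[OF k])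
    obtain x where x: "x \<in> K" using K_nonempty by blast
    have "0 < cmod (weighted v k p x)" by (simp add: p_def weighted_def monomial_def)
    then have pos: "0 < wnorm v k p" using wnorm_upper[OF v p x, of k] by (rule less_le_trans)
    have low: "sqrt (norm2 (weighted v k p)) \<le> wnorm v k p"
      using norm2_le_wnorm[OF v p] pos by (intro real_le_lsqrt) auto
    have "M k * sqrt (norm2 (weighted v k p)) \<le> max 0 (M k) * sqrt (norm2 (weighted v k p))"
      by (intro mult_right_mono) (auto simp: norm2_nonneg)
    also have "\<dots> \<le> max 0 (M k) * wnorm v k p"
      using low by (intro mult_left_mono) auto
    also have "\<dots> < 1 * wnorm v k p"
      using pos neg by (intro mult_strict_right_mono) auto
    finally show False using up by simp
  qed
  have "(\<lambda>k. ereal (root k (M k))) \<longlonglongrightarrow> 1"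
  proof -
    have "1 \<le> liminf (\<lambda>k. ereal (root k (M k)))"
      using ge1 by (intro Liminf_bounded eventually_sequentiallyI[of 1]) simp
    moreover have "liminf (\<lambda>k. ereal (root k (M k))) \<le> 1"
      using Liminf_le_Limsup[of sequentially "\<lambda>k. ereal (root k (M k))"] lim by simp
    ultimately have "liminf (\<lambda>k. ereal (root k (M k))) = 1" by (rule antisym[rotated])
    then show ?thesis using lim by (simp add: tendsto_iff_Liminf_eq_Limsup)
  qed
  then have "(\<lambda>k. root k (M k)) \<longlonglongrightarrow> 1" by (simp add: one_ereal_def)
  moreover have "\<forall>\<^sub>F k in sequentially. root k (M k) = M k powr (1 / real k)"
    using ge1 by (intro eventually_sequentiallyI[of 1]) (force simp: root_powr_inverse)
  ultimately have "(\<lambda>k. M k powr (1 / real k)) \<longlonglongrightarrow> 1"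
    by (rule Lim_transform_eventually)
  then show ?thesis using ge1 le by blast
qed

text \<open>A weighted relative of the Chebyshev constants in Zakharyuta's treatment of the
  transfinite diameter, one for each exponent.\<close>

definition cheb :: "(complex ^ 'n \<Rightarrow> real) \<Rightarrow> nat \<Rightarrow> ('n \<Rightarrow> nat) \<Rightarrow> real" where
  "cheb v k \<alpha> = (INF p\<in>monic k \<alpha>. wnorm v k p)"

lemma monic_nonempty: "monic k \<alpha> \<noteq> {}"
  using monomial_in_monic by blast

lemma cheb_lower:
  assumes "continuous_on K v" "p \<in> monic k \<alpha>"
  shows "cheb v k \<alpha> \<le> wnorm v k p"
  unfolding cheb_def using assms
  by (intro cINF_lower) (auto simp: bdd_below_def intro!: exI[of _ 0] wnorm_nonneg continuous_on_monic)

lemma cheb_greatest: "(\<And>p. p \<in> monic k \<alpha> \<Longrightarrow> c \<le> wnorm v k p) \<Longrightarrow> c \<le> cheb v k \<alpha>"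
  unfolding cheb_def by (rule cINF_greatest[OF monic_nonempty])

lemma cheb_nonneg: "continuous_on K v \<Longrightarrow> 0 \<le> cheb v k \<alpha>"
  by (intro cheb_greatest wnorm_nonneg continuous_on_monic)

text \<open>The factor exp(-kv) is multiplicative in k, so a product of competitors of degrees k and
  l is a competitor of degree k + l with the product weight. The two infima are then taken one after
  the other.\<close>

lemma cheb_submultiplicative:
  assumes v: "continuous_on K v" and \<alpha>: "\<alpha> \<in> multi_indices k" and \<beta>: "\<beta> \<in> multi_indices l"
  shows "cheb v (k + l) (\<lambda>i. \<alpha> i + \<beta> i) \<le> cheb v k \<alpha> * cheb v l \<beta>"
proof -
  let ?c = "cheb v (k + l) (\<lambda>i. \<alpha> i + \<beta> i)"
  have *: "?c \<le> wnorm v k p * wnorm v l q" if p: "p \<in> monic k \<alpha>" and q: "q \<in> monic l \<beta>" for p q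
  proof -
    have "?c \<le> wnorm v (k + l) (\<lambda>x. p x * q x)"
      by (rule cheb_lower[OF v monic_mult[OF \<alpha> \<beta> p q]])
    also have "\<dots> \<le> wnorm v k p * wnorm v l q"
    proof (rule wnorm_least)
      fix x assume x: "x \<in> K"
      have "weighted v (k + l) (\<lambda>x. p x * q x) x = weighted v k p x * weighted v l q x"
      proof -
        have "- real (k + l) * v x = - real k * v x + - real l * v x" by (simp add: algebra_simps)
        then show ?thesis unfolding weighted_def by (simp only: exp_add of_real_mult mult_ac)
      qed
      then show "cmod (weighted v (k + l) (\<lambda>x. p x * q x) x) \<le> wnorm v k p * wnorm v l q"
        using p q x v
        by (auto simp: norm_mult intro!: mult_mono wnorm_upper wnorm_nonneg continuous_on_monic)
    qed
    finally show ?thesis .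
  qed
  have **: "?c \<le> cheb v l \<beta> * wnorm v k p" if p: "p \<in> monic k \<alpha>" for p
    unfolding cheb_def[of v l \<beta>]
  proof (rule le_cInf_mult)
    show "0 \<le> wnorm v k p" by (rule wnorm_nonneg[OF v continuous_on_monic[OF p]])
  qed (use *[OF p] in \<open>auto simp: monic_nonempty mult.commute\<close>)
  show ?thesis
    unfolding cheb_def[of v k \<alpha>]
    by (rule le_cInf_mult) (use ** cheb_nonneg[OF v] in \<open>auto simp: monic_nonempty mult.commute\<close>)
qed

text \<open>The partition function of the point process with density proportional to |wVDM v k|^2.
  As a function of v it encodes the Laplace transforms of all linear statistics.\<close>

definition Z :: "(complex ^ 'n \<Rightarrow> real) \<Rightarrow> nat \<Rightarrow> real" where
  "Z v k = (\<integral>a. (cmod (wVDM v k a))\<^sup>2 \<partial>Pi\<^sub>M {..<N TYPE('n) k} (\<lambda>_. \<nu>))"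

definition wVDM_sup :: "(complex ^ 'n \<Rightarrow> real) \<Rightarrow> nat \<Rightarrow> real" where
  "wVDM_sup v k = (SUP a\<in>({..<N TYPE('n) k} \<rightarrow>\<^sub>E K). cmod (wVDM v k a))"

lemma continuous_on_weighted_monomial:
  "continuous_on K v \<Longrightarrow> continuous_on K (weighted v k (monomial \<alpha>))"
  by (intro continuous_on_weighted continuous_on_monomial)

lemma wVDM_bounded:
  assumes v: "continuous_on K v"
  obtains B where "\<And>a. a \<in> {..<N TYPE('n) k} \<rightarrow>\<^sub>E K \<Longrightarrow> cmod (wVDM v k a) \<le> B"
proof
  fix a assume a: "a \<in> {..<N TYPE('n) k} \<rightarrow>\<^sub>E K"
  show "cmod (wVDM v k a) \<le> fact (N TYPE('n) k) * (\<Prod>i<N TYPE('n) k. wnorm v k (monomial (exponent_enum k i)))"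
    unfolding wVDM_slater by (intro slater_le wnorm_upper v continuous_on_monomial a)
qed

lemma wVDM_le_sup:
  assumes "continuous_on K v" "a \<in> {..<N TYPE('n) k} \<rightarrow>\<^sub>E K"
  shows "cmod (wVDM v k a) \<le> wVDM_sup v k"
proof -
  obtain B where "\<And>a. a \<in> {..<N TYPE('n) k} \<rightarrow>\<^sub>E K \<Longrightarrow> cmod (wVDM v k a) \<le> B"
    using wVDM_bounded[OF assms(1), of k] by blast
  then show ?thesis
    unfolding wVDM_sup_def using assms(2) by (intro cSUP_upper) (auto simp: bdd_above_def)
qed

lemma wVDM_measurable:
  "continuous_on K v \<Longrightarrow> wVDM v k \<in> borel_measurable (Pi\<^sub>M {..<N TYPE('n) k} (\<lambda>_. \<nu>))"
  unfolding wVDM_slater[abs_def] by (intro slater_measurable continuous_on_weighted_monomial)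

lemma space_product: "space (Pi\<^sub>M I (\<lambda>_. \<nu>)) = I \<rightarrow>\<^sub>E K"
  by (simp add: space_PiM space_\<nu>)

lemma prob_space_product: "prob_space (Pi\<^sub>M I (\<lambda>_. \<nu>))"
  by (intro prob_space_PiM) unfold_locales

lemma product_nonempty: "I \<rightarrow>\<^sub>E K \<noteq> {}"
  using K_nonempty by (simp add: PiE_eq_empty_iff)

lemma integrable_wVDM:
  assumes "continuous_on K v"
  shows "integrable (Pi\<^sub>M {..<N TYPE('n) k} (\<lambda>_. \<nu>)) (\<lambda>a. (cmod (wVDM v k a))\<^sup>2)"
proof -
  interpret P: prob_space "Pi\<^sub>M {..<N TYPE('n) k} (\<lambda>_. \<nu>)" by (rule prob_space_product)
  have [measurable]: "wVDM v k \<in> borel_measurable (Pi\<^sub>M {..<N TYPE('n) k} (\<lambda>_. \<nu>))"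
    by (rule wVDM_measurable[OF assms])
  show ?thesis
    using wVDM_le_sup[OF assms]
    by (intro P.integrable_const_bound[where B = "(wVDM_sup v k)\<^sup>2"] AE_I2)
      (auto simp: space_product intro!: power_mono)
qed

lemma sqrt_Z_le_sup:
  assumes v: "continuous_on K v"
  shows "sqrt (Z v k) \<le> wVDM_sup v k"
proof -
  interpret P: prob_space "Pi\<^sub>M {..<N TYPE('n) k} (\<lambda>_. \<nu>)" by (rule prob_space_product)
  have "0 \<le> wVDM_sup v k"
  proof -
    have "({..<N TYPE('n) k} \<rightarrow>\<^sub>E K) \<noteq> {}" by (rule product_nonempty)
    then obtain a where "a \<in> {..<N TYPE('n) k} \<rightarrow>\<^sub>E K" by (auto simp only: ex_in_conv[symmetric])
    then have "cmod (wVDM v k a) \<le> wVDM_sup v k" by (rule wVDM_le_sup[OF v])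
    then show ?thesis by (rule order_trans[OF norm_ge_zero])
  qed
  moreover have "Z v k \<le> (wVDM_sup v k)\<^sup>2"
    unfolding Z_def
  proof (rule P.integral_le_const[OF integrable_wVDM[OF v]])
    show "AE a in Pi\<^sub>M {..<N TYPE('n) k} (\<lambda>_. \<nu>). (cmod (wVDM v k a))\<^sup>2 \<le> (wVDM_sup v k)\<^sup>2"
      using wVDM_le_sup[OF v] by (intro AE_I2 power_mono) (auto simp: space_product)
  qed
  ultimately show ?thesis by (intro real_le_lsqrt)
qed

text \<open>Along the monomial order, polynomials in \<open>monic k (h i)\<close> are exactly the
  i-th monomial plus combinations of earlier ones. Hence the orthogonalized functions belong to
  these classes and minimize the norm over the whole class.\<close>

lemma Gram_Schmidt_wVDM:
  assumes v: "continuous_on K v"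
  shows "\<exists>h q. bij_betw h {..<N TYPE('n) k} (multi_indices k)
    \<and> (\<forall>i<N TYPE('n) k. q i \<in> monic k (h i))
    \<and> (\<forall>a. cmod (wVDM v k a) = cmod (slater (N TYPE('n) k) (\<lambda>i. weighted v k (q i)) a))
    \<and> Z v k = fact (N TYPE('n) k) * (\<Prod>i<N TYPE('n) k. norm2 (weighted v k (q i)))
    \<and> (\<forall>i<N TYPE('n) k. \<forall>p\<in>monic k (h i). norm2 (weighted v k (q i)) \<le> norm2 (weighted v k p))"
proof -
  let ?n = "N TYPE('n) k"
  obtain h where h: "bij_betw h {..<?n} (multi_indices k :: ('n \<Rightarrow> nat) set)"
    and low: "\<And>i. i < ?n \<Longrightarrow> h ` {..<i} = lower_indices k (h i)"
    using monomial_order_enum[of k] by blast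
  define \<phi> where "\<phi> i = weighted v k (monomial (h i))" for i
  have \<phi>: "continuous_on K (\<phi> i)" for i
    unfolding \<phi>_def by (rule continuous_on_weighted_monomial[OF v])
  have reindex: "(\<Sum>\<beta>\<in>lower_indices k (h i). f \<beta>) = (\<Sum>j<i. f (h j) :: complex)" if "i < ?n" for f i
  proof -
    have "inj_on h {..<i}" using h that by (auto simp: bij_betw_def intro: inj_on_subset)
    then show ?thesis using sum.reindex[of h "{..<i}" f] by (simp add: low[OF that])
  qed
  have wVDM_eq: "cmod (wVDM v k a) = cmod (slater ?n \<phi> a)" for a
    unfolding wVDM_slater \<phi>_def
    by (rule cmod_slater_reindex[OF exponent_enum_bij h, of "\<lambda>\<alpha>. weighted v k (monomial \<alpha>)"])
  obtain \<psi> c where \<psi>: "\<And>i. i < ?n \<Longrightarrow> \<psi> i = (\<lambda>x. \<phi> i x + (\<Sum>j<i. c i j * \<phi> j x))"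
    and sl: "\<And>a. slater ?n \<phi> a = slater ?n \<psi> a"
    and Z: "(\<integral>a. (cmod (slater ?n \<phi> a))\<^sup>2 \<partial>Pi\<^sub>M {..<?n} (\<lambda>_. \<nu>)) = fact ?n * (\<Prod>i<?n. norm2 (\<psi> i))"
    and min: "\<And>i d. i < ?n \<Longrightarrow> norm2 (\<psi> i) \<le> norm2 (\<lambda>x. \<phi> i x + (\<Sum>j<i. d j * \<phi> j x))"
    using slater_gram_schmidt[of ?n \<phi>, OF \<phi>] by blast
  define q where "q i x = monomial (h i) x + (\<Sum>j<i. c i j * monomial (h j) x)" for i x
  have q_monic: "q i \<in> monic k (h i)" if i: "i < ?n" for i
  proof -
    define d where "d \<beta> = c i (the_inv_into {..<?n} h \<beta>)" for \<beta>
    have "(\<Sum>j<i. c i j * monomial (h j) x) = (\<Sum>\<beta>\<in>lower_indices k (h i). d \<beta> * monomial \<beta> x)" for x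
      unfolding reindex[OF i] using h i
      by (intro sum.cong) (auto simp: d_def bij_betw_def the_inv_into_f_f)
    then show ?thesis by (auto simp: monic_def q_def fun_eq_iff)
  qed
  have \<psi>_q: "\<psi> i = weighted v k (q i)" if "i < ?n" for i
    unfolding \<psi>[OF that] by (simp add: fun_eq_iff \<phi>_def q_def weighted_def distrib_right sum_distrib_right mult.assoc)
  have slq: "slater ?n \<psi> a = slater ?n (\<lambda>i. weighted v k (q i)) a" for a
  proof -
    have "mat ?n ?n (\<lambda>(i, j). \<psi> i (a j)) = mat ?n ?n (\<lambda>(i, j). weighted v k (q i) (a j))"
      by (rule eq_matI) (auto simp: \<psi>_q)
    then show ?thesis by (simp only: slater_def)
  qed
  have "norm2 (weighted v k (q i)) \<le> norm2 (weighted v k p)" if i: "i < ?n" and p: "p \<in> monic k (h i)" for i p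
  proof -
    obtain d where d: "p = (\<lambda>x. monomial (h i) x + (\<Sum>\<beta>\<in>lower_indices k (h i). d \<beta> * monomial \<beta> x))"
      using p by (auto simp: monic_def)
    have "weighted v k p = (\<lambda>x. \<phi> i x + (\<Sum>j<i. d (h j) * \<phi> j x))"
      unfolding d reindex[OF i] by (simp add: fun_eq_iff \<phi>_def weighted_def distrib_right sum_distrib_right mult.assoc)
    then show ?thesis using min[OF i, of "\<lambda>j. d (h j)"] by (simp only: \<psi>_q[OF i])
  qed
  moreover have "Z v k = fact ?n * (\<Prod>i<?n. norm2 (weighted v k (q i)))"
    unfolding Z_def wVDM_eq Z using \<psi>_q by simp
  ultimately show ?thesis
    using h q_monic by (intro exI[of _ h] exI[of _ q]) (simp add: wVDM_eq sl slq)
qed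

text \<open>With d the L2 norms of the orthogonal polynomials, minimality gives d at most
  \<open>cheb\<close>, while the Bernstein-Markov inequality gives \<open>cheb\<close> at most M d.
  The square root of Z is sqrt(N!) times the product of the d, and the Leibniz expansion bounds the
  sup by N! times the product of the M d.\<close>

lemma wVDM_estimates:
  assumes v: "continuous_on K v" and M: "0 \<le> M"
    and BM: "\<And>p. p \<in> polys k \<Longrightarrow> wnorm v k p \<le> M * sqrt (norm2 (weighted v k p))"
  shows "(\<Prod>\<alpha>\<in>multi_indices k. cheb v k \<alpha>) \<le> M ^ N TYPE('n) k * sqrt (Z v k)"
    and "sqrt (Z v k) \<le> sqrt (fact (N TYPE('n) k)) * (\<Prod>\<alpha>\<in>multi_indices k. cheb v k \<alpha>)"
    and "wVDM_sup v k \<le> sqrt (fact (N TYPE('n) k)) * M ^ N TYPE('n) k * sqrt (Z v k)"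
proof -
  let ?n = "N TYPE('n) k"
  obtain h q where h: "bij_betw h {..<?n} (multi_indices k :: ('n \<Rightarrow> nat) set)"
    and q: "\<And>i. i < ?n \<Longrightarrow> q i \<in> monic k (h i)"
    and sl: "\<And>a. cmod (wVDM v k a) = cmod (slater ?n (\<lambda>i. weighted v k (q i)) a)"
    and Z: "Z v k = fact ?n * (\<Prod>i<?n. norm2 (weighted v k (q i)))"
    and min: "\<And>i p. i < ?n \<Longrightarrow> p \<in> monic k (h i) \<Longrightarrow> norm2 (weighted v k (q i)) \<le> norm2 (weighted v k p)"
    using Gram_Schmidt_wVDM[OF v, of k] by blast
  define d where "d i = sqrt (norm2 (weighted v k (q i)))" for i
  have d0: "0 \<le> d i" for i by (simp add: d_def norm2_nonneg)
  have C: "(\<Prod>\<alpha>\<in>multi_indices k. cheb v k \<alpha>) = (\<Prod>i<?n. cheb v k (h i))"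
    by (rule prod.reindex_bij_betw[OF h, symmetric])
  have sqrtZ: "sqrt (Z v k) = sqrt (fact ?n) * (\<Prod>i<?n. d i)"
    unfolding Z d_def real_sqrt_mult by (simp only: sqrt_prod)
  have Md: "wnorm v k (q i) \<le> M * d i" if i: "i < ?n" for i
  proof -
    have "h i \<in> multi_indices k" using h i by (auto simp: bij_betw_def)
    then show ?thesis unfolding d_def using BM q[OF i] monic_subset_polys by blast
  qed
  have cont: "continuous_on K (q i)" if "i < ?n" for i using q[OF that] by (rule continuous_on_monic)
  have fact1: "1 \<le> sqrt (fact ?n)" by simp
  have prod0: "0 \<le> (\<Prod>i<?n. d i)" by (intro prod_nonneg) (simp add: d0)
  have "(\<Prod>i<?n. cheb v k (h i)) \<le> (\<Prod>i<?n. M * d i)"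
    by (intro prod_mono conjI cheb_nonneg v order_trans[OF cheb_lower[OF v q] Md]) auto
  also have "\<dots> = M ^ ?n * (1 * (\<Prod>i<?n. d i))" by (simp add: prod.distrib)
  also have "\<dots> \<le> M ^ ?n * sqrt (Z v k)"
    unfolding sqrtZ using fact1 prod0 M by (intro mult_left_mono mult_right_mono) auto
  finally show "(\<Prod>\<alpha>\<in>multi_indices k. cheb v k \<alpha>) \<le> M ^ ?n * sqrt (Z v k)" by (simp only: C)
  have "d i \<le> cheb v k (h i)" if i: "i < ?n" for i
  proof (rule cheb_greatest)
    fix p assume p: "p \<in> monic k (h i)"
    then have "norm2 (weighted v k (q i)) \<le> (wnorm v k p)\<^sup>2"
      using min[OF i p] norm2_le_wnorm[OF v continuous_on_monic[OF p], of k] by linarith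
    then show "d i \<le> wnorm v k p"
      unfolding d_def using wnorm_nonneg[OF v continuous_on_monic[OF p]] by (intro real_le_lsqrt)
  qed
  then have "(\<Prod>i<?n. d i) \<le> (\<Prod>i<?n. cheb v k (h i))"
    using d0 by (intro prod_mono) auto
  then show "sqrt (Z v k) \<le> sqrt (fact ?n) * (\<Prod>\<alpha>\<in>multi_indices k. cheb v k \<alpha>)"
    unfolding sqrtZ C by (intro mult_left_mono) auto
  show "wVDM_sup v k \<le> sqrt (fact ?n) * M ^ ?n * sqrt (Z v k)"
    unfolding wVDM_sup_def
  proof (rule cSUP_least[OF product_nonempty])
    fix a assume a: "a \<in> {..<?n} \<rightarrow>\<^sub>E K"
    have "cmod (wVDM v k a) \<le> fact ?n * (\<Prod>i<?n. M * d i)"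
      unfolding sl
    proof (rule slater_le[OF _ a])
      fix i x assume i: "i < ?n" and x: "x \<in> K"
      show "cmod (weighted v k (q i) x) \<le> M * d i"
        using wnorm_upper[OF v cont[OF i] x, of k] Md[OF i] by linarith
    qed
    also have "\<dots> = sqrt (fact ?n) * M ^ ?n * sqrt (Z v k)"
    proof -
      \<comment> \<open>Half of the factorial from the Leibniz expansion is absorbed by the one
        contained in Z.\<close>
      have fact_eq: "fact ?n = sqrt (fact ?n) * (sqrt (fact ?n) :: real)" by simp
      show ?thesis
        unfolding sqrtZ prod.distrib prod_constant card_lessThan
        by (subst fact_eq) (simp only: mult_ac)
    qed
    finally show "cmod (wVDM v k a) \<le> sqrt (fact ?n) * M ^ ?n * sqrt (Z v k)" .
  qed
qed

definition cheb_mean :: "(complex ^ 'n \<Rightarrow> real) \<Rightarrow> nat \<Rightarrow> real" where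
  "cheb_mean v k = (\<Prod>\<alpha>\<in>multi_indices k. cheb v k \<alpha>) powr (1 / real (N TYPE('n) k))"

text \<open>The logarithms of the Chebyshev constants, read as a function of compositions with one
  slack part, are subadditive, and uniform averages inherit this. Positivity is essential here since
  \<open>ln 0\<close> is 0 and not minus infinity.\<close>

lemma cheb_mean_submultiplicative:
  assumes v: "continuous_on K v" and pos: "\<And>k \<alpha>. \<alpha> \<in> multi_indices k \<Longrightarrow> cheb v k \<alpha> > 0"
  shows "cheb_mean v (k + l) \<le> cheb_mean v k * cheb_mean v l"
proof -
  \<comment> \<open>The degree is recovered as the total sum of f, so A is one function on all
    compositions, of every k at once.\<close>
  define A where "A f = ln (cheb v (sum f UNIV) (f \<circ> Some))" for f :: "'n option \<Rightarrow> nat"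
  define avg where "avg k = (\<Sum>f\<in>compositions UNIV k. A f) / card (compositions (UNIV :: 'n option set) k)" for k
  have mem: "f \<circ> Some \<in> multi_indices (sum f UNIV)" for f :: "'n option \<Rightarrow> nat"
    by (simp add: multi_indices_def UNIV_option_conv sum.reindex)
  have "A (\<lambda>i. f i + g i) \<le> A f + A g" for f g
  proof -
    have comp: "(\<lambda>i. f i + g i) \<circ> Some = (\<lambda>i. (f \<circ> Some) i + (g \<circ> Some) i)" by auto
    have "cheb v (sum f UNIV + sum g UNIV) ((\<lambda>i. f i + g i) \<circ> Some)
        \<le> cheb v (sum f UNIV) (f \<circ> Some) * cheb v (sum g UNIV) (g \<circ> Some)"
      unfolding comp by (rule cheb_submultiplicative[OF v mem mem])
    moreover have "0 < cheb v (sum f UNIV + sum g UNIV) ((\<lambda>i. f i + g i) \<circ> Some)"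
      unfolding comp by (intro pos multi_indices_add mem)
    ultimately have "ln (cheb v (sum f UNIV + sum g UNIV) ((\<lambda>i. f i + g i) \<circ> Some))
        \<le> ln (cheb v (sum f UNIV) (f \<circ> Some) * cheb v (sum g UNIV) (g \<circ> Some))"
      by (intro ln_mono) auto
    also have "\<dots> = A f + A g"
      using pos[OF mem, of f] pos[OF mem, of g] by (simp add: A_def ln_mult)
    finally show ?thesis by (simp add: A_def sum.distrib)
  qed
  then have "avg (k + l) \<le> avg k + avg l"
    unfolding avg_def by (rule average_subadditive)
  moreover have "cheb_mean v k = exp (avg k)" for k
  proof -
    have "(\<Sum>f\<in>compositions UNIV k. A f) = (\<Sum>f\<in>compositions UNIV k. ln (cheb v k (f \<circ> Some)))"
      by (intro sum.cong) (auto simp: A_def compositions_def)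
    also have "\<dots> = (\<Sum>\<alpha>\<in>multi_indices k. ln (cheb v k \<alpha>))"
      by (rule sum_compositions_option)
    also have "\<dots> = ln (\<Prod>\<alpha>\<in>multi_indices k. cheb v k \<alpha>)"
    proof (rule ln_prod[symmetric])
      show "cheb v k \<alpha> \<noteq> 0" if "\<alpha> \<in> multi_indices k" for \<alpha> using pos[OF that] by simp
    qed (rule finite_multi_indices)
    finally have S: "(\<Sum>f\<in>compositions UNIV k. A f) = ln (\<Prod>\<alpha>\<in>multi_indices k. cheb v k \<alpha>)" .
    have "card (compositions (UNIV :: 'n option set) k) = N TYPE('n) k"
      using sum_compositions_option[of "\<lambda>_ :: 'n \<Rightarrow> nat. 1 :: nat" k] card_multi_indices[where 'n = 'n, of k] by simp
    moreover have "(\<Prod>\<alpha>\<in>multi_indices k. cheb v k \<alpha>) \<noteq> 0"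
      using pos by (metis finite_multi_indices less_irrefl prod_zero_iff)
    ultimately show ?thesis
      by (simp add: cheb_mean_def avg_def S powr_def)
  qed
  ultimately show ?thesis by (simp flip: exp_add)
qed

text \<open>If all Chebyshev constants are positive, Fekete's lemma applies. A single zero one
  propagates to all higher degrees, and the sequence is eventually 0.\<close>

lemma cheb_mean_convergent:
  assumes v: "continuous_on K v"
  shows "convergent (\<lambda>k. cheb_mean v k powr (1 / real k))"
proof (cases "\<forall>k. \<forall>\<alpha>\<in>multi_indices k. cheb v k \<alpha> > 0")
  case True
  show ?thesis
  proof (rule submultiplicative_root_convergent)
    show "0 \<le> cheb_mean v k" for k by (simp add: cheb_mean_def)
    show "cheb_mean v (k + l) \<le> cheb_mean v k * cheb_mean v l" for k l
      by (rule cheb_mean_submultiplicative[OF v]) (use True in auto)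
  qed
next
  case False
  then obtain l \<alpha> where l: "\<alpha> \<in> multi_indices l" "\<not> cheb v l \<alpha> > 0" by blast
  then have zero: "cheb v l \<alpha> = 0" using cheb_nonneg[OF v, of l \<alpha>] by simp
  have "cheb_mean v k powr (1 / real k) = 0" if k: "k \<ge> l" for k
  proof -
    \<comment> \<open>Multiplication by polynomials with leading exponent 0 raises the degree bound
      without moving \<alpha>.\<close>
    have 0: "(\<lambda>_. 0) \<in> multi_indices (k - l)" by (simp add: multi_indices_def)
    have "cheb v (l + (k - l)) (\<lambda>i. \<alpha> i + 0) \<le> 0"
      using cheb_submultiplicative[OF v l(1) 0] zero by simp
    then have "cheb v k \<alpha> = 0" using k cheb_nonneg[OF v, of k \<alpha>] by simp
    moreover have "\<alpha> \<in> multi_indices k" using l(1) k by (simp add: multi_indices_def)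
    ultimately have "(\<Prod>\<alpha>\<in>multi_indices k. cheb v k \<alpha>) = 0"
      by (intro prod_zero[OF finite_multi_indices]) auto
    then show ?thesis by (simp add: cheb_mean_def)
  qed
  then have "\<forall>\<^sub>F k in sequentially. 0 = cheb_mean v k powr (1 / real k)"
    by (intro eventually_sequentiallyI[of l]) simp
  then have "(\<lambda>k. cheb_mean v k powr (1 / real k)) \<longlonglongrightarrow> 0"
    by (rule Lim_transform_eventually[OF tendsto_const])
  then show ?thesis by (rule convergentI)
qed

text \<open>Since \<open>lim\<close> has a meaning only for convergent sequences, convergence must
  come first. The roots of the Chebyshev means converge; L2 norm and maximum are squeezed to the
  same limit by factors built from N! and M k whose roots tend to 1.\<close>

lemma transfinite_diameter_limits:
  assumes v: "continuous_on K v"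
  shows "(\<lambda>k. wVDM_sup v k powr (1 / (real k * real (N TYPE('n) k)))) \<longlonglongrightarrow> transfinite_diameter K v" (is "?s \<longlonglongrightarrow> _")
    and "(\<lambda>k. sqrt (Z v k) powr (1 / (real k * real (N TYPE('n) k)))) \<longlonglongrightarrow> transfinite_diameter K v" (is "?z \<longlonglongrightarrow> _")
proof -
  define F where "F k = sqrt (fact (N TYPE('n) k)) powr (1 / (real k * real (N TYPE('n) k)))" for k
  have F: "F \<longlonglongrightarrow> 1" unfolding F_def[abs_def] by (rule fact_root_tendsto)
  obtain M where M: "(\<lambda>k. M k powr (1 / real k)) \<longlonglongrightarrow> 1" and M1: "\<forall>k\<ge>1. M k \<ge> 1"
    and BM: "\<forall>k\<ge>1. \<forall>p\<in>polys k. wnorm v k p \<le> M k * sqrt (norm2 (weighted v k p))"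
    using Bernstein_Markov_constants[OF v] by blast
  note M1 = M1[rule_format] and BM = BM[rule_format]
  define c where "c k = cheb_mean v k powr (1 / real k)" for k
  obtain L where L: "c \<longlonglongrightarrow> L"
    using cheb_mean_convergent[OF v] unfolding c_def[abs_def] convergent_def by blast
  have c_eq: "c k = (\<Prod>\<alpha>\<in>multi_indices k. cheb v k \<alpha>) powr (1 / (real k * real (N TYPE('n) k)))" for k
    by (simp add: c_def cheb_mean_def powr_powr mult.commute)
  have C0: "0 \<le> (\<Prod>\<alpha>\<in>multi_indices k. cheb v k \<alpha>)" for k
    by (intro prod_nonneg ballI cheb_nonneg v)
  have Z0: "0 \<le> sqrt (Z v k)" for k unfolding Z_def by simp
  have M_root: "(M k ^ N TYPE('n) k) powr (1 / (real k * real (N TYPE('n) k))) = M k powr (1 / real k)"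
    if k: "k \<ge> 1" for k
  proof -
    have "M k ^ N TYPE('n) k = M k powr real (N TYPE('n) k)"
      using M1[OF k] by (simp add: powr_realpow)
    then show ?thesis
      using N_pos[where 'n = 'n, of k] by (simp add: powr_powr)
  qed
  have bounds: "c k \<le> M k powr (1 / real k) * ?z k \<and> ?z k \<le> F k * c k \<and> ?z k \<le> ?s k
      \<and> ?s k \<le> F k * M k powr (1 / real k) * ?z k" if k: "k \<ge> 1" for k
  proof -
    have M0: "0 \<le> M k" using M1[OF k] by simp
    note est = wVDM_estimates[OF v M0 BM[OF k]]
    let ?e = "1 / (real k * real (N TYPE('n) k))"
    have "c k \<le> (M k ^ N TYPE('n) k * sqrt (Z v k)) powr ?e"
      unfolding c_eq by (rule powr_mono2[OF _ C0 est(1)]) auto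
    moreover have "\<dots> = M k powr (1 / real k) * ?z k"
      using M0 Z0 by (simp add: powr_mult M_root[OF k])
    moreover have "?z k \<le> (sqrt (fact (N TYPE('n) k)) * (\<Prod>\<alpha>\<in>multi_indices k. cheb v k \<alpha>)) powr ?e"
      by (rule powr_mono2[OF _ Z0 est(2)]) auto
    moreover have "\<dots> = F k * c k"
      using C0 by (simp add: powr_mult F_def c_eq)
    moreover have "?z k \<le> ?s k"
      by (rule powr_mono2[OF _ Z0 sqrt_Z_le_sup[OF v]]) auto
    moreover have "?s k \<le> (sqrt (fact (N TYPE('n) k)) * M k ^ N TYPE('n) k * sqrt (Z v k)) powr ?e"
      by (rule powr_mono2[OF _ order_trans[OF Z0 sqrt_Z_le_sup[OF v]] est(3)]) auto
    moreover have "\<dots> = F k * M k powr (1 / real k) * ?z k"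
      using M0 Z0 by (simp add: powr_mult M_root[OF k] F_def)
    ultimately show ?thesis by simp
  qed
  have "?z \<longlonglongrightarrow> L"
  proof (rule tendsto_sandwich)
    show "\<forall>\<^sub>F k in sequentially. c k / M k powr (1 / real k) \<le> ?z k"
    proof (intro eventually_sequentiallyI[of 1])
      fix k :: nat assume k: "1 \<le> k"
      have "0 < M k powr (1 / real k)" using M1[OF k] by simp
      then show "c k / M k powr (1 / real k) \<le> ?z k"
        using bounds[OF k] by (simp only: pos_divide_le_eq mult.commute)
    qed
    show "\<forall>\<^sub>F k in sequentially. ?z k \<le> F k * c k"
      using bounds by (intro eventually_sequentiallyI[of 1]) blast
    show "(\<lambda>k. c k / M k powr (1 / real k)) \<longlonglongrightarrow> L" using tendsto_divide[OF L M] by simp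
    show "(\<lambda>k. F k * c k) \<longlonglongrightarrow> L" using tendsto_mult[OF F L] by simp
  qed
  moreover have "?s \<longlonglongrightarrow> L"
  proof (rule tendsto_sandwich)
    show "\<forall>\<^sub>F k in sequentially. ?z k \<le> ?s k"
      using bounds by (intro eventually_sequentiallyI[of 1]) blast
    show "\<forall>\<^sub>F k in sequentially. ?s k \<le> F k * M k powr (1 / real k) * ?z k"
      using bounds by (intro eventually_sequentiallyI[of 1]) blast
    show "?z \<longlonglongrightarrow> L" by fact
    show "(\<lambda>k. F k * M k powr (1 / real k) * ?z k) \<longlonglongrightarrow> L"
      using tendsto_mult[OF tendsto_mult[OF F M] \<open>?z \<longlonglongrightarrow> L\<close>] by simp
  qed
  moreover from this have "transfinite_diameter K v = L"
    unfolding transfinite_diameter_def wVDM_sup_def[symmetric] by (rule limI)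
  ultimately show "?s \<longlonglongrightarrow> transfinite_diameter K v" "?z \<longlonglongrightarrow> transfinite_diameter K v" by simp_all
qed

text \<open>Indexing by exponents rather than by positions allows the factors belonging to two
  different weights to be compared one by one, although their enumerations are chosen
  independently.\<close>

lemma Gram_Schmidt_indexed:
  assumes v: "continuous_on K v"
  shows "\<exists>q. (\<forall>\<alpha>\<in>multi_indices k. q \<alpha> \<in> monic k \<alpha>)
    \<and> Z v k = fact (N TYPE('n) k) * (\<Prod>\<alpha>\<in>multi_indices k. norm2 (weighted v k (q \<alpha>)))
    \<and> (\<forall>\<alpha>\<in>multi_indices k. \<forall>p\<in>monic k \<alpha>. norm2 (weighted v k (q \<alpha>)) \<le> norm2 (weighted v k p))"
proof -
  let ?n = "N TYPE('n) k"
  obtain h q where h: "bij_betw h {..<?n} (multi_indices k :: ('n \<Rightarrow> nat) set)"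
    and q: "\<And>i. i < ?n \<Longrightarrow> q i \<in> monic k (h i)"
    and Z: "Z v k = fact ?n * (\<Prod>i<?n. norm2 (weighted v k (q i)))"
    and min: "\<And>i p. i < ?n \<Longrightarrow> p \<in> monic k (h i) \<Longrightarrow> norm2 (weighted v k (q i)) \<le> norm2 (weighted v k p)"
    using Gram_Schmidt_wVDM[OF v, of k] by blast
  define g where "g = the_inv_into {..<?n} h"
  have g: "g \<alpha> < ?n" "h (g \<alpha>) = \<alpha>" if "\<alpha> \<in> multi_indices k" for \<alpha>
    using that h bij_betw_the_inv_into[OF h] f_the_inv_into_f_bij_betw[OF h]
    by (auto simp: g_def bij_betw_def)
  have gh: "g (h i) = i" if "i < ?n" for i
    using that h by (auto simp: g_def bij_betw_def the_inv_into_f_f)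
  have "(\<Prod>\<alpha>\<in>multi_indices k. norm2 (weighted v k (q (g \<alpha>)))) = (\<Prod>i<?n. norm2 (weighted v k (q (g (h i)))))"
    by (rule prod.reindex_bij_betw[OF h, symmetric])
  also have "\<dots> = (\<Prod>i<?n. norm2 (weighted v k (q i)))"
    by (intro prod.cong) (auto simp: gh)
  finally have "Z v k = fact ?n * (\<Prod>\<alpha>\<in>multi_indices k. norm2 (weighted v k (q (g \<alpha>))))"
    using Z by simp
  moreover have "\<forall>\<alpha>\<in>multi_indices k. q (g \<alpha>) \<in> monic k \<alpha>"
    using q g by metis
  moreover have "\<forall>\<alpha>\<in>multi_indices k. \<forall>p\<in>monic k \<alpha>. norm2 (weighted v k (q (g \<alpha>))) \<le> norm2 (weighted v k p)"
    using min g by metis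
  ultimately show ?thesis by (intro exI[of _ "\<lambda>\<alpha>. q (g \<alpha>)"]) blast
qed

end

section \<open>Laplace transforms of linear statistics\<close>

lemma exp_le_quadratic:
  fixes y :: real
  assumes "\<bar>y\<bar> \<le> 1"
  shows "exp y \<le> 1 + y + y\<^sup>2"
proof (cases "y \<ge> 0")
  case True
  then show ?thesis using exp_bound[of y] assms by simp
next
  case False
  define x where "x = - y"
  have x: "x > 0" using False by (simp add: x_def)
  \<comment> \<open>The claim for y = -x is cleared of its denominator exp x, and exp x is replaced
    by its quadratic Taylor minorant.\<close>
  have "1 \<le> (1 - x + x\<^sup>2) * (1 + x + x\<^sup>2 / 2)"
  proof -
    have "(1 - x + x\<^sup>2) * (1 + x + x\<^sup>2 / 2) = 1 + x\<^sup>2 / 2 + x ^ 3 / 2 + x ^ 4 / 2"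
      by (simp add: power2_eq_square power3_eq_cube power4_eq_xxxx algebra_simps add_divide_distrib diff_divide_distrib)
    then show ?thesis using x by simp
  qed
  also have "\<dots> \<le> (1 - x + x\<^sup>2) * exp x"
  proof (rule mult_left_mono)
    show "1 + x + x\<^sup>2 / 2 \<le> exp x" using x by (intro exp_lower_Taylor_quadratic) simp
    have "0 \<le> (1 - x)\<^sup>2 + x" using x by simp
    then show "0 \<le> 1 - x + x\<^sup>2" by (simp add: power2_eq_square algebra_simps)
  qed
  finally have "exp (- x) \<le> 1 - x + x\<^sup>2"
    by (simp add: exp_minus field_simps)
  then show ?thesis by (simp add: x_def)
qed

context bernstein_markov begin

lemma cmod_wVDM_add:
  "(cmod (wVDM (\<lambda>x. v x + u x) k (a :: nat \<Rightarrow> complex ^ 'n)))\<^sup>2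
    = (cmod (wVDM v k a))\<^sup>2 * exp (- 2 * real k * (\<Sum>j<N TYPE('n) k. u (a j)))"
proof -
  have "(exp (- real k * (\<Sum>j<N TYPE('n) k. u (a j))))\<^sup>2 = exp (- 2 * real k * (\<Sum>j<N TYPE('n) k. u (a j)))"
    by (simp flip: exp_double)
  then show ?thesis by (simp add: wVDM_add norm_mult power_mult_distrib)
qed

text \<open>This is the bound exp(t * mean + t^2 B^2) for the moment generating function of a
  variable bounded by B, with t = 2ks and |t| B at most 1, under the probability density
  proportional to |weighted v k p|^2.\<close>

lemma norm2_weighted_tilt:
  assumes v: "continuous_on K v" and u: "continuous_on K u" and p: "continuous_on K p"
    and B: "\<And>x. x \<in> K \<Longrightarrow> \<bar>u x\<bar> \<le> B" and s: "\<bar>2 * real k * s\<bar> * B \<le> 1" and "B \<ge> 0"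
    and pos: "norm2 (weighted v k p) > 0"
  shows "norm2 (weighted (\<lambda>x. v x - s * u x) k p) \<le> norm2 (weighted v k p) *
    exp (2 * real k * s * ((\<integral>x. (cmod (weighted v k p x))\<^sup>2 * u x \<partial>\<nu>) / norm2 (weighted v k p))
      + (2 * real k * s)\<^sup>2 * B\<^sup>2)"
proof -
  define t where "t = 2 * real k * s"
  let ?w = "\<lambda>x. (cmod (weighted v k p x))\<^sup>2"
  define n where "n = norm2 (weighted v k p)"
  have w: "continuous_on K ?w" by (intro continuous_intros continuous_on_weighted v p)
  have eq: "(cmod (weighted (\<lambda>x. v x - s * u x) k p x))\<^sup>2 = ?w x * exp (t * u x)" for x
  proof -
    have "exp (- real k * (v x - s * u x)) = exp (- real k * v x) * exp (real k * s * u x)"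
      by (simp add: algebra_simps flip: exp_add)
    moreover have "(exp (real k * s * u x))\<^sup>2 = exp (t * u x)"
      by (simp add: t_def mult.assoc flip: exp_double)
    ultimately show ?thesis
      by (simp add: weighted_def norm_mult power_mult_distrib)
  qed
  have "norm2 (weighted (\<lambda>x. v x - s * u x) k p) = (\<integral>x. ?w x * exp (t * u x) \<partial>\<nu>)"
    unfolding norm2_def eq ..
  also have "\<dots> \<le> (\<integral>x. (1 + t\<^sup>2 * B\<^sup>2) * ?w x + t * (?w x * u x) \<partial>\<nu>)"
  proof (rule integral_mono)
    fix x assume "x \<in> space \<nu>"
    then have x: "\<bar>u x\<bar> \<le> B" by (simp add: B space_\<nu>)
    have le: "\<bar>t * u x\<bar> \<le> \<bar>t\<bar> * B" using x by (simp add: abs_mult mult_left_mono)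
    then have "exp (t * u x) \<le> 1 + t * u x + (t * u x)\<^sup>2"
      using s by (intro exp_le_quadratic) (simp add: t_def)
    also have "(t * u x)\<^sup>2 \<le> t\<^sup>2 * B\<^sup>2"
      using power_mono[OF le, of 2] by (simp add: power_mult_distrib)
    finally have "?w x * exp (t * u x) \<le> ?w x * (1 + t * u x + t\<^sup>2 * B\<^sup>2)"
      by (intro mult_left_mono) auto
    then show "?w x * exp (t * u x) \<le> (1 + t\<^sup>2 * B\<^sup>2) * ?w x + t * (?w x * u x)"
      by (simp add: algebra_simps)
  qed (intro integrable_continuous continuous_intros w u)+
  also have "\<dots> = (1 + t\<^sup>2 * B\<^sup>2) * n + t * (\<integral>x. ?w x * u x \<partial>\<nu>)"
    unfolding n_def norm2_def
    by (subst Bochner_Integration.integral_add) (auto intro!: integrable_continuous continuous_intros w u)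
  also have "\<dots> = n * (1 + (t * ((\<integral>x. ?w x * u x \<partial>\<nu>) / n) + t\<^sup>2 * B\<^sup>2))"
    using pos by (simp add: n_def field_simps)
  also have "\<dots> \<le> n * exp (t * ((\<integral>x. ?w x * u x \<partial>\<nu>) / n) + t\<^sup>2 * B\<^sup>2)"
    using pos by (intro mult_left_mono exp_ge_add_one_self) (simp add: n_def)
  finally show ?thesis by (simp add: n_def t_def)
qed

text \<open>The classes \<open>monic k \<alpha>\<close> do not involve the weight, so the orthogonal
  polynomials of the old weight compete under the new one and bound its minimal norms factor by
  factor. The centre m, the sum of the means of u under their normalized densities, does not depend
  on s; both signs of s are used later with the same m.\<close>

lemma Z_tilt:
  assumes v: "continuous_on K v" and u: "continuous_on K u"
    and B: "\<And>x. x \<in> K \<Longrightarrow> \<bar>u x\<bar> \<le> B" and "B \<ge> 0" and pos: "Z v k > 0"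
  shows "\<exists>m. \<forall>s. \<bar>2 * real k * s\<bar> * B \<le> 1 \<longrightarrow>
    Z (\<lambda>x. v x - s * u x) k \<le> Z v k * exp (2 * real k * s * m + (2 * real k * s)\<^sup>2 * B\<^sup>2 * real (N TYPE('n) k))"
proof -
  let ?I = "multi_indices k :: ('n \<Rightarrow> nat) set"
  obtain q where q: "\<And>\<alpha>. \<alpha> \<in> ?I \<Longrightarrow> q \<alpha> \<in> monic k \<alpha>"
    and Z: "Z v k = fact (N TYPE('n) k) * (\<Prod>\<alpha>\<in>?I. norm2 (weighted v k (q \<alpha>)))"
    using Gram_Schmidt_indexed[OF v, of k] by blast
  define d where "d \<alpha> = norm2 (weighted v k (q \<alpha>))" for \<alpha>
  have d: "d \<alpha> > 0" if "\<alpha> \<in> ?I" for \<alpha>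
  proof -
    have "(\<Prod>\<alpha>\<in>?I. d \<alpha>) \<noteq> 0" using pos Z by (auto simp: d_def)
    then have "d \<alpha> \<noteq> 0" using that finite_multi_indices by (metis prod_zero_iff)
    then show ?thesis using norm2_nonneg[of "weighted v k (q \<alpha>)"] by (simp add: d_def)
  qed
  define m where "m \<alpha> = (\<integral>x. (cmod (weighted v k (q \<alpha>) x))\<^sup>2 * u x \<partial>\<nu>) / d \<alpha>" for \<alpha>
  show ?thesis
  proof (intro exI[of _ "\<Sum>\<alpha>\<in>?I. m \<alpha>"] allI impI)
    fix s assume s: "\<bar>2 * real k * s\<bar> * B \<le> 1"
    let ?v = "\<lambda>x. v x - s * u x"
    have v': "continuous_on K ?v" by (intro continuous_intros v u)
    obtain q' where q': "\<And>\<alpha>. \<alpha> \<in> ?I \<Longrightarrow> q' \<alpha> \<in> monic k \<alpha>"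
      and Z': "Z ?v k = fact (N TYPE('n) k) * (\<Prod>\<alpha>\<in>?I. norm2 (weighted ?v k (q' \<alpha>)))"
      and min: "\<And>\<alpha> p. \<alpha> \<in> ?I \<Longrightarrow> p \<in> monic k \<alpha> \<Longrightarrow>
        norm2 (weighted ?v k (q' \<alpha>)) \<le> norm2 (weighted ?v k p)"
      using Gram_Schmidt_indexed[OF v', of k] by blast
    let ?t = "2 * real k * s"
    have "(\<Prod>\<alpha>\<in>?I. norm2 (weighted ?v k (q' \<alpha>))) \<le> (\<Prod>\<alpha>\<in>?I. d \<alpha> * exp (?t * m \<alpha> + ?t\<^sup>2 * B\<^sup>2))"
    proof (intro prod_mono conjI norm2_nonneg)
      fix \<alpha> assume \<alpha>: "\<alpha> \<in> ?I"
      have "norm2 (weighted ?v k (q' \<alpha>)) \<le> norm2 (weighted ?v k (q \<alpha>))"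
        by (rule min[OF \<alpha> q[OF \<alpha>]])
      also have "\<dots> \<le> d \<alpha> * exp (?t * m \<alpha> + ?t\<^sup>2 * B\<^sup>2)"
        unfolding m_def d_def
        by (rule norm2_weighted_tilt[OF v u continuous_on_monic[OF q[OF \<alpha>]] B s \<open>B \<ge> 0\<close>])
          (use d[OF \<alpha>] in \<open>simp_all add: d_def\<close>)
      finally show "norm2 (weighted ?v k (q' \<alpha>)) \<le> d \<alpha> * exp (?t * m \<alpha> + ?t\<^sup>2 * B\<^sup>2)" .
    qed
    also have "\<dots> = (\<Prod>\<alpha>\<in>?I. d \<alpha>) * exp (\<Sum>\<alpha>\<in>?I. ?t * m \<alpha> + ?t\<^sup>2 * B\<^sup>2)"
      by (simp add: prod.distrib exp_sum finite_multi_indices)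
    also have "(\<Sum>\<alpha>\<in>?I. ?t * m \<alpha> + ?t\<^sup>2 * B\<^sup>2) = ?t * (\<Sum>\<alpha>\<in>?I. m \<alpha>) + ?t\<^sup>2 * B\<^sup>2 * real (N TYPE('n) k)"
      by (simp add: sum.distrib card_multi_indices flip: sum_distrib_left)
    finally show "Z ?v k \<le> Z v k * exp (?t * (\<Sum>\<alpha>\<in>?I. m \<alpha>) + ?t\<^sup>2 * B\<^sup>2 * real (N TYPE('n) k))"
      unfolding Z Z' d_def[symmetric] mult.assoc by (intro mult_left_mono) auto
  qed
qed

end

section \<open>Empirical measures and weak-star neighbourhoods\<close>

lemma sets_empirical_measure: "sets (empirical_measure K s a) = sets (restrict_space borel K)"
  unfolding empirical_measure_def
  using sets.sigma_sets_eq[of "restrict_space borel K"] sets.space_closed[of "restrict_space borel K"]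
  by (simp add: space_restrict_space)

lemma empirical_measure_distr:
  assumes "s \<ge> 1" and a: "\<And>j. j < s \<Longrightarrow> a j \<in> K"
  shows "empirical_measure K s a = distr (uniform_count_measure {..<s}) (restrict_space borel K) a"
proof (rule measure_eqI)
  show "sets (empirical_measure K s a)
      = sets (distr (uniform_count_measure {..<s}) (restrict_space borel K) a)"
    by (simp add: sets_empirical_measure)
  fix A assume "A \<in> sets (empirical_measure K s a)"
  then have A: "A \<in> sets (restrict_space borel K)" by (simp add: sets_empirical_measure)
  have meas: "a \<in> uniform_count_measure {..<s} \<rightarrow>\<^sub>M restrict_space borel K"
    using a by (auto simp: measurable_def space_restrict_space space_uniform_count_measure
        sets_uniform_count_measure)
  have "(\<Sum>j<s. emeasure (return (restrict_space borel K) (a j)) A) = (\<Sum>j<s. indicator A (a j))"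
    using A by simp
  also have "\<dots> = of_nat (card {j \<in> {..<s}. a j \<in> A})"
    by (simp add: indicator_def sum.If_cases Int_def)
  also have "\<dots> / of_nat s = ennreal (real (card {j \<in> {..<s}. a j \<in> A}) / real s)"
    using \<open>s \<ge> 1\<close> by (simp add: divide_ennreal[symmetric] ennreal_of_nat_eq_real_of_nat)
  also have "\<dots> = emeasure (distr (uniform_count_measure {..<s}) (restrict_space borel K) a) A"
  proof -
    have "a -` A \<inter> space (uniform_count_measure {..<s}) = {j \<in> {..<s}. a j \<in> A}"
      by (auto simp: space_uniform_count_measure)
    moreover have "emeasure (uniform_count_measure {..<s}) {j \<in> {..<s}. a j \<in> A}
        = ennreal (real (card {j \<in> {..<s}. a j \<in> A}) / real s)"
      by (subst emeasure_uniform_count_measure) auto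
    ultimately show ?thesis using A by (subst emeasure_distr[OF meas]) simp_all
  qed
  finally show "emeasure (empirical_measure K s a) A
      = emeasure (distr (uniform_count_measure {..<s}) (restrict_space borel K) a) A"
    using emeasure_empirical_measure[OF A, of s a] by simp
qed

lemma integral_empirical_measure:
  fixes f :: "'a::topological_space \<Rightarrow> real"
  assumes "s \<ge> 1" and a: "\<And>j. j < s \<Longrightarrow> a j \<in> K" and f: "continuous_on K f"
  shows "(\<integral>x. f x \<partial>empirical_measure K s a) = (\<Sum>j<s. f (a j)) / real s"
proof -
  have meas: "a \<in> uniform_count_measure {..<s} \<rightarrow>\<^sub>M restrict_space borel K"
    using a by (auto simp: measurable_def space_restrict_space space_uniform_count_measure
        sets_uniform_count_measure)
  show ?thesis
  proof -
    have eq: "empirical_measure K s a = distr (uniform_count_measure {..<s}) (restrict_space borel K) a"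
      using assms by (intro empirical_measure_distr) auto
    show ?thesis
      unfolding eq
      by (subst integral_distr[OF meas borel_measurable_continuous_on_restrict[OF f]])
        (simp_all add: integral_uniform_count_measure)
  qed
qed

text \<open>Generation of the topology involves arbitrary unions, which preserve openness but not
  measurability. Hence openness is proved first; subbasic sets are preimages under a continuous
  average of f.\<close>

lemma openin_tilde:
  fixes K :: "'a::t2_space set"
  assumes G: "openin (weak_star K) G" and s: "s \<ge> 1"
  shows "openin (top_of_set ({..<s} \<rightarrow>\<^sub>E K)) (tilde K G s)"
proof -
  let ?S = "{{\<mu> \<in> prob_measures K. (\<integral>x. f x \<partial>\<mu>) \<in> U} | (f :: 'a \<Rightarrow> real) U. continuous_on K f \<and> open U}"
  have "generate_topology_on ?S G"
    using G unfolding weak_star_def openin_topology_generated_by_iff .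
  then show ?thesis
  proof induct
    case Empty
    then show ?case by (simp add: tilde_def)
  next
    case (Int A B)
    have "tilde K (A \<inter> B) s = tilde K A s \<inter> tilde K B s" by (auto simp: tilde_def)
    then show ?case using Int by (simp add: openin_Int)
  next
    case (UN \<A>)
    have "tilde K (\<Union>\<A>) s = (\<Union>A\<in>\<A>. tilde K A s)" by (auto simp: tilde_def)
    then show ?case using UN by (auto intro!: openin_Union)
  next
    case (Basis A)
    then obtain f :: "'a \<Rightarrow> real" and U where A: "A = {\<mu> \<in> prob_measures K. (\<integral>x. f x \<partial>\<mu>) \<in> U}"
      and f: "continuous_on K f" and U: "open U" by blast
    have "tilde K A s = ({..<s} \<rightarrow>\<^sub>E K) \<inter> (\<lambda>a. (\<Sum>j<s. f (a j)) / real s) -` U"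
    proof (rule Set.set_eqI)
      fix a
      show "a \<in> tilde K A s \<longleftrightarrow> a \<in> ({..<s} \<rightarrow>\<^sub>E K) \<inter> (\<lambda>a. (\<Sum>j<s. f (a j)) / real s) -` U"
      proof (cases "a \<in> {..<s} \<rightarrow>\<^sub>E K")
        case True
        then have mem: "a j \<in> K" if "j < s" for j using that by auto
        show ?thesis
          using True empirical_measure_in_prob_measures[OF s mem] integral_empirical_measure[OF s mem f]
          by (simp add: tilde_def A)
      qed (simp add: tilde_def)
    qed
    moreover have "continuous_on ({..<s} \<rightarrow>\<^sub>E K) (\<lambda>a. (\<Sum>j<s. f (a j)) / real s)"
    proof (intro continuous_intros)
      fix j assume j: "j \<in> {..<s}"
      have "continuous_on ({..<s} \<rightarrow>\<^sub>E K) (\<lambda>a. a j)"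
        by (rule continuous_on_subset[OF continuous_on_product_coordinates]) simp
      then show "continuous_on ({..<s} \<rightarrow>\<^sub>E K) (\<lambda>a. f (a j))"
        by (rule continuous_on_compose2[OF f]) (use j in auto)
    qed (use s in simp)
    ultimately show ?case using continuous_openin_preimage_gen U by simp
  qed
qed

lemma weak_star_neighbourhood:
  fixes K :: "'a::topological_space set"
  assumes G: "openin (weak_star K) G" and "\<mu> \<in> G"
  shows "\<exists>(F :: ('a \<Rightarrow> real) set) \<epsilon>. finite F \<and> \<epsilon> > 0 \<and> (\<forall>f\<in>F. continuous_on K f) \<and>
    {\<sigma> \<in> prob_measures K. \<forall>f\<in>F. \<bar>(\<integral>x. f x \<partial>\<sigma>) - (\<integral>x. f x \<partial>\<mu>)\<bar> < \<epsilon>} \<subseteq> G"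
proof -
  let ?S = "{{\<mu> \<in> prob_measures K. (\<integral>x. f x \<partial>\<mu>) \<in> U} | (f :: 'a \<Rightarrow> real) U. continuous_on K f \<and> open U}"
  define Nb where "Nb F e = {\<sigma> \<in> prob_measures K. \<forall>f\<in>F. \<bar>(\<integral>x. f x \<partial>\<sigma>) - (\<integral>x. f x \<partial>\<mu>)\<bar> < e}"
    for F :: "('a \<Rightarrow> real) set" and e :: real
  have "generate_topology_on ?S G"
    using G unfolding weak_star_def openin_topology_generated_by_iff .
  then have "\<exists>F e. finite F \<and> e > 0 \<and> (\<forall>f\<in>F. continuous_on K f) \<and> Nb F e \<subseteq> G"
    using \<open>\<mu> \<in> G\<close>
  proof induct
    case Empty
    then show ?case by simp
  next
    case (Int A B)
    then obtain F e where F: "finite F" "e > 0" "\<forall>f\<in>F. continuous_on K f" "Nb F e \<subseteq> A" by auto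
    from Int obtain F' e' where F': "finite F'" "e' > 0" "\<forall>f\<in>F'. continuous_on K f" "Nb F' e' \<subseteq> B"
      by auto
    have "Nb (F \<union> F') (min e e') \<subseteq> Nb F e" "Nb (F \<union> F') (min e e') \<subseteq> Nb F' e'"
      by (simp_all add: Nb_def subset_iff)
    then have "Nb (F \<union> F') (min e e') \<subseteq> A \<inter> B" using F(4) F'(4) by blast
    moreover have "finite (F \<union> F')" "min e e' > 0" "\<forall>f\<in>F \<union> F'. continuous_on K f"
      using F F' by auto
    ultimately show ?case by (intro exI conjI)
  next
    case (UN \<A>)
    then obtain A where A: "A \<in> \<A>" "\<mu> \<in> A" by auto
    then obtain F e where F: "finite F" "e > 0" "\<forall>f\<in>F. continuous_on K f" "Nb F e \<subseteq> A"
      using UN(2)[OF A] by auto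
    then have "Nb F e \<subseteq> \<Union>\<A>" using A(1) by auto
    with F(1-3) show ?case by (intro exI conjI)
  next
    case (Basis A)
    then obtain f :: "'a \<Rightarrow> real" and U where A: "A = {\<mu> \<in> prob_measures K. (\<integral>x. f x \<partial>\<mu>) \<in> U}"
      and f: "continuous_on K f" and U: "open U" by blast
    have "(\<integral>x. f x \<partial>\<mu>) \<in> U" using Basis.prems by (simp add: A)
    then obtain e where e: "e > 0" "ball (\<integral>x. f x \<partial>\<mu>) e \<subseteq> U"
      by (rule openE[OF U])
    have "Nb {f} e \<subseteq> A"
    proof
      fix \<sigma> assume \<sigma>: "\<sigma> \<in> Nb {f} e"
      then have "(\<integral>x. f x \<partial>\<sigma>) \<in> ball (\<integral>x. f x \<partial>\<mu>) e"
        by (simp add: Nb_def dist_real_def abs_minus_commute)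
      then show "\<sigma> \<in> A" using \<sigma> e(2) by (simp add: A Nb_def subset_eq)
    qed
    moreover have "finite {f}" "\<forall>g\<in>{f}. continuous_on K g" using f by simp_all
    ultimately show ?case using e(1) by (intro exI conjI)
  qed
  then show ?thesis unfolding Nb_def .
qed

lemma openin_weak_star_ball:
  fixes f :: "'a::topological_space \<Rightarrow> real"
  assumes "continuous_on K f"
  shows "openin (weak_star K) {\<sigma> \<in> prob_measures K. \<bar>(\<integral>x. f x \<partial>\<sigma>) - c\<bar> < \<epsilon>}"
proof -
  have "{\<sigma> \<in> prob_measures K. \<bar>(\<integral>x. f x \<partial>\<sigma>) - c\<bar> < \<epsilon>}
      = {\<sigma> \<in> prob_measures K. (\<integral>x. f x \<partial>\<sigma>) \<in> {c - \<epsilon><..<c + \<epsilon>}}" by (auto simp: abs_less_iff)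
  then show ?thesis
    unfolding weak_star_def using assms
    by (intro topology_generated_by_Basis CollectI exI[of _ f] exI[of _ "{c - \<epsilon><..<c + \<epsilon>}"]) simp
qed

lemma (in compact_prob) integral_bounded_abs:
  fixes f :: "'a \<Rightarrow> real"
  assumes "continuous_on K f" "\<And>x. x \<in> K \<Longrightarrow> \<bar>f x\<bar> \<le> B"
  shows "\<bar>\<integral>x. f x \<partial>\<nu>\<bar> \<le> B"
proof -
  have i: "integrable \<nu> f" by (rule integrable_continuous[OF assms(1)])
  have "(\<integral>x. f x \<partial>\<nu>) \<le> B"
    using assms(2) by (intro integral_le_const i AE_I2) (auto simp: space_\<nu> abs_le_iff)
  moreover have "- B \<le> (\<integral>x. f x \<partial>\<nu>)"
    using assms(2) by (intro integral_ge_const i AE_I2) (auto simp: space_\<nu> abs_le_iff minus_le_iff)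
  ultimately show ?thesis by (simp add: abs_le_iff)
qed

text \<open>Relatively open sets are product measurable because the Borel sets of a countable
  product of second countable spaces form the product sigma-algebra. Measurability matters: an
  integral over a nonmeasurable set could silently take the default value 0.\<close>

lemma (in bernstein_markov) tilde_measurable:
  assumes G: "openin (weak_star K) G" and s: "s \<ge> 1"
  shows "tilde K G s \<in> sets (Pi\<^sub>M {..<s} (\<lambda>_. \<nu>))"
proof -
  let ?M = "Pi\<^sub>M {..<s} (\<lambda>_. \<nu>)"
  obtain T where T: "open T" "tilde K G s = T \<inter> ({..<s} \<rightarrow>\<^sub>E K)"
    using openin_tilde[OF G s] by (auto simp: openin_open)
  have comp: "(\<lambda>a. a i) \<in> ?M \<rightarrow>\<^sub>M borel" for i
  proof (cases "i < s")
    case True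
    then have "(\<lambda>a. a i) \<in> ?M \<rightarrow>\<^sub>M \<nu>" by (intro measurable_component_singleton) simp
    moreover have "(\<lambda>x. x) \<in> \<nu> \<rightarrow>\<^sub>M borel" by (rule measurable_continuous[OF continuous_on_id])
    ultimately show ?thesis by (rule measurable_compose)
  next
    case False
    \<comment> \<open>The topology lives on functions with all natural numbers as arguments;
      coordinates beyond s are constant on extensional functions.\<close>
    then have "a i = undefined" if "a \<in> space ?M" for a
      using that by (auto simp: space_product PiE_def extensional_def)
    then show ?thesis by (subst measurable_cong[where g = "\<lambda>_. undefined"]) auto
  qed
  have "(\<lambda>a. a) \<in> ?M \<rightarrow>\<^sub>M Pi\<^sub>M UNIV (\<lambda>_. borel)"
    by (rule measurable_PiM_single') (use comp in auto)
  then have "(\<lambda>a. a) \<in> ?M \<rightarrow>\<^sub>M borel"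
    using measurable_cong_sets[OF refl sets_PiM_equal_borel] by blast
  then have "(\<lambda>a. a) -` T \<inter> space ?M \<in> sets ?M"
    using T(1) by (intro measurable_sets) auto
  then show ?thesis by (simp add: T(2) space_product)
qed

section \<open>Near minimizers of penalized functionals and uniform lower bounds\<close>

lemma near_minimizer:
  fixes q :: "'b \<Rightarrow> real"
  assumes "\<And>t. c \<le> q t" "\<tau> > 0"
  shows "\<exists>t. \<forall>t'. q t \<le> q t' + \<tau>"
proof -
  have bdd: "bdd_below (range q)" using assms(1) by (auto simp: bdd_below_def)
  have "Inf (range q) < Inf (range q) + \<tau>" using assms(2) by simp
  then obtain t where "q t < Inf (range q) + \<tau>" using cInf_lessD by blast
  moreover have "Inf (range q) \<le> q t'" for t' using bdd by (intro cInf_lower) auto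
  ultimately show ?thesis by (intro exI[of _ t] allI) (smt (verit))
qed

text \<open>The Lipschitz bound lets the functional fall at most linearly, so the penalty wins.
  Comparison with t = 0 bounds the sum of the g (t f) by 1; each other summand is at least
  -B^2/\<epsilon>, and dividing the remaining inequality by |t f| > 1 yields R. The box is the same
  for all functionals with this Lipschitz constant, hence for all k.\<close>

lemma ridge_near_minimizer:
  fixes \<Lambda> :: "('f \<Rightarrow> real) \<Rightarrow> real"
  assumes F: "finite F" and pos: "B > 0" "\<epsilon> > 0" "\<tau> > 0" "\<tau> \<le> 1"
    and Lip: "\<And>t t'. \<Lambda> t' - 2 * B * (\<Sum>f\<in>F. \<bar>t f - t' f\<bar>) \<le> \<Lambda> t"
  defines "R \<equiv> max 1 ((2 * B + 1 + real (card F) * (B\<^sup>2 / \<epsilon>)) / \<epsilon>)"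
  shows "\<exists>t. (\<forall>t'. \<Lambda> t + \<epsilon> * (\<Sum>f\<in>F. (t f)\<^sup>2) \<le> \<Lambda> t' + \<epsilon> * (\<Sum>f\<in>F. (t' f)\<^sup>2) + \<tau>) \<and> (\<forall>f\<in>F. \<bar>t f\<bar> \<le> R)"
proof -
  define q where "q t = \<Lambda> t + \<epsilon> * (\<Sum>f\<in>F. (t f)\<^sup>2)" for t
  define g where "g x = \<epsilon> * x\<^sup>2 - 2 * B * \<bar>x\<bar>" for x :: real
  have g_ge: "- (B\<^sup>2 / \<epsilon>) \<le> g x" for x
  proof -
    have "g x + B\<^sup>2 / \<epsilon> = \<epsilon> * (\<bar>x\<bar> - B / \<epsilon>)\<^sup>2"
      using pos by (simp add: g_def power2_eq_square field_simps)
    also have "\<dots> \<ge> 0" using pos by simp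
    finally show ?thesis by simp
  qed
  have q_ge: "\<Lambda> (\<lambda>_. 0) + (\<Sum>f\<in>F. g (t f)) \<le> q t" for t
    using Lip[of "\<lambda>_. 0" t] by (simp add: q_def g_def sum_subtractf sum_distrib_left)
  have "\<Lambda> (\<lambda>_. 0) - real (card F) * (B\<^sup>2 / \<epsilon>) \<le> q t" for t
    using q_ge[of t] sum_mono[of F "\<lambda>_. - (B\<^sup>2 / \<epsilon>)" "\<lambda>f. g (t f)"] g_ge by simp
  then obtain t where t: "\<And>t'. q t \<le> q t' + \<tau>"
    using near_minimizer[of _ q \<tau>] pos(3) by blast
  have "\<bar>t f\<bar> \<le> R" if f: "f \<in> F" for f
  proof (cases "\<bar>t f\<bar> \<le> 1")
    case False
    let ?c = "1 + real (card F) * (B\<^sup>2 / \<epsilon>)"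
    have "(\<Sum>f\<in>F. g (t f)) \<le> 1"
      using q_ge[of t] t[of "\<lambda>_. 0"] pos by (simp add: q_def)
    moreover have "(\<Sum>f\<in>F. g (t f)) = g (t f) + (\<Sum>f\<in>F - {f}. g (t f))"
      using F f by (rule sum.remove)
    moreover have "- (real (card (F - {f})) * (B\<^sup>2 / \<epsilon>)) \<le> (\<Sum>f\<in>F - {f}. g (t f))"
      using sum_mono[of "F - {f}" "\<lambda>_. - (B\<^sup>2 / \<epsilon>)" "\<lambda>f. g (t f)"] g_ge by simp
    moreover have "real (card (F - {f})) * (B\<^sup>2 / \<epsilon>) \<le> real (card F) * (B\<^sup>2 / \<epsilon>)"
      using F pos by (intro mult_right_mono) (auto simp: card_Diff_subset_Int intro: card_mono)
    ultimately have "g (t f) \<le> ?c" by linarith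
    also have "\<dots> \<le> ?c * \<bar>t f\<bar>"
      using False pos mult_left_mono[of 1 "\<bar>t f\<bar>" ?c] by simp
    finally have "\<epsilon> * \<bar>t f\<bar> * \<bar>t f\<bar> \<le> (2 * B + ?c) * \<bar>t f\<bar>"
      by (simp add: g_def power2_eq_square algebra_simps)
    then have "\<epsilon> * \<bar>t f\<bar> \<le> 2 * B + ?c" using False by (auto simp: mult_le_cancel_right)
    then have "\<bar>t f\<bar> \<le> (2 * B + ?c) / \<epsilon>" using pos by (simp add: pos_le_divide_eq mult.commute)
    then show ?thesis by (simp add: R_def add.assoc)
  qed (simp add: R_def)
  then show ?thesis using t by (auto simp: q_def)
qed

text \<open>Pointwise bounds hold simultaneously on a finite grid from some k on, and the common
  Lipschitz constant carries them to the whole box.\<close>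

lemma Lipschitz_uniform_lower_bound:
  fixes \<Lambda> :: "nat \<Rightarrow> ('f \<Rightarrow> real) \<Rightarrow> real"
  assumes F: "finite F" and B: "B > 0" and \<eta>: "\<eta> > 0"
    and Lip: "\<forall>\<^sub>F k in sequentially. \<forall>t t'. \<Lambda> k t' - 2 * B * (\<Sum>f\<in>F. \<bar>t f - t' f\<bar>) \<le> \<Lambda> k t"
    and ptw: "\<And>t \<eta>. \<eta> > 0 \<Longrightarrow> \<forall>\<^sub>F k in sequentially. r - \<eta> \<le> \<Lambda> k t"
  shows "\<forall>\<^sub>F k in sequentially. \<forall>t. (\<forall>f\<in>F. \<bar>t f\<bar> \<le> R) \<longrightarrow> r - \<eta> \<le> \<Lambda> k t"
proof -
  \<comment> \<open>The mesh makes the Lipschitz loss at most half of \<eta>; the other half is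
    spent on the grid points. The summand 1 avoids division by 0 when F is empty.\<close>
  define h where "h = \<eta> / (4 * B * (real (card F) + 1))"
  have h: "h > 0" using B \<eta> by (simp add: h_def)
  have h_le: "2 * B * (real (card F) * h) \<le> \<eta> / 2"
  proof -
    have "h * (4 * B * (real (card F) + 1)) = \<eta>"
    proof -
      have "4 * B * (real (card F) + 1) > 0" using B by (intro mult_pos_pos) auto
      then show ?thesis using B by (simp add: h_def)
    qed
    moreover have "2 * B * (real (card F) * h) \<le> 2 * B * ((real (card F) + 1) * h)"
      using B h by (intro mult_left_mono mult_right_mono) auto
    ultimately show ?thesis by (simp add: algebra_simps)
  qed
  \<comment> \<open>The extra 1 accommodates rounding down at the negative end of the box.\<close>
  define M where "M = \<lceil>R / h\<rceil> + 1"
  define grid where "grid = F \<rightarrow>\<^sub>E (\<lambda>z::int. h * of_int z) ` {- M..M}"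
  have "finite grid" unfolding grid_def using F by (intro finite_PiE) auto
  moreover have "\<forall>t\<in>grid. \<forall>\<^sub>F k in sequentially. r - \<eta> / 2 \<le> \<Lambda> k t"
    using ptw[of "\<eta> / 2"] \<eta> by simp
  ultimately have "\<forall>\<^sub>F k in sequentially. \<forall>t\<in>grid. r - \<eta> / 2 \<le> \<Lambda> k t"
    by (rule eventually_ball_finite)
  then show ?thesis using Lip
  proof eventually_elim
    case (elim k)
    show ?case
    proof (intro allI impI)
      fix t assume t: "\<forall>f\<in>F. \<bar>t f\<bar> \<le> R"
      define g where "g = restrict (\<lambda>f. h * of_int \<lfloor>t f / h\<rfloor>) F"
      have floor: "\<bar>t f - h * of_int \<lfloor>t f / h\<rfloor>\<bar> \<le> h" for f
      proof -
        have "of_int \<lfloor>t f / h\<rfloor> \<le> t f / h" "t f / h \<le> of_int \<lfloor>t f / h\<rfloor> + 1"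
          by linarith+
        then have "h * of_int \<lfloor>t f / h\<rfloor> \<le> h * (t f / h)" "h * (t f / h) \<le> h * (of_int \<lfloor>t f / h\<rfloor> + 1)"
          using h by (intro mult_left_mono; simp)+
        moreover have "h * (t f / h) = t f" using h by simp
        ultimately have "h * of_int \<lfloor>t f / h\<rfloor> \<le> t f" "t f \<le> h * of_int \<lfloor>t f / h\<rfloor> + h"
          by (simp_all add: distrib_left)
        then show ?thesis by (simp add: abs_le_iff)
      qed
      have "\<lfloor>t f / h\<rfloor> \<in> {- M..M}" if "f \<in> F" for f
      proof -
        have "\<bar>t f\<bar> / h \<le> R / h" using t that h by (intro divide_right_mono) auto
        then have "\<bar>t f / h\<bar> \<le> R / h" using h by simp
        then show ?thesis unfolding M_def atLeastAtMost_iff by linarith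
      qed
      then have "g \<in> grid" by (auto simp: g_def grid_def)
      then have "r - \<eta> / 2 \<le> \<Lambda> k g" using elim by blast
      moreover have "(\<Sum>f\<in>F. \<bar>t f - g f\<bar>) \<le> real (card F) * h"
        using sum_bounded_above[of F "\<lambda>f. \<bar>t f - g f\<bar>" h] floor by (simp add: g_def)
      then have "2 * B * (\<Sum>f\<in>F. \<bar>t f - g f\<bar>) \<le> 2 * B * (real (card F) * h)"
        using B by (intro mult_left_mono) auto
      moreover have "\<Lambda> k g - 2 * B * (\<Sum>f\<in>F. \<bar>t f - g f\<bar>) \<le> \<Lambda> k t" using elim by blast
      ultimately show "r - \<eta> \<le> \<Lambda> k t" using h_le by linarith
    qed
  qed
qed

section \<open>Concentration and the bounds for the functionals\<close>

context bernstein_markov begin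

text \<open>Makes the normalized logarithm of Z Lipschitz in the sup norm of the weight with
  constant 1, uniformly in k, and transfers positivity of Z between weights.\<close>

lemma Z_le_exp:
  assumes v: "continuous_on K v" and v': "continuous_on K v'"
    and b: "\<And>x. x \<in> K \<Longrightarrow> \<bar>v x - v' x\<bar> \<le> b"
  shows "Z v k \<le> exp (2 * real k * real (N TYPE('n) k) * b) * Z v' k"
proof -
  have "Z v k \<le> (\<integral>a. exp (2 * real k * real (N TYPE('n) k) * b) * (cmod (wVDM v' k a))\<^sup>2
      \<partial>Pi\<^sub>M {..<N TYPE('n) k} (\<lambda>_. \<nu>))"
    unfolding Z_def
  proof (rule integral_mono)
    fix a assume "a \<in> space (Pi\<^sub>M {..<N TYPE('n) k} (\<lambda>_. \<nu>))"
    then have a: "a j \<in> K" if "j < N TYPE('n) k" for j using that by (auto simp: space_product)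
    define X where "X = (\<Sum>j<N TYPE('n) k. v (a j) - v' (a j))"
    have "(\<Sum>j<N TYPE('n) k. - (v (a j) - v' (a j))) \<le> real (card {..<N TYPE('n) k}) * b"
      using b[OF a] by (intro sum_bounded_above) (auto simp: abs_le_iff)
    then have "- X \<le> real (N TYPE('n) k) * b"
      by (simp only: X_def sum_negf card_lessThan)
    then have "2 * real k * - X \<le> 2 * real k * (real (N TYPE('n) k) * b)"
      by (intro mult_left_mono) auto
    then have "- 2 * real k * X \<le> 2 * real k * real (N TYPE('n) k) * b" by simp
    then have "(cmod (wVDM v' k a))\<^sup>2 * exp (- 2 * real k * X)
        \<le> (cmod (wVDM v' k a))\<^sup>2 * exp (2 * real k * real (N TYPE('n) k) * b)"
      by (intro mult_left_mono) auto
    moreover have "(cmod (wVDM v k a))\<^sup>2 = (cmod (wVDM v' k a))\<^sup>2 * exp (- 2 * real k * X)"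
      using cmod_wVDM_add[of v' "\<lambda>x. v x - v' x" k a] by (simp add: X_def)
    ultimately show "(cmod (wVDM v k a))\<^sup>2 \<le> exp (2 * real k * real (N TYPE('n) k) * b) * (cmod (wVDM v' k a))\<^sup>2"
      by (simp only: mult.commute)
  qed (intro integrable_wVDM integrable_mult_right v v')+
  then show ?thesis by (simp add: Z_def)
qed

lemma statistic_measurable:
  fixes f :: "complex ^ 'n \<Rightarrow> real"
  assumes f: "continuous_on K f"
  shows "(\<lambda>a. \<Sum>j<s. f (a j)) \<in> borel_measurable (Pi\<^sub>M {..<s} (\<lambda>_. \<nu>))"
proof (rule borel_measurable_sum)
  fix j assume j: "j \<in> {..<s}"
  show "(\<lambda>a. f (a j)) \<in> borel_measurable (Pi\<^sub>M {..<s} (\<lambda>_. \<nu>))"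
    by (rule measurable_compose[OF measurable_component_singleton[OF j] measurable_continuous[OF f]])
qed

text \<open>
  A Chernoff bound: the assumption on \<open>Z\<close> bounds the Laplace transforms of the sums of \<open>f\<close> under the
  density \<open>|wVDM v k|\<^sup>2 / Z v k\<close>.
\<close>

lemma concentration:
  fixes F :: "(complex ^ 'n \<Rightarrow> real) set"
  assumes v: "continuous_on K v" and F: "finite F" "\<And>f. f \<in> F \<Longrightarrow> continuous_on K f"
    and B: "B > 0" and \<delta>: "0 < \<delta>" "\<delta> \<le> 2 * B" and k: "k \<ge> 1" and Z0: "Z v k > 0"
    and tilt: "\<And>f s. f \<in> F \<Longrightarrow> \<bar>2 * real k * s\<bar> * B \<le> 1 \<Longrightarrow> Z (\<lambda>x. v x - s * f x) k
      \<le> Z v k * exp (2 * real k * s * m f + (2 * real k * s)\<^sup>2 * B\<^sup>2 * real (N TYPE('n) k))"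
    and small: "2 * real (card F) * exp (- (real (N TYPE('n) k) * (\<delta>\<^sup>2 / (4 * B\<^sup>2)))) \<le> 1 / 2"
  defines "good \<equiv> {a \<in> {..<N TYPE('n) k} \<rightarrow>\<^sub>E K.
    \<forall>f\<in>F. \<bar>(\<Sum>j<N TYPE('n) k. f (a j)) - m f\<bar> < \<delta> * real (N TYPE('n) k)}"
  shows "good \<in> sets (Pi\<^sub>M {..<N TYPE('n) k} (\<lambda>_. \<nu>))"
    and "Z v k / 2 \<le> (\<integral>a. indicator good a * (cmod (wVDM v k a))\<^sup>2 \<partial>Pi\<^sub>M {..<N TYPE('n) k} (\<lambda>_. \<nu>))"
proof -
  let ?n = "N TYPE('n) k"
  let ?M = "Pi\<^sub>M {..<N TYPE('n) k} (\<lambda>_. \<nu>)"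
  define S where "S f a = (\<Sum>j<?n. f (a j))" for f :: "complex ^ 'n \<Rightarrow> real" and a
  have S_meas: "S f \<in> borel_measurable ?M" if "f \<in> F" for f
    unfolding S_def[abs_def] by (rule statistic_measurable[OF F(2)[OF that]])
  have "{a \<in> space ?M. \<forall>f\<in>F. \<bar>S f a - m f\<bar> < \<delta> * real ?n} \<in> sets ?M"
  proof (rule sets.sets_Collect_finite_All)
    fix f assume "f \<in> F"
    note [measurable] = S_meas[OF this]
    show "{a \<in> space ?M. \<bar>S f a - m f\<bar> < \<delta> * real ?n} \<in> sets ?M" by measurable
  qed (rule F(1))
  then show good: "good \<in> sets ?M" by (simp add: good_def S_def space_product)
  define w where "w a = (cmod (wVDM v k a))\<^sup>2" for a
  \<comment> \<open>Minimizer of \<sigma>^2 B^2 - \<sigma> \<delta>, with value -\<delta>^2/(4 B^2).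
    The assumption that \<delta> is at most 2B makes this tilt admissible.\<close>
  define \<sigma> where "\<sigma> = \<delta> / (2 * B\<^sup>2)"
  have \<sigma>: "\<sigma> > 0" "\<sigma> * B \<le> 1" using B \<delta> by (simp_all add: \<sigma>_def power2_eq_square)
  have tilted: "integrable ?M (\<lambda>a. w a * exp (\<tau> * S f a)) \<and>
      (\<integral>a. w a * exp (\<tau> * S f a) \<partial>?M) \<le> Z v k * exp (\<tau> * m f + \<sigma>\<^sup>2 * B\<^sup>2 * real ?n)"
    if f: "f \<in> F" and \<tau>: "\<bar>\<tau>\<bar> = \<sigma>" for f \<tau>
  proof -
    define s where "s = \<tau> / (2 * real k)"
    have s: "2 * real k * s = \<tau>" using k by (simp add: s_def)
    have eq: "w a * exp (\<tau> * S f a) = (cmod (wVDM (\<lambda>x. v x - s * f x) k a))\<^sup>2" for a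
      using cmod_wVDM_add[of v "\<lambda>x. - (s * f x)" k a]
      by (simp add: w_def S_def sum_negf sum_distrib_left[symmetric] flip: s mult.assoc)
    have cont: "continuous_on K (\<lambda>x. v x - s * f x)" by (intro continuous_intros v F f)
    have "(\<integral>a. w a * exp (\<tau> * S f a) \<partial>?M) = Z (\<lambda>x. v x - s * f x) k"
      unfolding eq Z_def ..
    also have "\<dots> \<le> Z v k * exp (\<tau> * m f + \<sigma>\<^sup>2 * B\<^sup>2 * real ?n)"
      using tilt[OF f, of s] \<sigma>(2) \<tau> by (simp add: s power2_abs[of \<tau>, symmetric])
    finally show ?thesis unfolding eq using integrable_wVDM[OF cont, of k] by blast
  qed
  have abs_\<sigma>: "\<bar>\<sigma>\<bar> = \<sigma>" "\<bar>- \<sigma>\<bar> = \<sigma>" using \<sigma> by simp_all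
  \<comment> \<open>One summand dominates w on the upper tail of S f, the other on the lower tail.
    Summing over F is the union bound, and \<open>small\<close> makes the bad part at most half of
    Z.\<close>
  define g where "g f a = exp (- \<sigma> * m f - \<sigma> * \<delta> * real ?n) * (w a * exp (\<sigma> * S f a))
      + exp (\<sigma> * m f - \<sigma> * \<delta> * real ?n) * (w a * exp (- \<sigma> * S f a))" for f a
  have g_int: "integrable ?M (g f)" if "f \<in> F" for f
    unfolding g_def[abs_def]
    by (intro Bochner_Integration.integrable_add integrable_mult_right
        conjunct1[OF tilted[OF that abs_\<sigma>(1)]] conjunct1[OF tilted[OF that abs_\<sigma>(2)]])
  have exponent: "\<sigma>\<^sup>2 * B\<^sup>2 * real ?n - \<sigma> * \<delta> * real ?n = - (real ?n * (\<delta>\<^sup>2 / (4 * B\<^sup>2)))"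
    using B by (simp add: \<sigma>_def power2_eq_square field_simps)
  have g_le: "(\<integral>a. g f a \<partial>?M) \<le> 2 * exp (- (real ?n * (\<delta>\<^sup>2 / (4 * B\<^sup>2)))) * Z v k" if f: "f \<in> F" for f
  proof -
    note i1 = conjunct1[OF tilted[OF f abs_\<sigma>(1)]] and i2 = conjunct1[OF tilted[OF f abs_\<sigma>(2)]]
    have "(\<integral>a. g f a \<partial>?M) = exp (- \<sigma> * m f - \<sigma> * \<delta> * real ?n) * (\<integral>a. w a * exp (\<sigma> * S f a) \<partial>?M)
        + exp (\<sigma> * m f - \<sigma> * \<delta> * real ?n) * (\<integral>a. w a * exp (- \<sigma> * S f a) \<partial>?M)"
      unfolding g_def
      by (subst Bochner_Integration.integral_add[OF integrable_mult_right[OF i1] integrable_mult_right[OF i2]])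
        (simp only: Bochner_Integration.integral_mult_right_zero)
    also have "\<dots> \<le> exp (- \<sigma> * m f - \<sigma> * \<delta> * real ?n) * (Z v k * exp (\<sigma> * m f + \<sigma>\<^sup>2 * B\<^sup>2 * real ?n))
        + exp (\<sigma> * m f - \<sigma> * \<delta> * real ?n) * (Z v k * exp (- \<sigma> * m f + \<sigma>\<^sup>2 * B\<^sup>2 * real ?n))"
      by (intro add_mono mult_left_mono conjunct2[OF tilted[OF f abs_\<sigma>(1)]]
          conjunct2[OF tilted[OF f abs_\<sigma>(2)]]) simp_all
    also have "\<dots> = Z v k * exp ((- \<sigma> * m f - \<sigma> * \<delta> * real ?n) + (\<sigma> * m f + \<sigma>\<^sup>2 * B\<^sup>2 * real ?n))
        + Z v k * exp ((\<sigma> * m f - \<sigma> * \<delta> * real ?n) + (- \<sigma> * m f + \<sigma>\<^sup>2 * B\<^sup>2 * real ?n))"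
      unfolding exp_add by (simp only: mult_ac)
    also have "\<dots> = 2 * exp (\<sigma>\<^sup>2 * B\<^sup>2 * real ?n - \<sigma> * \<delta> * real ?n) * Z v k"
      by (simp add: algebra_simps)
    finally show ?thesis unfolding exponent .
  qed
  have w0: "0 \<le> w a" for a by (simp add: w_def)
  have g0: "0 \<le> g f a" for f a using w0 by (simp add: g_def)
  have w_int: "integrable ?M w" unfolding w_def[abs_def] by (rule integrable_wVDM[OF v])
  have ind_int: "integrable ?M (\<lambda>a. indicator good a * w a)"
    using integrable_mult_indicator[OF good w_int] by simp
  have "Z v k = (\<integral>a. w a \<partial>?M)" by (simp add: Z_def w_def)
  also have "\<dots> \<le> (\<integral>a. indicator good a * w a + (\<Sum>f\<in>F. g f a) \<partial>?M)"
  proof (rule integral_mono[OF w_int])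
    show "integrable ?M (\<lambda>a. indicator good a * w a + (\<Sum>f\<in>F. g f a))"
      by (intro Bochner_Integration.integrable_add Bochner_Integration.integrable_sum ind_int g_int)
    fix a assume a: "a \<in> space ?M"
    show "w a \<le> indicator good a * w a + (\<Sum>f\<in>F. g f a)"
    proof (cases "a \<in> good")
      case True
      then show ?thesis using g0 by (simp add: sum_nonneg)
    next
      case False
      then obtain f where f: "f \<in> F" "\<delta> * real ?n \<le> \<bar>S f a - m f\<bar>"
        using a by (auto simp: good_def S_def space_product not_less)
      have "w a \<le> g f a"
      proof (cases "S f a - m f \<ge> 0")
        case True
        have "\<sigma> * (\<delta> * real ?n) \<le> \<sigma> * (S f a - m f)" using f True \<sigma> by (intro mult_left_mono) auto
        then have "1 \<le> exp ((- \<sigma> * m f - \<sigma> * \<delta> * real ?n) + \<sigma> * S f a)" by (simp add: algebra_simps)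
        then have "w a * 1 \<le> w a * exp ((- \<sigma> * m f - \<sigma> * \<delta> * real ?n) + \<sigma> * S f a)"
          using w0 by (intro mult_left_mono)
        also have "\<dots> \<le> g f a" unfolding exp_add g_def using w0[of a] by (simp add: mult_ac)
        finally show ?thesis by simp
      next
        case False
        have "\<sigma> * (\<delta> * real ?n) \<le> \<sigma> * (m f - S f a)" using f False \<sigma> by (intro mult_left_mono) auto
        then have "1 \<le> exp ((\<sigma> * m f - \<sigma> * \<delta> * real ?n) + - \<sigma> * S f a)" by (simp add: algebra_simps)
        then have "w a * 1 \<le> w a * exp ((\<sigma> * m f - \<sigma> * \<delta> * real ?n) + - \<sigma> * S f a)"
          using w0 by (intro mult_left_mono)
        also have "\<dots> \<le> g f a" unfolding exp_add g_def using w0[of a] by (simp add: mult_ac)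
        finally show ?thesis by simp
      qed
      also have "\<dots> \<le> (\<Sum>f\<in>F. g f a)" using F(1) f(1) g0 by (intro member_le_sum) auto
      finally show ?thesis using False by simp
    qed
  qed
  also have "\<dots> = (\<integral>a. indicator good a * w a \<partial>?M) + (\<Sum>f\<in>F. \<integral>a. g f a \<partial>?M)"
    by (subst Bochner_Integration.integral_add[OF ind_int Bochner_Integration.integrable_sum[OF g_int]])
      (simp_all add: Bochner_Integration.integral_sum g_int)
  also have "(\<Sum>f\<in>F. \<integral>a. g f a \<partial>?M) \<le> real (card F) * (2 * exp (- (real ?n * (\<delta>\<^sup>2 / (4 * B\<^sup>2)))) * Z v k)"
    using g_le by (intro sum_bounded_above)
  also have "\<dots> = (2 * real (card F) * exp (- (real ?n * (\<delta>\<^sup>2 / (4 * B\<^sup>2))))) * Z v k" by simp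
  also have "\<dots> \<le> 1 / 2 * Z v k" using small Z0 by (intro mult_right_mono) auto
  finally show "Z v k / 2 \<le> (\<integral>a. indicator good a * (cmod (wVDM v k a))\<^sup>2 \<partial>?M)"
    by (simp add: w_def)
qed

lemma J_le_W:
  assumes v: "continuous_on K v" and G: "openin (weak_star K) G" and k: "k \<ge> 1"
  shows "J K \<nu> (wVDM v) k G \<le> W K (wVDM v) k G"
proof (cases "W K (wVDM v) k G")
  case (real c)
  let ?n = "N TYPE('n) k"
  let ?M = "Pi\<^sub>M {..<N TYPE('n) k} (\<lambda>_. \<nu>)"
  interpret P: prob_space ?M by (rule prob_space_product)
  have n: "?n \<ge> 1" using N_pos[where 'n = 'n, of k] by simp
  have meas: "tilde K G ?n \<in> sets ?M" by (rule tilde_measurable[OF G n])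
  have e: "real k * real ?n > 0" using k n by simp
  have bound: "cmod (wVDM v k a) \<le> c powr (real k * real ?n)" if a: "a \<in> tilde K G ?n" for a
  proof -
    have "ennreal (cmod (wVDM v k a) powr (1 / (real k * real ?n))) \<le> W K (wVDM v) k G"
      unfolding W_def using a by (rule SUP_upper)
    then have "cmod (wVDM v k a) powr (1 / (real k * real ?n)) \<le> c"
      using real by (simp add: ennreal_le_iff)
    then have "(cmod (wVDM v k a) powr (1 / (real k * real ?n))) powr (real k * real ?n)
        \<le> c powr (real k * real ?n)"
      using e by (intro powr_mono2) auto
    then show ?thesis using k n by (auto simp: powr_powr split: if_splits)
  qed
  have "(\<integral>a. indicator (tilde K G ?n) a *\<^sub>R (cmod (wVDM v k a))\<^sup>2 \<partial>?M) \<le> (c powr (real k * real ?n))\<^sup>2"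
    using bound by (intro P.integral_le_const integrable_mult_indicator[OF meas] integrable_wVDM v AE_I2)
      (auto simp: indicator_def intro!: power_mono)
  then have "(LINT a:tilde K G ?n|?M. (cmod (wVDM v k a))\<^sup>2) powr (1 / (2 * real k * real ?n))
      \<le> ((c powr (real k * real ?n))\<^sup>2) powr (1 / (2 * real k * real ?n))"
    unfolding set_lebesgue_integral_def
    by (intro powr_mono2 integral_nonneg_AE AE_I2) auto
  also have "\<dots> = c"
  proof (cases "c = 0")
    case False
    then have "c > 0" using real(1) by simp
    have "(c powr (real k * real ?n))\<^sup>2 = c powr (real k * real ?n + real k * real ?n)"
      by (simp only: power2_eq_square powr_add)
    also have "real k * real ?n + real k * real ?n = 2 * real k * real ?n" by simp
    finally have "((c powr (real k * real ?n))\<^sup>2) powr (1 / (2 * real k * real ?n))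
        = c powr (2 * real k * real ?n * (1 / (2 * real k * real ?n)))"
      by (simp only: powr_powr)
    also have "2 * real k * real ?n * (1 / (2 * real k * real ?n)) = 1" using k n by simp
    finally show ?thesis using \<open>c > 0\<close> by simp
  qed simp
  finally show ?thesis unfolding J_def real(2) by (rule ennreal_leI)
qed simp

section \<open>The lower bound for J by tilting the weight\<close>

definition tilt :: "(complex ^ 'n \<Rightarrow> real) \<Rightarrow> (complex ^ 'n \<Rightarrow> real) set \<Rightarrow>
    ((complex ^ 'n \<Rightarrow> real) \<Rightarrow> real) \<Rightarrow> complex ^ 'n \<Rightarrow> real" where
  "tilt Q F t x = Q x + (\<Sum>f\<in>F. t f * f x)"

lemma continuous_on_tilt:
  "continuous_on K Q \<Longrightarrow> (\<And>f. f \<in> F \<Longrightarrow> continuous_on K f) \<Longrightarrow> continuous_on K (tilt Q F t)"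
  unfolding tilt_def by (intro continuous_intros)

lemma tilt_diff_bound:
  assumes "\<And>f. f \<in> F \<Longrightarrow> \<bar>f x\<bar> \<le> B"
  shows "\<bar>tilt Q F t x - tilt Q F t' x\<bar> \<le> B * (\<Sum>f\<in>F. \<bar>t f - t' f\<bar>)"
proof -
  have "tilt Q F t x - tilt Q F t' x = (\<Sum>f\<in>F. (t f - t' f) * f x)"
    by (simp add: tilt_def left_diff_distrib sum_subtractf)
  also have "\<bar>\<dots>\<bar> \<le> (\<Sum>f\<in>F. \<bar>t f - t' f\<bar> * B)"
    using assms by (intro order_trans[OF sum_abs] sum_mono) (simp add: abs_mult mult_left_mono)
  finally show ?thesis by (simp add: sum_distrib_left mult.commute)
qed

text \<open>
  One step of the lower bound: \<open>t\<close> almost minimizes the ridge-regularized functional, so the tilted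
  measure has the right means up to \<open>2 \<epsilon> t\<close>, and by concentration it charges \<open>tilde K G\<close>. The
  regularization enters the final estimate with the favourable sign.
\<close>

lemma J_lower_step:
  fixes F :: "(complex ^ 'n \<Rightarrow> real) set" and Q :: "complex ^ 'n \<Rightarrow> real"
    and q :: "(complex ^ 'n \<Rightarrow> real) \<Rightarrow> real"
  defines "n \<equiv> N TYPE('n)"
  defines "\<Lambda> \<equiv> \<lambda>k t. ln (Z (tilt Q F t) k) / (2 * real k * real (n k)) + (\<Sum>f\<in>F. t f * q f)"
  assumes Q: "continuous_on K Q" and F: "finite F" "\<And>f. f \<in> F \<Longrightarrow> continuous_on K f"
    and B: "B > 0" "\<And>f x. f \<in> F \<Longrightarrow> x \<in> K \<Longrightarrow> \<bar>f x\<bar> \<le> B"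
    and k: "k \<ge> 1" and Zpos: "\<And>t. Z (tilt Q F t) k > 0"
    and pos: "\<epsilon> > 0" "\<theta> > 0" "\<theta> \<le> 2 * B" "s > 0" and s: "2 * real k * s * B \<le> 1"
    and \<tau>: "(2 * real k * B\<^sup>2 + \<epsilon>) * s\<^sup>2 + \<tau> \<le> \<theta> * s"
    and min: "\<And>t'. \<Lambda> k t + \<epsilon> * (\<Sum>f\<in>F. (t f)\<^sup>2) \<le> \<Lambda> k t' + \<epsilon> * (\<Sum>f\<in>F. (t' f)\<^sup>2) + \<tau>"
    and R: "\<And>f. f \<in> F \<Longrightarrow> \<bar>t f\<bar> \<le> R"
    and small: "2 * real (card F) * exp (- (real (n k) * (\<theta>\<^sup>2 / (4 * B\<^sup>2)))) \<le> 1 / 2"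
    and G: "openin (weak_star K) G"
    and GF: "{\<sigma> \<in> prob_measures K. \<forall>f\<in>F. \<bar>(\<integral>x. f x \<partial>\<sigma>) - q f\<bar> < \<epsilon>0} \<subseteq> G"
    and \<epsilon>0: "\<And>f. f \<in> F \<Longrightarrow> 2 * \<theta> + 2 * \<epsilon> * \<bar>t f\<bar> \<le> \<epsilon>0"
  shows "ennreal (exp (\<Lambda> k t - 2 * real (card F) * R * \<theta> - ln 2 / (2 * real k * real (n k))))
    \<le> J K \<nu> (wVDM Q) k G"
proof -
  let ?n = "n k"
  let ?M = "Pi\<^sub>M {..<N TYPE('n) k} (\<lambda>_. \<nu>)"
  define V where "V = tilt Q F"
  have n: "?n \<ge> 1" using N_pos[where 'n = 'n, of k] by (simp add: n_def)
  define E where "E = 2 * real k * real ?n"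
  have E: "E > 0" using k n by (simp add: E_def)
  have V: "continuous_on K (V t)" for t
    unfolding V_def by (intro continuous_on_tilt Q F)
  have "\<forall>f\<in>F. \<exists>m. \<forall>s. \<bar>2 * real k * s\<bar> * B \<le> 1 \<longrightarrow> Z (\<lambda>x. V t x - s * f x) k
      \<le> Z (V t) k * exp (2 * real k * s * m + (2 * real k * s)\<^sup>2 * B\<^sup>2 * real ?n)"
    unfolding n_def
    by (intro ballI Z_tilt V F B(2)) (use B(1) Zpos in \<open>simp_all add: V_def\<close>)
  from bchoice[OF this] obtain m where "\<forall>f\<in>F. \<forall>s. \<bar>2 * real k * s\<bar> * B \<le> 1 \<longrightarrow> Z (\<lambda>x. V t x - s * f x) k
      \<le> Z (V t) k * exp (2 * real k * s * m f + (2 * real k * s)\<^sup>2 * B\<^sup>2 * real ?n)" ..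
  note m = this[rule_format]
  \<comment> \<open>First order condition without derivatives: up to second order terms, moving t f
    by -\<sigma> changes the penalized functional by at most -\<sigma> times the bracket. Near
    minimality bounds \<sigma> times the bracket by the error terms, which \<open>\<tau>\<close>
    keeps below \<theta> s.\<close>
  have mean1: "\<sigma> * (q f + 2 * \<epsilon> * t f - m f / real ?n) \<le> \<theta> * s" if f: "f \<in> F" and \<sigma>: "\<bar>\<sigma>\<bar> = s" for f \<sigma>
  proof -
    \<comment> \<open>The minus sign matches the form v - s u of the tilted weights in
      \<open>Z_tilt\<close>.\<close>
    define t' where "t' = t(f := t f - \<sigma>)"
    have upd: "(\<Sum>g\<in>F. h (t' g) g) = (\<Sum>g\<in>F. h (t g) g) + (h (t f - \<sigma>) f - h (t f) f)" for h :: "real \<Rightarrow> (complex ^ 'n \<Rightarrow> real) \<Rightarrow> real"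
    proof -
      have "(\<Sum>g\<in>F - {f}. h (t' g) g) = (\<Sum>g\<in>F - {f}. h (t g) g)"
        by (intro sum.cong) (auto simp: t'_def)
      then show ?thesis using F(1) f by (simp add: sum.remove[of F f] t'_def)
    qed
    have V': "V t' = (\<lambda>x. V t x - \<sigma> * f x)"
      using upd[of "\<lambda>c g. c * g x" for x] by (simp add: V_def tilt_def fun_eq_iff algebra_simps)
    have "\<bar>2 * real k * \<sigma>\<bar> * B \<le> 1" using s \<sigma> by (simp add: abs_mult)
    from m[OF f this] have "Z (V t') k \<le> Z (V t) k * exp (2 * real k * \<sigma> * m f + (2 * real k * \<sigma>)\<^sup>2 * B\<^sup>2 * real ?n)"
      by (simp only: V')
    then have "ln (Z (V t') k) \<le> ln (Z (V t) k * exp (2 * real k * \<sigma> * m f + (2 * real k * \<sigma>)\<^sup>2 * B\<^sup>2 * real ?n))"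
      using Zpos[of t'] by (intro ln_mono) (simp_all add: V_def)
    also have "\<dots> = ln (Z (V t) k) + (2 * real k * \<sigma> * m f + (2 * real k * \<sigma>)\<^sup>2 * B\<^sup>2 * real ?n)"
      using Zpos[of t] by (subst ln_mult) (simp_all add: V_def)
    finally have "ln (Z (V t') k) / E
        \<le> (ln (Z (V t) k) + (2 * real k * \<sigma> * m f + (2 * real k * \<sigma>)\<^sup>2 * B\<^sup>2 * real ?n)) / E"
      using E by (intro divide_right_mono) auto
    also have "\<dots> = ln (Z (V t) k) / E + \<sigma> * (m f / real ?n) + 2 * real k * B\<^sup>2 * \<sigma>\<^sup>2"
    proof -
      have "2 * real k * \<sigma> * m f / E = \<sigma> * (m f / real ?n)"
        using k n by (simp add: E_def)
      moreover have "(2 * real k * \<sigma>)\<^sup>2 * B\<^sup>2 * real ?n / E = 2 * real k * B\<^sup>2 * \<sigma>\<^sup>2"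
        using k n by (simp add: E_def power2_eq_square)
      ultimately show ?thesis by (simp only: add_divide_distrib add.assoc)
    qed
    finally have "ln (Z (V t') k) / E - ln (Z (V t) k) / E
        \<le> \<sigma> * (m f / real ?n) + 2 * real k * B\<^sup>2 * \<sigma>\<^sup>2" by simp
    moreover have "ln (Z (V t) k) / E + (\<Sum>f\<in>F. t f * q f) + \<epsilon> * (\<Sum>f\<in>F. (t f)\<^sup>2)
        \<le> ln (Z (V t') k) / E + (\<Sum>f\<in>F. t' f * q f) + \<epsilon> * (\<Sum>f\<in>F. (t' f)\<^sup>2) + \<tau>"
      using min[of t'] by (simp add: \<Lambda>_def V_def E_def)
    moreover have "(\<Sum>f\<in>F. t' f * q f) = (\<Sum>f\<in>F. t f * q f) - \<sigma> * q f"
      using upd[of "\<lambda>c g. c * q g"] by (simp add: algebra_simps)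
    moreover have "\<epsilon> * (\<Sum>f\<in>F. (t' f)\<^sup>2) = \<epsilon> * (\<Sum>f\<in>F. (t f)\<^sup>2) - 2 * \<epsilon> * \<sigma> * t f + \<epsilon> * \<sigma>\<^sup>2"
    proof -
      have sq: "(\<Sum>f\<in>F. (t' f)\<^sup>2) = (\<Sum>f\<in>F. (t f)\<^sup>2) - 2 * \<sigma> * t f + \<sigma>\<^sup>2"
        using upd[of "\<lambda>c g. c\<^sup>2"] by (simp add: power2_diff)
      show ?thesis unfolding sq by (simp add: algebra_simps)
    qed
    ultimately have "\<sigma> * q f + 2 * \<epsilon> * \<sigma> * t f - \<sigma> * (m f / real ?n)
        \<le> 2 * real k * B\<^sup>2 * \<sigma>\<^sup>2 + \<epsilon> * \<sigma>\<^sup>2 + \<tau>" by linarith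
    also have "\<sigma>\<^sup>2 = s\<^sup>2" using \<sigma> by (metis power2_abs)
    also have "2 * real k * B\<^sup>2 * s\<^sup>2 + \<epsilon> * s\<^sup>2 + \<tau> \<le> \<theta> * s" using \<tau> by (simp add: distrib_right)
    finally show ?thesis by (simp add: algebra_simps)
  qed
  \<comment> \<open>Both signs of the displacement are used, which turns the one-sided inequality
    into an estimate of the absolute value.\<close>
  have mean: "\<bar>q f + 2 * \<epsilon> * t f - m f / real ?n\<bar> \<le> \<theta>" if f: "f \<in> F" for f
  proof -
    define X where "X = q f + 2 * \<epsilon> * t f - m f / real ?n"
    have "s * X \<le> \<theta> * s" "(- s) * X \<le> \<theta> * s"
      unfolding X_def by (rule mean1[OF f]; use pos(4) in simp)+
    then have "s * X \<le> s * \<theta>" "s * - X \<le> s * \<theta>" by (simp_all add: mult.commute)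
    then have "X \<le> \<theta>" "- X \<le> \<theta>"
      using pos(4) by (simp_all only: mult_le_cancel_left_pos)
    then have "\<bar>X\<bar> \<le> \<theta>" by (rule abs_leI)
    then show ?thesis unfolding X_def .
  qed
  define good where "good = {a \<in> {..<N TYPE('n) k} \<rightarrow>\<^sub>E K.
    \<forall>f\<in>F. \<bar>(\<Sum>j<N TYPE('n) k. f (a j)) - m f\<bar> < \<theta> * real (N TYPE('n) k)}"
  note conc = concentration[OF V F B(1) pos(2,3) k Zpos[of t, folded V_def] m[unfolded n_def]
      small[unfolded n_def], folded good_def]
  have stat: "\<bar>(\<Sum>j<?n. f (a j)) / real ?n - (q f + 2 * \<epsilon> * t f)\<bar> < 2 * \<theta>" if a: "a \<in> good" and f: "f \<in> F" for a f
  proof -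
    have "\<bar>(\<Sum>j<?n. f (a j)) - m f\<bar> < \<theta> * real ?n" using a f by (simp add: good_def n_def)
    then have "\<bar>(\<Sum>j<?n. f (a j)) - m f\<bar> / real ?n < \<theta>" using n by (simp add: pos_divide_less_eq)
    then have "\<bar>(\<Sum>j<?n. f (a j)) / real ?n - m f / real ?n\<bar> < \<theta>"
      by (simp add: diff_divide_distrib[symmetric])
    then show ?thesis using mean[OF f] by linarith
  qed
  have good_tilde: "good \<subseteq> tilde K G (N TYPE('n) k)"
  proof
    fix a assume a: "a \<in> good"
    then have aK: "a \<in> {..<?n} \<rightarrow>\<^sub>E K" by (simp add: good_def n_def)
    then have mem: "a j \<in> K" if "j < ?n" for j using that by auto
    have "\<bar>(\<integral>x. f x \<partial>empirical_measure K ?n a) - q f\<bar> < \<epsilon>0" if f: "f \<in> F" for f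
    proof -
      have "\<bar>2 * \<epsilon> * t f\<bar> = 2 * \<epsilon> * \<bar>t f\<bar>" using pos by (simp add: abs_mult)
      moreover have "(\<integral>x. f x \<partial>empirical_measure K ?n a) = (\<Sum>j<?n. f (a j)) / real ?n"
        by (rule integral_empirical_measure) (use n mem F(2)[OF f] in auto)
      ultimately show ?thesis using stat[OF a f] \<epsilon>0[OF f] by linarith
    qed
    moreover have "empirical_measure K ?n a \<in> prob_measures K"
      using n mem by (intro empirical_measure_in_prob_measures) auto
    ultimately have "empirical_measure K ?n a \<in> G"
      by (intro subsetD[OF GF]) simp
    then show "a \<in> tilde K G (N TYPE('n) k)" using aK by (simp add: tilde_def n_def)
  qed
  \<comment> \<open>Lower bound, on \<open>good\<close>, for the exponent in the passage from the
    weight \<open>V t\<close> back to Q. The loss comes from |t f| at most R and the deviation 2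
    \<theta> of the statistics; the shift 2 \<epsilon> t f contributes a square times 2 \<epsilon>
    and is dropped.\<close>
  define D where "D = E * ((\<Sum>f\<in>F. t f * q f) - 2 * real (card F) * R * \<theta>)"
  have le: "indicator good a * (cmod (wVDM (V t) k a))\<^sup>2 * exp D
      \<le> indicator (tilde K G (N TYPE('n) k)) a * (cmod (wVDM Q k a))\<^sup>2" for a
  proof (cases "a \<in> good")
    case True
    define g where "g x = (\<Sum>f\<in>F. t f * f x)" for x
    have "(\<Sum>f\<in>F. t f * q f) - 2 * real (card F) * R * \<theta> = (\<Sum>f\<in>F. t f * q f - R * (2 * \<theta>))"
      by (simp add: sum_subtractf)
    also have "\<dots> \<le> (\<Sum>f\<in>F. t f * ((\<Sum>j<?n. f (a j)) / real ?n))"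
    proof (rule sum_mono)
      fix f assume f: "f \<in> F"
      define e where "e = (\<Sum>j<?n. f (a j)) / real ?n - (q f + 2 * \<epsilon> * t f)"
      have "\<bar>t f * e\<bar> \<le> R * (2 * \<theta>)"
        unfolding abs_mult using R[OF f] stat[OF True f] by (intro mult_mono) (auto simp: e_def)
      moreover have "0 \<le> 2 * \<epsilon> * (t f * t f)" using pos by simp
      moreover have "t f * ((\<Sum>j<?n. f (a j)) / real ?n) = t f * q f + 2 * \<epsilon> * (t f * t f) + t f * e"
        by (simp add: e_def algebra_simps)
      ultimately show "t f * q f - R * (2 * \<theta>) \<le> t f * ((\<Sum>j<?n. f (a j)) / real ?n)" by linarith
    qed
    also have "\<dots> = (\<Sum>f\<in>F. t f * (\<Sum>j<?n. f (a j))) / real ?n" by (simp only: sum_divide_distrib[of _ F] times_divide_eq_right)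
    also have "(\<Sum>f\<in>F. t f * (\<Sum>j<?n. f (a j))) = (\<Sum>j<?n. g (a j))"
      unfolding g_def sum_distrib_left by (rule sum.swap)
    finally have "D \<le> E * ((\<Sum>j<?n. g (a j)) / real ?n)"
      unfolding D_def using E by (intro mult_left_mono) auto
    also have "\<dots> = 2 * real k * (\<Sum>j<?n. g (a j))" using n by (simp add: E_def)
    finally have expD: "exp D \<le> exp (2 * real k * (\<Sum>j<?n. g (a j)))" by simp
    have eq: "(cmod (wVDM (V t) k a))\<^sup>2 = (cmod (wVDM Q k a))\<^sup>2 * exp (- 2 * real k * (\<Sum>j<?n. g (a j)))"
      using cmod_wVDM_add[of Q g k a] by (simp add: V_def tilt_def[abs_def] g_def n_def)
    have "(cmod (wVDM (V t) k a))\<^sup>2 * exp D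
        \<le> (cmod (wVDM (V t) k a))\<^sup>2 * exp (2 * real k * (\<Sum>j<?n. g (a j)))"
      using expD by (intro mult_left_mono) auto
    also have "\<dots> = (cmod (wVDM Q k a))\<^sup>2 *
        (exp (- 2 * real k * (\<Sum>j<?n. g (a j))) * exp (2 * real k * (\<Sum>j<?n. g (a j))))"
      by (simp only: eq mult.assoc)
    also have "\<dots> = (cmod (wVDM Q k a))\<^sup>2" by (simp flip: exp_add)
    finally show ?thesis using True good_tilde by (simp add: subset_iff)
  qed (simp add: indicator_def)
  define A where "A = (LINT a:tilde K G (N TYPE('n) k)|?M. (cmod (wVDM Q k a))\<^sup>2)"
  have meas: "tilde K G (N TYPE('n) k) \<in> sets ?M"
    using n by (intro tilde_measurable G) (simp add: n_def)
  have "Z (V t) k / 2 * exp D \<le> (\<integral>a. indicator good a * (cmod (wVDM (V t) k a))\<^sup>2 \<partial>?M) * exp D"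
    using conc(2) by (intro mult_right_mono) auto
  also have "\<dots> = (\<integral>a. indicator good a * (cmod (wVDM (V t) k a))\<^sup>2 * exp D \<partial>?M)" by simp
  also have "\<dots> \<le> A"
    unfolding A_def set_lebesgue_integral_def real_scaleR_def
  proof (rule integral_mono[OF _ _ le])
    show "integrable ?M (\<lambda>a. indicator good a * (cmod (wVDM (V t) k a))\<^sup>2 * exp D)"
      using integrable_mult_indicator[OF conc(1) integrable_wVDM[OF V, of k t]] by simp
    show "integrable ?M (\<lambda>a. indicator (tilde K G (N TYPE('n) k)) a * (cmod (wVDM Q k a))\<^sup>2)"
      using integrable_mult_indicator[OF meas integrable_wVDM[OF Q, of k]] by simp
  qed
  finally have A_ge: "Z (V t) k / 2 * exp D \<le> A" .
  \<comment> \<open>The summand ln 2 / E is the price for keeping only half of the mass.\<close>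
  have "Z (V t) k / 2 * exp D = exp (E * (\<Lambda> k t - 2 * real (card F) * R * \<theta> - ln 2 / E))"
  proof -
    have "E * (\<Lambda> k t - 2 * real (card F) * R * \<theta> - ln 2 / E) = (ln (Z (V t) k) - ln 2) + D"
    proof -
      have "\<Lambda> k t = ln (Z (V t) k) / E + (\<Sum>f\<in>F. t f * q f)" by (simp add: \<Lambda>_def V_def E_def)
      then show ?thesis using E by (simp add: D_def field_simps)
    qed
    then show ?thesis using Zpos[of t] by (simp add: exp_add exp_diff V_def)
  qed
  then have "exp (E * (\<Lambda> k t - 2 * real (card F) * R * \<theta> - ln 2 / E)) powr (1 / E) \<le> A powr (1 / E)"
    using A_ge E by (intro powr_mono2) auto
  also have "exp (E * (\<Lambda> k t - 2 * real (card F) * R * \<theta> - ln 2 / E)) powr (1 / E)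
      = exp (\<Lambda> k t - 2 * real (card F) * R * \<theta> - ln 2 / E)"
    using E by (simp add: powr_def)
  finally show ?thesis
    unfolding J_def A_def E_def n_def by (rule ennreal_leI)
qed

lemma transfinite_diameter_nonneg:
  assumes "continuous_on K v"
  shows "0 \<le> transfinite_diameter K v"
  by (rule LIMSEQ_le_const[OF transfinite_diameter_limits(1)[OF assms]]) simp

text \<open>The constants are fixed in this order: G yields the test functions and e0; then
  \<epsilon>, R and \<theta> are chosen independently of k; the displacement s, the tolerance \<tau>
  and the near minimizer t depend on k.\<close>

lemma J_lower_bound:
  assumes Q: "continuous_on K Q" and \<mu>: "\<mu> \<in> prob_measures K" and \<rho>: "\<rho> > 0"
    and le: "\<And>v. continuous_on K v \<Longrightarrow> \<rho> \<le> transfinite_diameter K v * exp ((\<integral>x. v x \<partial>\<mu>) - (\<integral>x. Q x \<partial>\<mu>))"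
    and G: "openin (weak_star K) G" "\<mu> \<in> G"
  shows "ennreal \<rho> \<le> liminf (\<lambda>k. J K \<nu> (wVDM Q) k G)"
proof -
  interpret M: compact_prob K \<mu> by unfold_locales (rule compact, rule \<mu>)
  obtain F e0 where F: "finite F" "\<forall>f\<in>F. continuous_on K f" and e0: "e0 > (0::real)"
    and GF: "{\<sigma> \<in> prob_measures K. \<forall>f\<in>F. \<bar>(\<integral>x. f x \<partial>\<sigma>) - (\<integral>x. f x \<partial>\<mu>)\<bar> < e0} \<subseteq> G"
    using weak_star_neighbourhood[OF G] by auto
  note Fc = F(2)[rule_format]
  have "\<forall>f\<in>F. \<exists>b. b > 0 \<and> (\<forall>x\<in>K. \<bar>f x\<bar> \<le> b)"
  proof
    fix f assume "f \<in> F"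
    from compact_imp_bounded[OF compact_continuous_image[OF Fc[OF this] compact]]
    show "\<exists>b. b > 0 \<and> (\<forall>x\<in>K. \<bar>f x\<bar> \<le> b)"
      by (simp add: bounded_pos)
  qed
  from bchoice[OF this] obtain b where b: "\<forall>f\<in>F. b f > 0 \<and> (\<forall>x\<in>K. \<bar>f x\<bar> \<le> b f)" ..
  define B where "B = 1 + sum b F"
  have "0 \<le> sum b F" using b by (intro sum_nonneg) (simp add: less_imp_le)
  then have B0: "B > 0" by (simp add: B_def)
  have B: "\<bar>f x\<bar> \<le> B" if "f \<in> F" "x \<in> K" for f x
  proof -
    have "b f \<le> sum b F" using b that(1) F(1) by (intro member_le_sum) (simp_all add: less_imp_le)
    then show ?thesis using b that by (fastforce simp: B_def)
  qed
  define q where "q f = (\<integral>x. f x \<partial>\<mu>)" for f :: "complex ^ 'n \<Rightarrow> real"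
  have q: "\<bar>q f\<bar> \<le> B" if "f \<in> F" for f
    unfolding q_def by (rule M.integral_bounded_abs[OF Fc[OF that] B[OF that]])
  define V where "V = tilt Q F"
  have V: "continuous_on K (V t)" for t unfolding V_def by (intro continuous_on_tilt Q Fc)
  have V0: "V (\<lambda>_. 0) = Q" by (simp add: V_def tilt_def fun_eq_iff)
  have V_int: "(\<integral>x. V t x \<partial>\<mu>) = (\<integral>x. Q x \<partial>\<mu>) + (\<Sum>f\<in>F. t f * q f)" for t
  proof -
    have "(\<integral>x. V t x \<partial>\<mu>) = (\<integral>x. Q x \<partial>\<mu>) + (\<integral>x. (\<Sum>f\<in>F. t f * f x) \<partial>\<mu>)"
      unfolding V_def tilt_def
      by (intro Bochner_Integration.integral_add M.integrable_continuous continuous_intros Q Fc)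
    also have "(\<integral>x. (\<Sum>f\<in>F. t f * f x) \<partial>\<mu>) = (\<Sum>f\<in>F. \<integral>x. t f * f x \<partial>\<mu>)"
      by (intro Bochner_Integration.integral_sum M.integrable_continuous continuous_intros Fc)
    finally show ?thesis by (simp add: q_def)
  qed
  have td_pos: "transfinite_diameter K v > 0" if v: "continuous_on K v" for v
    using le[OF v] \<rho> transfinite_diameter_nonneg[OF v] by (cases "transfinite_diameter K v = 0") auto
  define r where "r = ln \<rho>"
  have r_le: "r \<le> ln (transfinite_diameter K (V t)) + (\<Sum>f\<in>F. t f * q f)" for t
  proof -
    have "\<rho> \<le> transfinite_diameter K (V t) * exp (\<Sum>f\<in>F. t f * q f)"
      using le[OF V[of t]] by (simp add: V_int)
    then have "ln \<rho> \<le> ln (transfinite_diameter K (V t) * exp (\<Sum>f\<in>F. t f * q f))"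
      using \<rho> by (intro ln_mono) auto
    also have "\<dots> = ln (transfinite_diameter K (V t)) + (\<Sum>f\<in>F. t f * q f)"
      using td_pos[OF V[of t]] by (simp add: ln_mult)
    finally show ?thesis by (simp add: r_def)
  qed
  \<comment> \<open>Positivity at Q holds for large k because the limit is positive. Passing to
    other tilts by comparison of weights, rather than by their own limits, gives one threshold for
    all t.\<close>
  have Zev: "\<forall>\<^sub>F k in sequentially. k \<ge> 1 \<and> (\<forall>t. Z (V t) k > 0)"
  proof -
    have "\<forall>\<^sub>F k in sequentially. 0 < sqrt (Z Q k) powr (1 / (real k * real (N TYPE('n) k)))"
      by (rule order_tendstoD(1)[OF transfinite_diameter_limits(2)[OF Q] td_pos[OF Q]])
    then show ?thesis using eventually_ge_at_top[of 1]
    proof eventually_elim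
      case (elim k)
      have "Z Q k \<noteq> 0" using elim(1) by auto
      moreover have "0 \<le> Z Q k" unfolding Z_def by simp
      ultimately have ZQ: "0 < Z Q k" by simp
      have "0 < Z (V t) k" for t
      proof -
        have "\<bar>Q x - V t x\<bar> \<le> B * (\<Sum>f\<in>F. \<bar>0 - t f\<bar>)" if "x \<in> K" for x
          using tilt_diff_bound[of F x B Q "\<lambda>_. 0" t] B that by (simp add: V0[unfolded V_def] V_def)
        from Z_le_exp[OF Q V this] have "0 < exp (2 * real k * real (N TYPE('n) k) * (B * (\<Sum>f\<in>F. \<bar>0 - t f\<bar>))) * Z (V t) k"
          using ZQ by (intro less_le_trans[OF ZQ])
        then show ?thesis by (simp add: zero_less_mult_iff)
      qed
      then show ?case using elim(2) by simp
    qed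
  qed
  define E where "E k = 2 * real k * real (N TYPE('n) k)" for k
  have E: "E k > 0" if "k \<ge> 1" for k using that N_pos[where 'n = 'n, of k] by (simp add: E_def)
  define \<Lambda> where "\<Lambda> k t = ln (Z (V t) k) / E k + (\<Sum>f\<in>F. t f * q f)" for k t
  \<comment> \<open>One B comes from the change of weight, the other from the linear term, since the
    means q are bounded by B as well.\<close>
  have Lip: "\<Lambda> k t' - 2 * B * (\<Sum>f\<in>F. \<bar>t f - t' f\<bar>) \<le> \<Lambda> k t"
    if k: "k \<ge> 1 \<and> (\<forall>t. Z (V t) k > 0)" for k t t'
  proof -
    define S where "S = (\<Sum>f\<in>F. \<bar>t f - t' f\<bar>)"
    have S: "(\<Sum>f\<in>F. \<bar>t' f - t f\<bar>) = S" by (simp add: S_def abs_minus_commute)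
    have "\<bar>V t' x - V t x\<bar> \<le> B * S" if "x \<in> K" for x
      using tilt_diff_bound[of F x B Q t' t] B that by (simp add: V_def S)
    from Z_le_exp[OF V V this] have "Z (V t') k \<le> exp (E k * (B * S)) * Z (V t) k"
      by (simp add: E_def)
    then have "ln (Z (V t') k) \<le> ln (exp (E k * (B * S)) * Z (V t) k)"
      using k by (intro ln_mono) auto
    also have "\<dots> = E k * (B * S) + ln (Z (V t) k)"
    proof -
      have "Z (V t) k > 0" using k by blast
      then show ?thesis by (simp add: ln_mult)
    qed
    finally have "ln (Z (V t') k) / E k \<le> (E k * (B * S) + ln (Z (V t) k)) / E k"
      using E k by (intro divide_right_mono) (auto simp: less_imp_le)
    also have "\<dots> = B * S + ln (Z (V t) k) / E k"
      using E[of k] k by (simp add: add_divide_distrib)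
    finally have 1: "ln (Z (V t') k) / E k \<le> B * S + ln (Z (V t) k) / E k" .
    have "(\<Sum>f\<in>F. t' f * q f) - (\<Sum>f\<in>F. t f * q f) = (\<Sum>f\<in>F. (t' f - t f) * q f)"
      by (simp add: left_diff_distrib sum_subtractf)
    also have "\<dots> \<le> (\<Sum>f\<in>F. \<bar>t' f - t f\<bar> * B)"
    proof (rule sum_mono)
      fix f assume "f \<in> F"
      then have "\<bar>(t' f - t f) * q f\<bar> \<le> \<bar>t' f - t f\<bar> * B"
        unfolding abs_mult using q by (intro mult_left_mono) auto
      then show "(t' f - t f) * q f \<le> \<bar>t' f - t f\<bar> * B" by linarith
    qed
    also have "\<dots> = B * S" by (simp add: S[symmetric] sum_distrib_left mult.commute)
    finally show ?thesis using 1 by (simp add: \<Lambda>_def S_def[symmetric])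
  qed
  have lim: "(\<lambda>k. \<Lambda> k t) \<longlonglongrightarrow> ln (transfinite_diameter K (V t)) + (\<Sum>f\<in>F. t f * q f)" for t
  proof -
    have "(\<lambda>k. ln (sqrt (Z (V t) k) powr (1 / (real k * real (N TYPE('n) k))))) \<longlonglongrightarrow> ln (transfinite_diameter K (V t))"
      using td_pos[OF V[of t]] by (intro tendsto_ln transfinite_diameter_limits(2) V) simp
    moreover have "\<forall>\<^sub>F k in sequentially. ln (sqrt (Z (V t) k) powr (1 / (real k * real (N TYPE('n) k))))
        = ln (Z (V t) k) / E k"
      using Zev
    proof eventually_elim
      case (elim k)
      then have "Z (V t) k > 0" by blast
      then show ?case by (simp add: ln_powr ln_sqrt E_def)
    qed
    ultimately have "(\<lambda>k. ln (Z (V t) k) / E k) \<longlonglongrightarrow> ln (transfinite_diameter K (V t))"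
      by (rule Lim_transform_eventually)
    then show ?thesis unfolding \<Lambda>_def by (intro tendsto_intros)
  qed
  have ptw: "\<forall>\<^sub>F k in sequentially. r - \<eta> \<le> \<Lambda> k t" if "\<eta> > 0" for t \<eta>
  proof -
    have "r - \<eta> < ln (transfinite_diameter K (V t)) + (\<Sum>f\<in>F. t f * q f)"
      using r_le[of t] that by simp
    from order_tendstoD(1)[OF lim this] show ?thesis by eventually_elim simp
  qed
  have Lip_ev: "\<forall>\<^sub>F k in sequentially. \<forall>t t'. \<Lambda> k t' - 2 * B * (\<Sum>f\<in>F. \<bar>t f - t' f\<bar>) \<le> \<Lambda> k t"
    using Zev by eventually_elim (intro allI Lip)
  \<comment> \<open>The three \<eta> pay for the lower bound of the free energy on the box, for the
    fluctuation term with \<theta>, and for the factor 1/2 from concentration.\<close>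
  have main: "\<forall>\<^sub>F k in sequentially. ennreal (exp (r - 3 * \<eta>)) \<le> J K \<nu> (wVDM Q) k G" if \<eta>: "\<eta> > 0" for \<eta>
  proof -
    define L0 where "L0 = ln (transfinite_diameter K Q)"
    have L0: "r \<le> L0" using r_le[of "\<lambda>_. 0"] by (simp add: V0 L0_def)
    \<comment> \<open>C bounds the penalty at a near minimizer: at most L0 + 1 from the value at 0,
      plus \<tau> at most 1, minus the lower bound r - 1. Then \<epsilon> C = (e0/8)^2, so
      \<epsilon> (t f)^2 at most C gives \<epsilon> |t f| at most e0/8.\<close>
    define C where "C = L0 - r + 3"
    have C: "C > 0" using L0 by (simp add: C_def)
    define \<epsilon> where "\<epsilon> = e0\<^sup>2 / (64 * C)"
    have \<epsilon>: "\<epsilon> > 0" using e0 C by (simp add: \<epsilon>_def)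
    define R where "R = max 1 ((2 * B + 1 + real (card F) * (B\<^sup>2 / \<epsilon>)) / \<epsilon>)"
    define c where "c = 2 * real (card F) * R"
    have c: "c \<ge> 0" by (simp add: c_def R_def)
    \<comment> \<open>The entries serve the neighbourhood (2 \<theta> is at most e0/2), the
      admissible range of the concentration bound, and the loss c \<theta>.\<close>
    define \<theta> where "\<theta> = min (e0 / 4) (min (2 * B) (\<eta> / (c + 1)))"
    have \<theta>: "\<theta> > 0" "\<theta> \<le> 2 * B" "\<theta> \<le> e0 / 4"
      using e0 B0 \<eta> c by (simp add: \<theta>_def) (simp_all only: \<theta>_def min.cobounded1 min.coboundedI2)
    have c\<theta>: "c * \<theta> \<le> \<eta>"
    proof -
      have "c * \<theta> \<le> (c + 1) * (\<eta> / (c + 1))" using c \<theta>(1) by (intro mult_mono) (auto simp: \<theta>_def)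
      then show ?thesis using c by simp
    qed
    have E2: "\<forall>\<^sub>F k in sequentially. \<forall>t. (\<forall>f\<in>F. \<bar>t f\<bar> \<le> R) \<longrightarrow> r - 1 \<le> \<Lambda> k t"
      by (rule Lipschitz_uniform_lower_bound[OF F(1) B0 _ Lip_ev ptw]) simp_all
    have E3: "\<forall>\<^sub>F k in sequentially. \<forall>t. (\<forall>f\<in>F. \<bar>t f\<bar> \<le> R) \<longrightarrow> r - \<eta> \<le> \<Lambda> k t"
      by (rule Lipschitz_uniform_lower_bound[OF F(1) B0 \<eta> Lip_ev ptw]) simp_all
    have E4: "\<forall>\<^sub>F k in sequentially. \<Lambda> k (\<lambda>_. 0) < L0 + 1"
    proof (rule order_tendstoD(2))
      show "(\<lambda>k. \<Lambda> k (\<lambda>_. 0)) \<longlonglongrightarrow> L0" using lim[of "\<lambda>_. 0"] by (simp add: V0 L0_def)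
    qed simp
    have E5: "\<forall>\<^sub>F k in sequentially.
        2 * real (card F) * exp (- (real (N TYPE('n) k) * (\<theta>\<^sup>2 / (4 * B\<^sup>2)))) < 1 / 2"
    proof -
      define x where "x = \<theta>\<^sup>2 / (4 * B\<^sup>2)"
      have "x > 0" using \<theta> B0 by (simp add: x_def)
      then have "(\<lambda>n. 2 * real (card F) * exp (- (real n * x))) \<longlonglongrightarrow> 0" by real_asymp
      from filterlim_compose[OF this N_at_top[where 'n = 'n]]
      have "(\<lambda>k. 2 * real (card F) * exp (- (real (N TYPE('n) k) * x))) \<longlonglongrightarrow> 0" .
      then show ?thesis unfolding x_def by (rule order_tendstoD(2)) simp
    qed
    have E6: "\<forall>\<^sub>F k in sequentially. ln 2 / real k < \<eta>"
    proof -
      have "(\<lambda>k. ln 2 / real k) \<longlonglongrightarrow> 0" by real_asymp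
      then show ?thesis using \<eta> by (rule order_tendstoD(2))
    qed
    show ?thesis
      using Zev E2 E3 E4 E5 E6
    proof eventually_elim
      case (elim k)
      have k: "k \<ge> 1" and Zk: "\<And>t. Z (V t) k > 0" using elim(1) by auto
      define D where "D = 2 * real k * B\<^sup>2 + \<epsilon>"
      have D: "D > 0" using \<epsilon> by (simp add: D_def add_nonneg_pos)
      \<comment> \<open>The first entry keeps the exponents in the Laplace bound at most 1; the
        second makes the quadratic error at most half of \<theta> s, leaving the other half for
        \<tau>.\<close>
      define s where "s = min (1 / (2 * real k * B)) (\<theta> / (2 * D))"
      have s: "s > 0" using k B0 \<theta> D by (simp add: s_def)
      have s1: "2 * real k * s * B \<le> 1"
      proof -
        have "2 * real k * B * s \<le> 2 * real k * B * (1 / (2 * real k * B))"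
          using B0 by (intro mult_left_mono) (simp_all add: s_def)
        also have "\<dots> = 1" using k B0 by simp
        finally show ?thesis by (simp add: mult_ac)
      qed
      define \<tau> where "\<tau> = min 1 (\<theta> * s / 2)"
      have \<tau>: "\<tau> > 0" "\<tau> \<le> 1" using \<theta> s by (simp_all add: \<tau>_def)
      have D\<tau>: "D * s\<^sup>2 + \<tau> \<le> \<theta> * s"
      proof -
        have "D * s \<le> D * (\<theta> / (2 * D))" using D by (intro mult_left_mono) (simp_all add: s_def)
        then have "D * s * s \<le> \<theta> / 2 * s" using D s by (intro mult_right_mono) simp_all
        moreover have "\<tau> \<le> \<theta> * s / 2" by (simp add: \<tau>_def)
        ultimately show ?thesis by (simp add: power2_eq_square mult.assoc)
      qed
      obtain t where min: "\<forall>t'. \<Lambda> k t + \<epsilon> * (\<Sum>f\<in>F. (t f)\<^sup>2) \<le> \<Lambda> k t' + \<epsilon> * (\<Sum>f\<in>F. (t' f)\<^sup>2) + \<tau>"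
        and tR: "\<forall>f\<in>F. \<bar>t f\<bar> \<le> R"
        using ridge_near_minimizer[where \<Lambda> = "\<Lambda> k", OF F(1) B0 \<epsilon> \<tau> Lip[OF elim(1)]]
        unfolding R_def by blast
      have \<epsilon>t: "\<epsilon> * \<bar>t f\<bar> \<le> e0 / 8" if f: "f \<in> F" for f
      proof -
        have "r - 1 \<le> \<Lambda> k t" using elim(2) tR by blast
        moreover have "\<Lambda> k t + \<epsilon> * (\<Sum>f\<in>F. (t f)\<^sup>2) \<le> \<Lambda> k (\<lambda>_. 0) + \<tau>"
          using min[rule_format, of "\<lambda>_. 0"] by simp
        ultimately have "\<epsilon> * (\<Sum>f\<in>F. (t f)\<^sup>2) \<le> C"
          using elim(4) \<tau>(2) by (simp add: C_def)
        moreover have "\<epsilon> * (t f)\<^sup>2 \<le> \<epsilon> * (\<Sum>f\<in>F. (t f)\<^sup>2)"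
        proof (rule mult_left_mono)
          show "(t f)\<^sup>2 \<le> (\<Sum>f\<in>F. (t f)\<^sup>2)" using F(1) f by (intro member_le_sum) auto
        qed (use \<epsilon> in simp)
        ultimately have "\<epsilon> * (t f)\<^sup>2 \<le> C" by linarith
        then have "\<epsilon> * (\<epsilon> * (t f)\<^sup>2) \<le> \<epsilon> * C" by (rule mult_left_mono) (use \<epsilon> in simp)
        also have "\<epsilon> * C = (e0 / 8)\<^sup>2" using C by (simp add: \<epsilon>_def power_divide)
        also have "\<epsilon> * (\<epsilon> * (t f)\<^sup>2) = (\<epsilon> * \<bar>t f\<bar>)\<^sup>2"
          by (simp only: power_mult_distrib power2_abs power2_eq_square[of \<epsilon>] mult.assoc)
        finally have "(\<epsilon> * \<bar>t f\<bar>)\<^sup>2 \<le> (e0 / 8)\<^sup>2" .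
        then show ?thesis by (rule power2_le_imp_le) (use e0 in simp)
      qed
      have step: "ennreal (exp (\<Lambda> k t - 2 * real (card F) * R * \<theta> - ln 2 / E k)) \<le> J K \<nu> (wVDM Q) k G"
        unfolding \<Lambda>_def V_def E_def
      proof (rule J_lower_step[where Q = Q and F = F and B = B and k = k and \<epsilon> = \<epsilon> and \<theta> = \<theta> and s = s
            and t = t and q = q and \<tau> = \<tau> and R = R and G = G and ?\<epsilon>0.0 = e0])
        show "continuous_on K Q" "finite F" "B > 0" "1 \<le> k" "0 < \<epsilon>" "0 < \<theta>" "\<theta> \<le> 2 * B" "0 < s"
          "2 * real k * s * B \<le> 1" by fact+
        show "continuous_on K f" if "f \<in> F" for f by (rule Fc[OF that])
        show "\<bar>f x\<bar> \<le> B" if "f \<in> F" "x \<in> K" for f x by (rule B[OF that])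
        show "0 < Z (tilt Q F t) k" for t using Zk[of t] by (simp only: V_def)
        show "(2 * real k * B\<^sup>2 + \<epsilon>) * s\<^sup>2 + \<tau> \<le> \<theta> * s" using D\<tau> by (simp only: D_def)
        show "ln (Z (tilt Q F t) k) / (2 * real k * real (N TYPE('n) k)) + (\<Sum>f\<in>F. t f * q f) + \<epsilon> * (\<Sum>f\<in>F. (t f)\<^sup>2)
          \<le> ln (Z (tilt Q F t') k) / (2 * real k * real (N TYPE('n) k)) + (\<Sum>f\<in>F. t' f * q f) + \<epsilon> * (\<Sum>f\<in>F. (t' f)\<^sup>2) + \<tau>" for t'
          using min by (simp only: \<Lambda>_def V_def E_def)
        show "\<bar>t f\<bar> \<le> R" if "f \<in> F" for f using tR that by blast
        show "2 * real (card F) * exp (- (real (N TYPE('n) k) * (\<theta>\<^sup>2 / (4 * B\<^sup>2)))) \<le> 1 / 2"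
          using elim(5) by simp
        show "openin (weak_star K) G" by (rule G(1))
        show "{\<sigma> \<in> prob_measures K. \<forall>f\<in>F. \<bar>(\<integral>x. f x \<partial>\<sigma>) - q f\<bar> < e0} \<subseteq> G"
          using GF by (simp only: q_def)
        show "2 * \<theta> + 2 * \<epsilon> * \<bar>t f\<bar> \<le> e0" if "f \<in> F" for f
          using \<epsilon>t[OF that] \<theta>(3) e0 by simp
      qed
      have "r - \<eta> \<le> \<Lambda> k t" using elim(3) tR by blast
      moreover have "2 * real (card F) * R * \<theta> \<le> \<eta>" using c\<theta> by (simp only: c_def)
      moreover have "ln 2 / E k \<le> \<eta>"
      proof -
        have "real k * 1 \<le> E k"
          unfolding E_def using N_pos[where 'n = 'n, of k] by (simp only: mult.assoc[symmetric] mult.commute[of 2])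
            (intro mult_mono; simp)
        then have "ln 2 / E k \<le> ln 2 / real k" using k by (intro divide_left_mono) auto
        then show ?thesis using elim(6) by linarith
      qed
      ultimately have "exp (r - 3 * \<eta>) \<le> exp (\<Lambda> k t - 2 * real (card F) * R * \<theta> - ln 2 / E k)" by simp
      then show ?case using step by (rule order_trans[OF ennreal_leI])
    qed
  qed
  have "(\<lambda>i. ennreal (exp (r - 3 * (1 / real (Suc i))))) \<longlonglongrightarrow> ennreal (exp (r - 3 * 0))"
    by (intro tendsto_ennrealI tendsto_intros LIMSEQ_Suc[OF lim_1_over_n])
  note LIMSEQ_le_const2[OF this]
  moreover have "ennreal (exp (r - 3 * (1 / real (Suc i)))) \<le> liminf (\<lambda>k. J K \<nu> (wVDM Q) k G)" for i
    using main[of "1 / real (Suc i)"] by (intro Liminf_bounded) simp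
  ultimately have "ennreal (exp (r - 3 * 0)) \<le> liminf (\<lambda>k. J K \<nu> (wVDM Q) k G)"
    by blast
  then show ?thesis using \<rho> by (simp add: r_def)
qed

section \<open>The upper bound for W and the comparison of the four functionals\<close>

lemma upper_W_le:
  assumes Q: "continuous_on K Q" and v: "continuous_on K v" and \<mu>: "\<mu> \<in> prob_measures K"
  shows "upper K (W K (wVDM Q)) \<mu> \<le>
    ennreal (transfinite_diameter K v * exp ((\<integral>x. v x \<partial>\<mu>) - (\<integral>x. Q x \<partial>\<mu>)))"
proof -
  interpret M: compact_prob K \<mu> by unfold_locales (rule compact, rule \<mu>)
  define c where "c = (\<integral>x. v x - Q x \<partial>\<mu>)"
  have c: "c = (\<integral>x. v x \<partial>\<mu>) - (\<integral>x. Q x \<partial>\<mu>)"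
    unfolding c_def by (intro Bochner_Integration.integral_diff M.integrable_continuous v Q)
  have vQ: "continuous_on K (\<lambda>x. v x - Q x)" by (intro continuous_intros v Q)
  have step: "upper K (W K (wVDM Q)) \<mu> \<le> ennreal (transfinite_diameter K v * exp (c + \<epsilon>))" if \<epsilon>: "\<epsilon> > 0" for \<epsilon>
  proof -
    \<comment> \<open>On this neighbourhood the average of v - Q over the points is below c +
      \<epsilon>, so replacing the weight Q by v costs at most the factor exp(kN(c + \<epsilon>)),
      whose normalized root is exp(c + \<epsilon>).\<close>
    define G where "G = {\<sigma> \<in> prob_measures K. \<bar>(\<integral>x. v x - Q x \<partial>\<sigma>) - c\<bar> < \<epsilon>}"
    have G: "openin (weak_star K) G" "\<mu> \<in> G"
      unfolding G_def using openin_weak_star_ball[OF vQ] \<mu> \<epsilon> by (simp_all add: c_def)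
    let ?s = "\<lambda>k. wVDM_sup v k powr (1 / (real k * real (N TYPE('n) k)))"
    have W_le: "W K (wVDM Q) k G \<le> ennreal (?s k * exp (c + \<epsilon>))" if k: "k \<ge> 1" for k
      unfolding W_def
    proof (rule SUP_least, rule ennreal_leI)
      let ?n = "N TYPE('n) k"
      have n: "?n \<ge> 1" using N_pos[where 'n = 'n, of k] by simp
      fix a assume a: "a \<in> tilde K G ?n"
      then have aK: "a \<in> {..<?n} \<rightarrow>\<^sub>E K" and aG: "empirical_measure K ?n a \<in> G" by (simp_all add: tilde_def)
      have mem: "a j \<in> K" if "j < ?n" for j using aK that by auto
      define X where "X = (\<Sum>j<?n. v (a j) - Q (a j))"
      have "(\<integral>x. v x - Q x \<partial>empirical_measure K ?n a) = X / real ?n"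
        unfolding X_def by (rule integral_empirical_measure[OF n _ vQ]) (rule mem)
      then have "X / real ?n < c + \<epsilon>" using aG by (simp add: G_def abs_less_iff)
      then have X: "X \<le> real ?n * (c + \<epsilon>)" using n by (simp add: pos_divide_less_eq mult.commute less_imp_le)
      have "wVDM v k a = wVDM Q k a * of_real (exp (- real k * X))"
        using wVDM_add[of Q "\<lambda>x. v x - Q x" k a] by (simp add: X_def)
      then have "cmod (wVDM v k a) * exp (real k * X) = cmod (wVDM Q k a) * (exp (- real k * X) * exp (real k * X))"
        by (simp add: norm_mult)
      also have "\<dots> = cmod (wVDM Q k a)" by (simp flip: exp_add)
      finally have "cmod (wVDM Q k a) = cmod (wVDM v k a) * exp (real k * X)" by simp
      also have "\<dots> \<le> wVDM_sup v k * exp (real k * (real ?n * (c + \<epsilon>)))"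
        using X by (intro mult_mono wVDM_le_sup[OF v aK] order_trans[OF norm_ge_zero wVDM_le_sup[OF v aK]])
          (auto intro: mult_left_mono)
      finally have "cmod (wVDM Q k a) powr (1 / (real k * real ?n))
          \<le> (wVDM_sup v k * exp (real k * (real ?n * (c + \<epsilon>)))) powr (1 / (real k * real ?n))"
        by (intro powr_mono2) auto
      also have "\<dots> = ?s k * exp (real k * (real ?n * (c + \<epsilon>))) powr (1 / (real k * real ?n))"
        by (intro powr_mult order_trans[OF norm_ge_zero wVDM_le_sup[OF v aK]])
      also have "exp (real k * (real ?n * (c + \<epsilon>))) powr (1 / (real k * real ?n)) = exp (c + \<epsilon>)"
        using k n by (simp add: powr_def)
      finally show "cmod (wVDM Q k a) powr (1 / (real k * real ?n)) \<le> ?s k * exp (c + \<epsilon>)" .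
    qed
    have "upper K (W K (wVDM Q)) \<mu> \<le> limsup (\<lambda>k. W K (wVDM Q) k G)"
      unfolding upper_def by (rule INF_lower) (use G in simp)
    also have "\<dots> \<le> limsup (\<lambda>k. ennreal (?s k * exp (c + \<epsilon>)))"
      using W_le by (intro Limsup_mono eventually_sequentiallyI[of 1])
    also have "\<dots> = ennreal (transfinite_diameter K v * exp (c + \<epsilon>))"
      by (intro lim_imp_Limsup tendsto_ennrealI tendsto_mult tendsto_const transfinite_diameter_limits v) simp
    finally show ?thesis .
  qed
  have "(\<lambda>i. ennreal (transfinite_diameter K v * exp (c + 1 / real (Suc i))))
      \<longlonglongrightarrow> ennreal (transfinite_diameter K v * exp (c + 0))"
    by (intro tendsto_ennrealI tendsto_intros LIMSEQ_Suc[OF lim_1_over_n])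
  note LIMSEQ_le_const[OF this]
  moreover have "upper K (W K (wVDM Q)) \<mu> \<le> ennreal (transfinite_diameter K v * exp (c + 1 / real (Suc i)))" for i
    by (rule step) simp
  ultimately have "upper K (W K (wVDM Q)) \<mu> \<le> ennreal (transfinite_diameter K v * exp (c + 0))"
    by blast
  then show ?thesis by (simp add: c)
qed

text \<open>The infimum is at most the lower J, each lower functional is at most the upper one, each
  J at most the corresponding W, and the upper W at most the infimum; so all agree.\<close>

lemma functionals_eq:
  assumes Q: "continuous_on K Q" and \<mu>: "\<mu> \<in> prob_measures K"
  defines "I \<equiv> INF v\<in>{v. continuous_on K v}.
    ennreal (transfinite_diameter K v * exp ((\<integral>x. v x \<partial>\<mu>) - (\<integral>x. Q x \<partial>\<mu>)))"
  shows "upper K (J K \<nu> (wVDM Q)) \<mu> = I" "upper K (W K (wVDM Q)) \<mu> = I"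
    "lower K (J K \<nu> (wVDM Q)) \<mu> = I" "lower K (W K (wVDM Q)) \<mu> = I"
proof -
  let ?g = "\<lambda>v. transfinite_diameter K v * exp ((\<integral>x. v x \<partial>\<mu>) - (\<integral>x. Q x \<partial>\<mu>))"
  have ev: "\<forall>\<^sub>F k in sequentially. J K \<nu> (wVDM Q) k G \<le> W K (wVDM Q) k G" if "openin (weak_star K) G" for G
    using J_le_W[OF Q that] by (intro eventually_sequentiallyI[of 1])
  have UW: "upper K (W K (wVDM Q)) \<mu> \<le> I"
    unfolding I_def by (intro INF_greatest upper_W_le Q \<mu>) simp
  have UJ: "upper K (J K \<nu> (wVDM Q)) \<mu> \<le> upper K (W K (wVDM Q)) \<mu>"
    unfolding upper_def
  proof (rule INF_mono)
    fix G assume G: "G \<in> {G. openin (weak_star K) G \<and> \<mu> \<in> G}"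
    then have "limsup (\<lambda>k. J K \<nu> (wVDM Q) k G) \<le> limsup (\<lambda>k. W K (wVDM Q) k G)"
      by (intro Limsup_mono ev) simp
    with G show "\<exists>G'\<in>{G. openin (weak_star K) G \<and> \<mu> \<in> G}.
        limsup (\<lambda>k. J K \<nu> (wVDM Q) k G') \<le> limsup (\<lambda>k. W K (wVDM Q) k G)" by (rule bexI[rotated])
  qed
  have LJ: "lower K (J K \<nu> (wVDM Q)) \<mu> \<le> lower K (W K (wVDM Q)) \<mu>"
    unfolding lower_def
  proof (rule INF_mono)
    fix G assume G: "G \<in> {G. openin (weak_star K) G \<and> \<mu> \<in> G}"
    then have "liminf (\<lambda>k. J K \<nu> (wVDM Q) k G) \<le> liminf (\<lambda>k. W K (wVDM Q) k G)"
      by (intro Liminf_mono ev) simp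
    with G show "\<exists>G'\<in>{G. openin (weak_star K) G \<and> \<mu> \<in> G}.
        liminf (\<lambda>k. J K \<nu> (wVDM Q) k G') \<le> liminf (\<lambda>k. W K (wVDM Q) k G)" by (rule bexI[rotated])
  qed
  have LU: "lower K X \<mu> \<le> upper K X \<mu>" for X
    unfolding lower_def upper_def
  proof (rule INF_mono)
    fix G assume G: "G \<in> {G. openin (weak_star K) G \<and> \<mu> \<in> G}"
    have "liminf (\<lambda>k. X k G) \<le> limsup (\<lambda>k. X k G)" by (rule Liminf_le_Limsup) simp
    with G show "\<exists>G'\<in>{G. openin (weak_star K) G \<and> \<mu> \<in> G}. liminf (\<lambda>k. X k G') \<le> limsup (\<lambda>k. X k G)"
      by (rule bexI[rotated])
  qed
  have IJ: "I \<le> lower K (J K \<nu> (wVDM Q)) \<mu>"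
    unfolding lower_def
  proof (rule INF_greatest)
    fix G assume G: "G \<in> {G. openin (weak_star K) G \<and> \<mu> \<in> G}"
    have le: "I \<le> ennreal (?g v)" if "continuous_on K v" for v
      unfolding I_def by (rule INF_lower) (use that in simp)
    have "I \<noteq> \<top>" using le[OF Q] by (auto simp: top_unique)
    then obtain \<rho> where \<rho>: "I = ennreal \<rho>" "\<rho> \<ge> 0" by (cases I) auto
    show "I \<le> liminf (\<lambda>k. J K \<nu> (wVDM Q) k G)"
    \<comment> \<open>A zero infimum makes the bound trivial; otherwise \<rho> is positive and has a
      logarithm.\<close>
    proof (cases "\<rho> = 0")
      case False
      have "\<rho> \<le> ?g v" if v: "continuous_on K v" for v
        using le[OF v] transfinite_diameter_nonneg[OF v] by (simp add: \<rho>(1) ennreal_le_iff)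
      then show ?thesis
        unfolding \<rho>(1) using False \<rho>(2) G by (intro J_lower_bound[OF Q \<mu>]) auto
    qed (simp add: \<rho>)
  qed
  show "upper K (J K \<nu> (wVDM Q)) \<mu> = I" "upper K (W K (wVDM Q)) \<mu> = I"
    "lower K (J K \<nu> (wVDM Q)) \<mu> = I" "lower K (W K (wVDM Q)) \<mu> = I"
    using UW UJ LJ LU[of "J K \<nu> (wVDM Q)"] LU[of "W K (wVDM Q)"] IJ by (auto intro: antisym order_trans)
qed

end

section \<open>The extended logarithm\<close>

lemma elog_ennreal: "r > 0 \<Longrightarrow> elog (ennreal r) = ereal (ln r)"
  by (simp add: elog_def)

lemma elog_le_iff: "elog x \<le> elog y \<longleftrightarrow> x \<le> y"
proof (cases "x = 0 \<or> y = 0 \<or> x = \<infinity> \<or> y = \<infinity>")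
  case True
  then show ?thesis by (auto simp: elog_def top_unique)
next
  case False
  then obtain r s where "x = ennreal r" "r > 0" "y = ennreal s" "s > 0"
    by (cases x; cases y) (auto simp: less_le)
  then show ?thesis by (simp add: elog_ennreal ennreal_le_iff)
qed

lemma surj_elog: "\<exists>x. elog x = y"
proof (cases y)
  case (real r)
  then show ?thesis using elog_ennreal[of "exp r"] by (intro exI[of _ "ennreal (exp r)"]) simp
next
  case PInf
  then show ?thesis by (intro exI[of _ "\<infinity>"]) (simp add: elog_def)
next
  case MInf
  then show ?thesis by (intro exI[of _ 0]) (simp add: elog_def)
qed

text \<open>\<open>elog\<close> is an order isomorphism onto the extended reals, so it commutes with
  arbitrary infima, including those equal to 0 and those over an empty family.\<close>

lemma elog_INF: "elog (INF i\<in>I. f i) = (INF i\<in>I. elog (f i))"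
proof (rule antisym)
  show "elog (INF i\<in>I. f i) \<le> (INF i\<in>I. elog (f i))"
    by (intro INF_greatest) (simp add: elog_le_iff INF_lower)
  obtain x where x: "elog x = (INF i\<in>I. elog (f i))" using surj_elog by blast
  have "elog x \<le> elog (f i)" if "i \<in> I" for i unfolding x using that by (rule INF_lower)
  then have "x \<le> (INF i\<in>I. f i)" by (intro INF_greatest) (simp add: elog_le_iff)
  then show "(INF i\<in>I. elog (f i)) \<le> elog (INF i\<in>I. f i)" by (simp add: elog_le_iff flip: x)
qed

text \<open>For d = 0 both sides are minus infinity, since adding a real number does not change
  it.\<close>

lemma elog_mult_exp:
  assumes "d \<ge> 0"
  shows "elog (ennreal (d * exp c)) = elog (ennreal d) + ereal c"
proof (cases "d = 0")
  case True
  then show ?thesis by (simp add: elog_def)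
next
  case False
  then show ?thesis using assms by (simp add: elog_ennreal ln_mult)
qed

lemma INF_minus_ereal: "(INF i\<in>I. g i - ereal c) = (INF i\<in>I. g i) - ereal c"
proof (rule antisym)
  have "(INF i\<in>I. g i - ereal c) + ereal c \<le> (INF i\<in>I. g i)"
  proof (rule INF_greatest)
    fix i assume "i \<in> I"
    then have "(INF i\<in>I. g i - ereal c) \<le> g i - ereal c" by (rule INF_lower)
    then show "(INF i\<in>I. g i - ereal c) + ereal c \<le> g i" by (simp add: ereal_le_minus)
  qed
  then show "(INF i\<in>I. g i - ereal c) \<le> (INF i\<in>I. g i) - ereal c" by (simp add: ereal_le_minus)
  show "(INF i\<in>I. g i) - ereal c \<le> (INF i\<in>I. g i - ereal c)"
    by (intro INF_greatest ereal_minus_mono INF_lower) auto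
qed

lemma wVDM_zero: "wVDM (\<lambda>_. 0) = VDM"
  by (simp add: wVDM_def fun_eq_iff)

theorem theorem4p6:
  fixes K :: "(complex ^ 'n) set"
    and \<nu> \<mu> :: "(complex ^ 'n) measure"
    and Q :: "complex ^ 'n \<Rightarrow> real"
  assumes "compact K" and "\<not> pluripolar K"
    and "strong_BM K \<nu>"
    and "continuous_on K Q"
    and "\<mu> \<in> prob_measures K"
  shows "(elog (upper K (J K \<nu> VDM) \<mu>) = elog (upper K (W K VDM) \<mu>)
        \<and> elog (upper K (W K VDM) \<mu>) = elog (lower K (J K \<nu> VDM) \<mu>)
        \<and> elog (lower K (J K \<nu> VDM) \<mu>) = elog (lower K (W K VDM) \<mu>)
        \<and> elog (lower K (W K VDM) \<mu>)
          = (INF v\<in>{v. continuous_on K v}.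
               elog (ennreal (transfinite_diameter K v)) + ereal (\<integral>x. v x \<partial>\<mu>)))
      \<and> (elog (upper K (J K \<nu> (wVDM Q)) \<mu>) = elog (upper K (W K (wVDM Q)) \<mu>)
        \<and> elog (upper K (W K (wVDM Q)) \<mu>) = elog (lower K (J K \<nu> (wVDM Q)) \<mu>)
        \<and> elog (lower K (J K \<nu> (wVDM Q)) \<mu>) = elog (lower K (W K (wVDM Q)) \<mu>)
        \<and> elog (lower K (W K (wVDM Q)) \<mu>)
          = (INF v\<in>{v. continuous_on K v}.
               elog (ennreal (transfinite_diameter K v)) + ereal (\<integral>x. v x \<partial>\<mu>))
            - ereal (\<integral>x. Q x \<partial>\<mu>))"
proof -
  interpret bernstein_markov K \<nu> by unfold_locales fact+
  have eq: "elog (INF v\<in>{v. continuous_on K v}.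
      ennreal (transfinite_diameter K v * exp ((\<integral>x. v x \<partial>\<mu>) - (\<integral>x. Q x \<partial>\<mu>))))
    = (INF v\<in>{v. continuous_on K v}.
        elog (ennreal (transfinite_diameter K v)) + ereal (\<integral>x. v x \<partial>\<mu>)) - ereal (\<integral>x. Q x \<partial>\<mu>)" for Q
  proof -
    have "elog (ennreal (transfinite_diameter K v * exp ((\<integral>x. v x \<partial>\<mu>) - (\<integral>x. Q x \<partial>\<mu>))))
        = elog (ennreal (transfinite_diameter K v)) + ereal (\<integral>x. v x \<partial>\<mu>) - ereal (\<integral>x. Q x \<partial>\<mu>)"
      if v: "continuous_on K v" for v
    proof -
      have "elog (ennreal (transfinite_diameter K v * exp ((\<integral>x. v x \<partial>\<mu>) - (\<integral>x. Q x \<partial>\<mu>))))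
          = elog (ennreal (transfinite_diameter K v)) + ereal ((\<integral>x. v x \<partial>\<mu>) - (\<integral>x. Q x \<partial>\<mu>))"
        by (rule elog_mult_exp[OF transfinite_diameter_nonneg[OF v]])
      then show ?thesis by (cases "elog (ennreal (transfinite_diameter K v))") simp_all
    qed
    then have "(INF v\<in>{v. continuous_on K v}.
        elog (ennreal (transfinite_diameter K v * exp ((\<integral>x. v x \<partial>\<mu>) - (\<integral>x. Q x \<partial>\<mu>)))))
      = (INF v\<in>{v. continuous_on K v}.
        elog (ennreal (transfinite_diameter K v)) + ereal (\<integral>x. v x \<partial>\<mu>) - ereal (\<integral>x. Q x \<partial>\<mu>))"
      by (intro INF_cong refl) simp
    then show ?thesis unfolding elog_INF INF_minus_ereal .
  qed
  note main = functionals_eq[OF _ \<open>\<mu> \<in> prob_measures K\<close>]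
  \<comment> \<open>The first chain is the instance with weight 0, where the integral of Q
    disappears.\<close>
  have zero: "x - ereal (\<integral>x. (0 :: real) \<partial>\<mu>) = x" for x by (simp flip: zero_ereal_def)
  show ?thesis
    using main[OF \<open>continuous_on K Q\<close>] main[OF continuous_on_const[of K 0]]
      eq[of Q] eq[of "\<lambda>_. 0"]
    unfolding wVDM_zero zero by simp
qed

end
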